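(* Consider the standard model together with $\mathbf{RandEdge}$ queries, with $n$ known to the algorithm, and let $\varepsilon\in(0,1)$. (a) There is a randomized algorithm that outputs a $(1+\varepsilon)$-approximation to $d$ using $\widetilde{O}\left(\varepsilon^{-2}\min\left(d, \sqrt[3]{n/d}\right)\right)$ queries. In particular, it outputs a $(1+\varepsilon)$-approximation to $d$ using $\widetilde{O}\left(\varepsilon^{-2}n^{1/4}\right)$ queries. (b) Any algorithm in this setting (standard model with $\mathbf{RandEdge}$ queries and known $n$) that outputs a constant factor approximation to $d$ requires $\Omega(n^{1/4})$ queries.
   Context: $G=(V,E)$ is an unknown simple undirected graph with $n=|V|$ vertices and $m=|E|$ edges, no isolated vertices, and average degree $d=2m/n$. An algorithm accesses $G$ only through oracles. $\mathbf{RandVert}()$ returns a uniformly random vertex. $\mathbf{RandNbr}(x)$ returns a uniformly random neighbor of $x$. $\mathbf{Degree}(x)$ returns $\deg(x)$. $\mathbf{Pair}(x,y)$ returns $1$ if $\{x,y\}\in E$ and $0$ otherwise. $\mathbf{RandEdge}()$ returns a uniformly random edge. Each query has unit cost, and the query complexity is the total cost. The standard model gives access to $\mathbf{RandVert}$, $\mathbf{RandNbr}$, $\mathbf{Degree}$ and $\mathbf{Pair}$. A $(1+\varepsilon)$-approximation to $d$ is a value in $[(1-\varepsilon)d,(1+\varepsilon)d]$. A constant factor ($c$-) approximation is a value in $[d/c, cd]$ for a constant $c$. Guarantees of randomized algorithms hold with probability at least $0.99$. $\widetilde{O}(\cdot)$ hides factors polylogarithmic in $n$. *)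

theory Defs
  imports "HOL-Probability.Probability_Mass_Function"
begin

definition simple_graph :: "'v set \<Rightarrow> 'v set set \<Rightarrow> bool" where
  "simple_graph V E \<longleftrightarrow> finite V \<and> V \<noteq> {} \<and> (\<forall>e\<in>E. e \<subseteq> V \<and> card e = 2)"

definition no_isolated_vertices :: "'v set \<Rightarrow> 'v set set \<Rightarrow> bool" where
  "no_isolated_vertices V E \<longleftrightarrow> (\<forall>v\<in>V. \<exists>e\<in>E. v \<in> e)"

definition neighbors :: "'v set set \<Rightarrow> 'v \<Rightarrow> 'v set" where
  "neighbors E x = {y. {x, y} \<in> E}"

definition degree :: "'v set set \<Rightarrow> 'v \<Rightarrow> nat" where
  "degree E x = card (neighbors E x)"

definition average_degree :: "'v set \<Rightarrow> 'v set set \<Rightarrow> real" where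
  "average_degree V E = 2 * real (card E) / real (card V)"

text \<open>
  A randomized query algorithm is a decision tree. A node is an output, an internal random choice
  (which is free), or an oracle query; its continuation receives the random value or the answer.
  All adaptivity is in the continuations, so the algorithm learns about the graph only through
  the answers.
\<close>

datatype 'v algorithm =
    Output real
  | Toss "nat pmf" "nat \<Rightarrow> 'v algorithm"
  | RandVert "'v \<Rightarrow> 'v algorithm"
  | RandNbr 'v "'v option \<Rightarrow> 'v algorithm"
  | Degree 'v "nat \<Rightarrow> 'v algorithm"
  | PairQuery 'v 'v "bool \<Rightarrow> 'v algorithm"
  | RandEdge "'v set \<Rightarrow> 'v algorithm"

text \<open>
  The answer to \<open>RandNbr x\<close> is \<open>Some y\<close> with \<open>y\<close> a uniformly random neighbor of \<open>x\<close>. The answer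
  \<open>None\<close> occurs only if \<open>x\<close> has no neighbor, that is, in graphs without isolated vertices, only
  if \<open>x\<close> is not a vertex.
\<close>

definition random_neighbor :: "'v set set \<Rightarrow> 'v \<Rightarrow> 'v option pmf" where
  "random_neighbor E x =
     (if neighbors E x = {} then return_pmf None
      else map_pmf Some (pmf_of_set (neighbors E x)))"

definition charge :: "(real \<times> nat) pmf \<Rightarrow> (real \<times> nat) pmf" where
  "charge p = map_pmf (\<lambda>(r, t). (r, Suc t)) p"

text \<open>The joint distribution of the output and the number of queries made.\<close>

primrec run :: "'v set \<Rightarrow> 'v set set \<Rightarrow> 'v algorithm \<Rightarrow> (real \<times> nat) pmf" where
  "run V E (Output r) = return_pmf (r, 0)"
| "run V E (Toss p k) = bind_pmf p (\<lambda>i. run V E (k i))"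
| "run V E (RandVert k) = charge (bind_pmf (pmf_of_set V) (\<lambda>x. run V E (k x)))"
| "run V E (RandNbr x k) = charge (bind_pmf (random_neighbor E x) (\<lambda>y. run V E (k y)))"
| "run V E (Degree x k) = charge (run V E (k (degree E x)))"
| "run V E (PairQuery x y k) = charge (run V E (k ({x, y} \<in> E)))"
| "run V E (RandEdge k) = charge (bind_pmf (pmf_of_set E) (\<lambda>e. run V E (k e)))"

text \<open>
  With probability at least 0.99, the output lies in \<open>S\<close> and at most \<open>q\<close> queries are made.
  The query bound is part of the event because it may depend on the unknown graph. For a bound that
  the algorithm knows, this is the same as a worst-case bound: stop after \<open>q\<close> queries.
\<close>

definition outputs_within ::
    "'v set \<Rightarrow> 'v set set \<Rightarrow> 'v algorithm \<Rightarrow> real set \<Rightarrow> real \<Rightarrow> bool" where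
  "outputs_within V E A S q \<longleftrightarrow>
     measure_pmf.prob (run V E A) {(r, t). r \<in> S \<and> real t \<le> q} \<ge> 99 / 100"

definition eps_approximations :: "real \<Rightarrow> real \<Rightarrow> real set" where
  "eps_approximations \<epsilon> d = {(1 - \<epsilon>) * d .. (1 + \<epsilon>) * d}"

definition factor_approximations :: "real \<Rightarrow> real \<Rightarrow> real set" where
  "factor_approximations c d = {d / c .. c * d}"

text \<open>The factors hidden by soft-O notation.\<close>

definition polylog :: "(nat \<Rightarrow> real) \<Rightarrow> bool" where
  "polylog L \<longleftrightarrow> (\<exists>C>0. \<exists>k::nat. \<forall>n. L n = C * ln (real n) ^ k)"

end

theory Submission
  imports Defs
begin

text \<open>
  Upper bound. Let \<open>d\<close> be the average degree and let \<open>x\<close> be a random endpoint of a random edge. The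
  mean of \<open>1 / deg x\<close> is \<open>1 / d\<close>, which gives \<open>d / \<epsilon>\<^sup>2\<close> queries. Otherwise fix a degree threshold
  \<open>\<tau>\<close>. If light vertices carry a constant fraction of the degree sum, this fraction (from random
  edges) and the average light degree (from random vertices, with values at most \<open>\<tau>\<close>) determine \<open>d\<close>
  after about \<open>\<tau> / d\<close> queries. If not, most edges join two heavy vertices; two independent random
  endpoints are then adjacent with probability about \<open>\<tau>\<^sup>2 / (n d)\<close>, and the suitably weighted frequency of
  this event determines \<open>n d\<close>. Both costs are about \<open>root 3 (n / d)\<close> for \<open>\<tau>\<^sup>3 = d\<^sup>2 n\<close>. Budgets are doubled
  until an estimate certifies itself by the size of its sample sums.

  Lower bound. With \<open>s\<close> about \<open>root 4 n\<close>, hide \<open>g\<close> cliques of size \<open>s\<^sup>2\<close> with \<open>g = s\<close> or \<open>g = C s\<close>, so that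
  the average degrees differ by a factor of about \<open>C\<close>. A query hits a clique by a random vertex, or
  hits no clique by a random edge, or meets a seen vertex again, or finds two sampled vertices in
  the same clique, each with probability \<open>O(1 / s)\<close> as long as at most \<open>s\<close> queries are made. Up to these events all answers can be simulated without knowing \<open>g\<close>.
\<close>

section \<open>Expectations of composed distributions\<close>

text \<open>The obstacle in the upper bound is that the right sample size depends on
  \<open>d\<close>. A stage with too few samples must therefore stay silent rather than err, and a
  test on the sample sums achieves this without knowledge of the means. Chebyshev's inequality
  suffices: the failure probability is shared among O(log n) sums, which enlarges each sample by a
  factor O(log n), and this is the only logarithm in the bound.

  The comparison in the lower bound is one-sided. True failure is bounded below by simulated failure
  minus a loss per query, so any part of the probability space may be dropped. The simulated run is
  the same for both values of \<open>g\<close>, while the two target sets are disjoint; its two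
  failure probabilities thus add up to at least 1, whereas a correct algorithm would make both
  small. With \<open>g\<close> cliques of size \<open>D\<close> on \<open>n\<close> vertices and
  \<open>q\<close> queries, the bad events cost about \<open>g * D / n\<close>,
  \<open>n / (g * D ^ 2)\<close>, \<open>q / D\<close> and \<open>1 / g\<close> per query. All are
  O(1 / s) at \<open>g = s\<close>, \<open>D = s ^ 2\<close>, \<open>n = s ^ 4\<close> and
  \<open>q = s\<close>.\<close>

lemma integrable_bounded_pmf:
  fixes h :: "'a \<Rightarrow> real"
  assumes "\<And>x. x \<in> set_pmf p \<Longrightarrow> \<bar>h x\<bar> \<le> B"
  shows "integrable (measure_pmf p) h"
  by (rule measure_pmf.integrable_const_bound[where B = B]) (use assms in \<open>auto simp: AE_measure_pmf_iff\<close>)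

lemma expectation_bind_pmf:
  fixes h :: "'b \<Rightarrow> real"
  assumes "\<And>y. y \<in> set_pmf (bind_pmf p f) \<Longrightarrow> \<bar>h y\<bar> \<le> B"
  shows "measure_pmf.expectation (bind_pmf p f) h
       = measure_pmf.expectation p (\<lambda>x. measure_pmf.expectation (f x) h)"
proof -
  \<comment> \<open>The integral rule for bind asks for a bound valid everywhere, whereas
    \<open>h\<close> is bounded only on the support; cutting it off elsewhere changes no
    expectation.\<close>
  define h' where "h' y = (if y \<in> set_pmf (bind_pmf p f) then h y else 0)" for y
  obtain y0 where "y0 \<in> set_pmf (bind_pmf p f)"
    using set_pmf_not_empty by fastforce
  then have "0 \<le> B" using assms[of y0] by simp
  then have B: "\<bar>h' y\<bar> \<le> B" for y
    using assms by (simp add: h'_def)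
  have "measure_pmf.expectation (bind_pmf p f) h = measure_pmf.expectation (bind_pmf p f) h'"
    by (intro integral_cong_AE) (auto simp: AE_measure_pmf_iff h'_def)
  also have "\<dots> = measure_pmf.expectation p (\<lambda>x. measure_pmf.expectation (f x) h')"
    unfolding measure_pmf_bind
    by (rule integral_bind[where K = "count_space UNIV" and B = B and B' = 1])
       (use B measurable_measure_pmf[of f] in \<open>auto simp: measure_pmf.emeasure_space_1\<close>)
  also have "\<dots> = measure_pmf.expectation p (\<lambda>x. measure_pmf.expectation (f x) h)"
    by (intro integral_cong_AE) (auto simp: AE_measure_pmf_iff h'_def intro!: integral_cong_AE)
  finally show ?thesis .
qed

lemma prob_bind_pmf:
  "measure_pmf.prob (bind_pmf p f) S = measure_pmf.expectation p (\<lambda>x. measure_pmf.prob (f x) S)"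
  using expectation_bind_pmf[of p f "indicator S" 1] by simp

lemma expectation_bind_pmf_finite:
  fixes h :: "'b \<Rightarrow> real"
  assumes "finite (set_pmf (bind_pmf p f))"
  shows "measure_pmf.expectation (bind_pmf p f) h
       = measure_pmf.expectation p (\<lambda>x. measure_pmf.expectation (f x) h)"
  using assms by (intro expectation_bind_pmf[where B = "Max ((\<lambda>y. \<bar>h y\<bar>) ` set_pmf (bind_pmf p f))"] Max_ge) auto

section \<open>Sampling procedures and self-certifying estimates\<close>

definition delay :: "nat \<Rightarrow> (real \<times> nat) pmf \<Rightarrow> (real \<times> nat) pmf" where
  "delay c p = map_pmf (\<lambda>(r, t). (r, t + c)) p"

lemma charge_eq_delay: "charge = delay 1"
  by (simp add: charge_def delay_def fun_eq_iff)

lemma delay_0: "delay 0 p = p"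
  by (simp add: delay_def case_prod_beta)

lemma delay_delay: "delay a (delay b p) = delay (a + b) p"
  by (simp add: delay_def map_pmf_comp case_prod_beta add_ac case_prod_unfold)

lemma delay_bind: "delay c (bind_pmf p f) = bind_pmf p (\<lambda>x. delay c (f x))"
  by (simp add: delay_def map_bind_pmf)

text \<open>
  Algorithms have no result type, so a subroutine with results of type \<open>'a\<close> is written in
  continuation-passing style. It makes exactly \<open>c\<close> queries and its result has distribution \<open>p\<close>.
\<close>

definition samples ::
    "'v set \<Rightarrow> 'v set set \<Rightarrow> (('a \<Rightarrow> 'v algorithm) \<Rightarrow> 'v algorithm) \<Rightarrow> nat \<Rightarrow> 'a pmf \<Rightarrow> bool" where
  "samples V E s c p \<longleftrightarrow> (\<forall>k. run V E (s k) = delay c (bind_pmf p (\<lambda>x. run V E (k x))))"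

lemma samples_return: "samples V E (\<lambda>k. k x) 0 (return_pmf x)"
  by (simp add: samples_def delay_0 bind_return_pmf)

lemma samples_bind:
  assumes "samples V E s c p" "\<And>x. x \<in> set_pmf p \<Longrightarrow> samples V E (t x) c' (q x)"
  shows "samples V E (\<lambda>k. s (\<lambda>x. t x k)) (c + c') (bind_pmf p q)"
  unfolding samples_def
proof
  fix k
  have "run V E (s (\<lambda>x. t x k)) = delay c (bind_pmf p (\<lambda>x. run V E (t x k)))"
    using assms(1) by (simp add: samples_def)
  also have "\<dots> = delay c (bind_pmf p (\<lambda>x. delay c' (bind_pmf (q x) (\<lambda>y. run V E (k y)))))"
    using assms(2) by (intro arg_cong[where f = "delay c"] bind_pmf_cong) (auto simp: samples_def)
  also have "\<dots> = delay (c + c') (bind_pmf (bind_pmf p q) (\<lambda>y. run V E (k y)))"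
    by (simp add: delay_delay delay_bind[symmetric] bind_assoc_pmf)
  finally show "run V E (s (\<lambda>x. t x k)) = \<dots>" .
qed

lemma samples_RandVert: "samples V E RandVert 1 (pmf_of_set V)"
  by (simp add: samples_def charge_eq_delay)

lemma samples_RandEdge: "samples V E RandEdge 1 (pmf_of_set E)"
  by (simp add: samples_def charge_eq_delay)

section \<open>Sums of independent samples and their concentration\<close>

primrec sum_sampler ::
    "((real \<Rightarrow> 'v algorithm) \<Rightarrow> 'v algorithm) \<Rightarrow> nat \<Rightarrow> (real \<Rightarrow> 'v algorithm) \<Rightarrow> 'v algorithm" where
  "sum_sampler s 0 = (\<lambda>k. k 0)"
| "sum_sampler s (Suc n) = (\<lambda>k. s (\<lambda>x. sum_sampler s n (\<lambda>y. k (x + y))))"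

primrec sum_pmf :: "real pmf \<Rightarrow> nat \<Rightarrow> real pmf" where
  "sum_pmf p 0 = return_pmf 0"
| "sum_pmf p (Suc n) = bind_pmf p (\<lambda>x. map_pmf ((+) x) (sum_pmf p n))"

lemma samples_sum_sampler:
  assumes "samples V E s c p"
  shows "samples V E (sum_sampler s n) (n * c) (sum_pmf p n)"
proof (induction n)
  case 0
  then show ?case by (simp add: samples_return)
next
  case (Suc n)
  have "samples V E (\<lambda>k. sum_sampler s n (\<lambda>y. k (x + y))) (n * c) (map_pmf ((+) x) (sum_pmf p n))" for x
    using Suc by (simp add: samples_def bind_map_pmf)
  from samples_bind[OF assms this] show ?case
    by simp
qed

lemma set_sum_pmf:
  assumes "set_pmf p \<subseteq> {0..1}"
  shows "set_pmf (sum_pmf p n) \<subseteq> {0..real n}"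
proof (induction n)
  case (Suc n)
  then show ?case using assms by (fastforce simp: subset_iff)
qed simp

text \<open>Values in the unit interval satisfy \<open>x ^ 2 <= x\<close>, so their variance is at
  most their mean. With such a bound, relative accuracy depends only on the size of the expected
  sum.\<close>

lemma sum_pmf_moments:
  fixes p :: "real pmf" and \<mu> :: real
  assumes "set_pmf p \<subseteq> {0..1}" and \<mu>: "measure_pmf.expectation p (\<lambda>x. x) = \<mu>"
  shows "measure_pmf.expectation (sum_pmf p n) (\<lambda>x. x) = real n * \<mu> \<and>
         measure_pmf.expectation (sum_pmf p n) (\<lambda>x. (x - real n * \<mu>)\<^sup>2) \<le> real n * \<mu>"
proof (induction n)
  case 0
  then show ?case by simp
next
  case (Suc n)
  let ?q = "sum_pmf p n" and ?E = measure_pmf.expectation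
  have p01: "0 \<le> x" "x \<le> 1" if "x \<in> set_pmf p" for x
    using assms that by auto
  have q0n: "0 \<le> x" "x \<le> real n" if "x \<in> set_pmf ?q" for x
    using set_sum_pmf[OF assms(1), of n] that by auto
  have bnd: "\<bar>y\<bar> \<le> real (Suc n)" if "y \<in> set_pmf (sum_pmf p (Suc n))" for y
    using subsetD[OF set_sum_pmf[OF assms(1)] that] by simp
  have ip: "integrable (measure_pmf p) (\<lambda>x. x)"
    by (rule integrable_bounded_pmf[where B = 1]) (use p01 in force)
  have ip2: "integrable (measure_pmf p) (\<lambda>x. (x - \<mu>)\<^sup>2)"
    by (rule integrable_bounded_pmf[where B = "(1 + \<bar>\<mu>\<bar>)\<^sup>2"]) (use p01 in \<open>force intro!: abs_le_square_iff[THEN iffD1]\<close>)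
  have iq: "integrable (measure_pmf ?q) (\<lambda>x. x)"
    by (rule integrable_bounded_pmf[where B = "real n"]) (use q0n in force)
  have iq2: "integrable (measure_pmf ?q) (\<lambda>x. (x - real n * \<mu>)\<^sup>2)"
    by (rule integrable_bounded_pmf[where B = "(real n + \<bar>real n * \<mu>\<bar>)\<^sup>2"]) (use q0n in \<open>force intro!: abs_le_square_iff[THEN iffD1]\<close>)
  have "?E (sum_pmf p (Suc n)) (\<lambda>x. x) = ?E p (\<lambda>x. ?E ?q (\<lambda>y. x + y))"
    by (simp only: sum_pmf.simps, subst expectation_bind_pmf[where B = "real (Suc n)"])
       (use bnd in auto)
  also have "\<dots> = ?E p (\<lambda>x. x + real n * \<mu>)"
    using Suc iq by simp
  also have "\<dots> = real (Suc n) * \<mu>"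
    using ip \<mu> by (simp add: algebra_simps)
  finally have 1: "?E (sum_pmf p (Suc n)) (\<lambda>x. x) = real (Suc n) * \<mu>" .
  have var: "?E p (\<lambda>x. (x - \<mu>)\<^sup>2) \<le> \<mu>"
  proof -
    have "?E p (\<lambda>x. (x - \<mu>)\<^sup>2) \<le> ?E p (\<lambda>x. x - 2 * \<mu> * x + \<mu>\<^sup>2)"
    proof (rule integral_mono_AE)
      show "AE x in measure_pmf p. (x - \<mu>)\<^sup>2 \<le> x - 2 * \<mu> * x + \<mu>\<^sup>2"
      proof (simp add: AE_measure_pmf_iff, intro ballI)
        fix x assume x: "x \<in> set_pmf p"
        have "x * x \<le> x" using p01[OF x] by (simp add: mult_left_le)
        then show "(x - \<mu>)\<^sup>2 \<le> x - 2 * \<mu> * x + \<mu>\<^sup>2"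
          by (simp add: power2_eq_square algebra_simps)
      qed
    qed (use ip ip2 in auto)
    also have "\<dots> = \<mu> - \<mu>\<^sup>2"
      using ip \<mu> by (simp add: power2_eq_square)
    finally show ?thesis using zero_le_power2[of \<mu>] by linarith
  qed
  have "?E (sum_pmf p (Suc n)) (\<lambda>x. (x - real (Suc n) * \<mu>)\<^sup>2)
      = ?E p (\<lambda>x. ?E ?q (\<lambda>y. (x + y - real (Suc n) * \<mu>)\<^sup>2))"
    by (simp only: sum_pmf.simps, subst expectation_bind_pmf[where B = "(real (Suc n) + \<bar>real (Suc n) * \<mu>\<bar>)\<^sup>2"])
       (use bnd in \<open>force intro!: abs_le_square_iff[THEN iffD1]\<close>)+
  also have "\<dots> = ?E p (\<lambda>x. ?E ?q (\<lambda>y. (y - real n * \<mu>)\<^sup>2 + 2 * (x - \<mu>) * (y - real n * \<mu>) + (x - \<mu>)\<^sup>2))"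
    by (simp add: power2_eq_square algebra_simps)
  \<comment> \<open>The cross term integrates to zero over \<open>y\<close>, since
    \<open>real n * \<mu>\<close> is the mean of \<open>?q\<close>.\<close>
  also have "\<dots> = ?E p (\<lambda>x. ?E ?q (\<lambda>y. (y - real n * \<mu>)\<^sup>2) + (x - \<mu>)\<^sup>2)"
    using Suc iq iq2 by simp
  also have "\<dots> = ?E ?q (\<lambda>y. (y - real n * \<mu>)\<^sup>2) + ?E p (\<lambda>x. (x - \<mu>)\<^sup>2)"
    using ip2 by simp
  also have "\<dots> \<le> real (Suc n) * \<mu>"
    using Suc var by (simp add: algebra_simps)
  finally show ?case using 1 by simp
qed

text \<open>Chebyshev with the error measured against \<open>max m T\<close>. The variance is at
  most \<open>m\<close>, which leaves \<open>1 / (\<eta>^2 * max m T)\<close>, and \<open>T\<close>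
  is chosen to make this at most \<open>\<delta>\<close>. The error is relative once the unknown
  \<open>m\<close> reaches \<open>T\<close> and below \<open>\<eta> * T\<close> otherwise, so the
  bound applies without a prior estimate of \<open>m\<close>.\<close>

lemma sum_pmf_concentration:
  fixes p :: "real pmf" and n :: nat
  defines "m \<equiv> n * measure_pmf.expectation p (\<lambda>x. x)"
  assumes "set_pmf p \<subseteq> {0..1}" "0 < \<eta>" "0 < \<delta>" and T: "T = 1 / (\<eta>\<^sup>2 * \<delta>)"
  shows "measure_pmf.prob (sum_pmf p n) {x. \<bar>x - m\<bar> < \<eta> * max m T} \<ge> 1 - \<delta>"
proof -
  let ?q = "sum_pmf p n" and ?M = "max m T"
  have T0: "0 < T" using assms by simp
  have mom: "measure_pmf.expectation ?q (\<lambda>x. x) = m" "measure_pmf.expectation ?q (\<lambda>x. (x - m)\<^sup>2) \<le> m"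
    using sum_pmf_moments[OF assms(2) refl, of n] by (auto simp: m_def)
  have int: "integrable ?q (\<lambda>x. x\<^sup>2)"
  proof (rule integrable_bounded_pmf[where B = "(real n)\<^sup>2"])
    fix x assume "x \<in> set_pmf ?q"
    then have "0 \<le> x" "x \<le> n" using set_sum_pmf[OF assms(2), of n] by auto
    then show "\<bar>x\<^sup>2\<bar> \<le> (real n)\<^sup>2" by (simp add: power_mono)
  qed
  have "measure_pmf.prob ?q {x. \<bar>x - m\<bar> \<ge> \<eta> * ?M} \<le> measure_pmf.expectation ?q (\<lambda>x. (x - m)\<^sup>2) / (\<eta> * ?M)\<^sup>2"
    using measure_pmf.Chebyshev_inequality[of "\<lambda>x. x" ?q "\<eta> * ?M"] int mom(1) \<open>0 < \<eta>\<close> T0 by simp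
  also have "\<dots> \<le> m / (\<eta> * ?M)\<^sup>2"
    using mom by (intro divide_right_mono) auto
  also have "\<dots> \<le> ?M / (\<eta> * ?M)\<^sup>2"
    by (intro divide_right_mono) auto
  also have "\<dots> = 1 / (\<eta>\<^sup>2 * ?M)"
    using T0 \<open>0 < \<eta>\<close> by (simp add: power2_eq_square field_simps)
  also have "\<dots> \<le> 1 / (\<eta>\<^sup>2 * T)"
    using T0 \<open>0 < \<eta>\<close> by (intro divide_left_mono mult_left_mono mult_pos_pos) auto
  also have "\<dots> = \<delta>"
    using assms by simp
  finally have "measure_pmf.prob ?q {x. \<bar>x - m\<bar> \<ge> \<eta> * ?M} \<le> \<delta>" .
  moreover have "{x. \<bar>x - m\<bar> < \<eta> * ?M} = - {x. \<bar>x - m\<bar> \<ge> \<eta> * ?M}"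
    by auto
  ultimately show ?thesis
    using measure_pmf.prob_compl[of "{x. \<bar>x - m\<bar> \<ge> \<eta> * ?M}" ?q] by (simp add: Compl_eq_Diff_UNIV)
qed

section \<open>Composition of success guarantees\<close>

definition ensures ::
    "'v set \<Rightarrow> 'v set set \<Rightarrow> 'v algorithm \<Rightarrow> real set \<Rightarrow> nat \<Rightarrow> real \<Rightarrow> bool" where
  "ensures V E A S q \<delta> \<longleftrightarrow> measure_pmf.prob (run V E A) {(r, t). r \<in> S \<and> t \<le> q} \<ge> 1 - \<delta>"

lemma ensures_Output: "r \<in> S \<Longrightarrow> 0 \<le> \<delta> \<Longrightarrow> ensures V E (Output r) S q \<delta>"
  by (simp add: ensures_def)

lemma ensures_mono:
  assumes "ensures V E A S q \<delta>" "q \<le> q'" "\<delta> \<le> \<delta>'"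
  shows "ensures V E A S q' \<delta>'"
proof -
  have "measure_pmf.prob (run V E A) {(r, t). r \<in> S \<and> t \<le> q} \<le> measure_pmf.prob (run V E A) {(r, t). r \<in> S \<and> t \<le> q'}"
    using assms by (intro measure_pmf.finite_measure_mono) auto
  then show ?thesis using assms by (simp add: ensures_def)
qed

text \<open>Failure budgets add because \<open>(1 - \<delta>') * P\<close> is at least
  \<open>P - \<delta>'\<close> for a probability \<open>P\<close>. Query counts add because a
  sampler makes exactly \<open>c\<close> queries whatever its result.\<close>

lemma ensures_samples:
  assumes s: "samples V E s c p" and G: "measure_pmf.prob p G \<ge> 1 - \<delta>" and "0 \<le> \<delta>'"
    and k: "\<And>x. x \<in> G \<Longrightarrow> ensures V E (k x) S q \<delta>'"
  shows "ensures V E (s k) S (c + q) (\<delta> + \<delta>')"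
proof -
  let ?X = "{(r, t). r \<in> S \<and> t \<le> q}"
  have "1 - (\<delta> + \<delta>') \<le> measure_pmf.prob p G - \<delta>'"
    using G by simp
  also have "\<dots> \<le> measure_pmf.prob p G - \<delta>' * measure_pmf.prob p G"
    using \<open>0 \<le> \<delta>'\<close> by (simp add: mult_left_le)
  also have "\<dots> = measure_pmf.expectation p (\<lambda>x. (1 - \<delta>') * indicator G x)"
    by (subst Bochner_Integration.integral_mult_right_zero) (simp add: algebra_simps)
  also have "\<dots> \<le> measure_pmf.expectation p (\<lambda>x. measure_pmf.prob (run V E (k x)) ?X)"
  proof (rule integral_mono_AE)
    show "AE x in p. (1 - \<delta>') * indicator G x \<le> measure_pmf.prob (run V E (k x)) ?X"
      using k by (auto simp: ensures_def indicator_def)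
    show "integrable p (\<lambda>x. (1 - \<delta>') * indicator G x :: real)"
      by (intro integrable_mult_right integrable_bounded_pmf[where B = 1]) simp
    show "integrable p (\<lambda>x. measure_pmf.prob (run V E (k x)) ?X)"
      by (rule integrable_bounded_pmf[where B = 1]) simp
  qed
  also have "\<dots> = measure_pmf.prob (bind_pmf p (\<lambda>x. run V E (k x))) ?X"
    by (simp add: prob_bind_pmf)
  also have "\<dots> = measure_pmf.prob (run V E (s k)) {(r, t). r \<in> S \<and> t \<le> c + q}"
  proof -
    have "(\<lambda>(r, t). (r, t + c)) -` {(r, t). r \<in> S \<and> t \<le> c + q} = ?X"
      by auto
    then show ?thesis
      using s by (simp add: samples_def delay_def)
  qed
  finally show ?thesis by (simp add: ensures_def)
qed

type_synonym 'v sampler = "(real \<Rightarrow> 'v algorithm) \<Rightarrow> 'v algorithm"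

text \<open>
  Stage \<open>(n, c, a, b)\<close> draws \<open>n\<close> samples from \<open>a\<close> and from \<open>b\<close>, whose means \<open>\<mu>\<close>, \<open>\<nu>\<close> satisfy
  \<open>c * \<mu> = d * \<nu>\<close>. If both sums reach \<open>2 * T\<close> they are relatively concentrated whatever \<open>\<mu>\<close> and
  \<open>\<nu>\<close> are, so the quotient can be trusted although \<open>d\<close> is unknown.
\<close>

primrec first_certified ::
    "real \<Rightarrow> (nat \<times> real \<times> 'v sampler \<times> 'v sampler) list \<Rightarrow> 'v algorithm" where
  "first_certified T [] = Output 0"
| "first_certified T (e # es) = (case e of (n, c, a, b) \<Rightarrow>
     sum_sampler a n (\<lambda>x. sum_sampler b n (\<lambda>y.
       if 2 * T \<le> x \<and> 2 * T \<le> y then Output (c * x / y) else first_certified T es)))"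

text \<open>\<open>c\<close> is stored in the stage and so is known to the algorithm, while
  \<open>\<mu>\<close> and \<open>\<nu>\<close> may depend on the graph; the identity makes
  \<open>c\<close> times the quotient of the sample sums an estimate of \<open>d\<close>. Five
  queries are the cost of the dearest sampler: two edges, two degrees and a pair.\<close>

definition ratio_estimator ::
    "'v set \<Rightarrow> 'v set set \<Rightarrow> real \<Rightarrow> real \<Rightarrow> 'v sampler \<Rightarrow> 'v sampler \<Rightarrow> real \<Rightarrow> real \<Rightarrow> bool" where
  "ratio_estimator V E d c a b \<mu> \<nu> \<longleftrightarrow>
     0 \<le> c \<and> c * \<mu> = d * \<nu> \<and>
     (\<exists>p i. i \<le> 5 \<and> samples V E a i p \<and> set_pmf p \<subseteq> {0..1} \<and> measure_pmf.expectation p (\<lambda>x. x) = \<mu>) \<and>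
     (\<exists>p i. i \<le> 5 \<and> samples V E b i p \<and> set_pmf p \<subseteq> {0..1} \<and> measure_pmf.expectation p (\<lambda>x. x) = \<nu>)"

text \<open>A sum of at least \<open>2 * T\<close> cannot stem from a mean of at most
  \<open>T\<close>, where the deviation stays below \<open>T\<close>. So both errors are relative,
  by less than \<open>\<epsilon> / 3\<close>, and the quotient of two such quantities is accurate up
  to \<open>\<epsilon>\<close>.\<close>

lemma certified_quotient:
  fixes x y c d \<mu> \<nu> \<epsilon> T :: real
  assumes "0 < \<epsilon>" "\<epsilon> < 1" "0 < T" "0 \<le> c" "0 \<le> d" "c * \<mu> = d * \<nu>"
    and x: "\<bar>x - \<mu>\<bar> < \<epsilon> / 3 * max \<mu> T" "2 * T \<le> x"
    and y: "\<bar>y - \<nu>\<bar> < \<epsilon> / 3 * max \<nu> T" "2 * T \<le> y"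
  shows "c * x / y \<in> eps_approximations \<epsilon> d"
proof -
  have big: "T < m" if "\<bar>z - m\<bar> < \<epsilon> / 3 * max m T" "2 * T \<le> z" for z m :: real
  proof (rule ccontr)
    assume "\<not> T < m"
    then have "\<epsilon> / 3 * max m T \<le> 1 * T"
      using assms by (intro mult_mono) auto
    then show False using that \<open>\<not> T < m\<close> by linarith
  qed
  have "T < \<mu>" "T < \<nu>"
    using big x y by blast+
  then have "\<bar>x - \<mu>\<bar> < \<epsilon> / 3 * \<mu>" "\<bar>y - \<nu>\<bar> < \<epsilon> / 3 * \<nu>"
    using x y by (auto simp: max_def)
  then have x': "(1 - \<epsilon> / 3) * \<mu> \<le> x" "x \<le> (1 + \<epsilon> / 3) * \<mu>"
    and y': "(1 - \<epsilon> / 3) * \<nu> \<le> y" "y \<le> (1 + \<epsilon> / 3) * \<nu>"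
    by (simp_all only: abs_less_iff left_diff_distrib distrib_right mult_1_left; linarith)+
  have "0 < y" using y \<open>0 < T\<close> by linarith
  have e1: "(1 - \<epsilon>) * (1 + \<epsilon> / 3) \<le> 1 - \<epsilon> / 3" "1 + \<epsilon> / 3 \<le> (1 + \<epsilon>) * (1 - \<epsilon> / 3)"
    using \<open>0 < \<epsilon>\<close> mult_left_le[of \<epsilon> \<epsilon>] \<open>\<epsilon> < 1\<close> by (simp add: algebra_simps, simp add: field_simps)
  have dn: "0 \<le> d * \<nu>" using \<open>0 \<le> d\<close> \<open>T < \<nu>\<close> \<open>0 < T\<close> by simp
  have "(1 - \<epsilon>) * d * y \<le> (1 - \<epsilon>) * d * ((1 + \<epsilon> / 3) * \<nu>)"
    using assms y' by (intro mult_left_mono) auto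
  also have "\<dots> = ((1 - \<epsilon>) * (1 + \<epsilon> / 3)) * (d * \<nu>)" by (simp add: algebra_simps)
  also have "\<dots> \<le> (1 - \<epsilon> / 3) * (d * \<nu>)" using e1 dn by (intro mult_right_mono)
  also have "\<dots> = c * ((1 - \<epsilon> / 3) * \<mu>)" using assms(6) by (simp add: algebra_simps)
  also have "\<dots> \<le> c * x" using x' \<open>0 \<le> c\<close> by (intro mult_left_mono)
  finally have 1: "(1 - \<epsilon>) * d \<le> c * x / y" using \<open>0 < y\<close> by (simp add: field_simps)
  have "c * x \<le> c * ((1 + \<epsilon> / 3) * \<mu>)" using x' \<open>0 \<le> c\<close> by (intro mult_left_mono)
  also have "\<dots> = (1 + \<epsilon> / 3) * (d * \<nu>)" using assms(6) by (simp add: algebra_simps)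
  also have "\<dots> \<le> ((1 + \<epsilon>) * (1 - \<epsilon> / 3)) * (d * \<nu>)" using e1 dn by (intro mult_right_mono)
  also have "\<dots> = (1 + \<epsilon>) * d * ((1 - \<epsilon> / 3) * \<nu>)" by (simp add: algebra_simps)
  also have "\<dots> \<le> (1 + \<epsilon>) * d * y" using assms y' by (intro mult_left_mono) auto
  finally have 2: "c * x / y \<le> (1 + \<epsilon>) * d" using \<open>0 < y\<close> by (simp add: field_simps)
  show ?thesis using 1 2 by (simp add: eps_approximations_def)
qed

text \<open>On the good event for both sums a certified output is correct, whether or not the means
  are large. Certification at \<open>2 * T\<close> is guaranteed only for means of at least
  \<open>4 * T\<close>; otherwise the remaining list must succeed, hence the disjunction in
  \<open>rest\<close>. Each of the two sums costs \<open>\<delta>\<close> and at most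
  \<open>5 * n\<close> queries.\<close>

lemma ensures_first_certified_Cons:
  assumes \<epsilon>: "0 < \<epsilon>" "\<epsilon> < 1" and "0 < \<delta>" "0 \<le> \<delta>'" "0 \<le> d" and T: "T = 1 / ((\<epsilon> / 3)\<^sup>2 * \<delta>)"
    and est: "ratio_estimator V E d c a b \<mu> \<nu>"
    and rest: "(4 * T \<le> n * \<mu> \<and> 4 * T \<le> n * \<nu>) \<or> ensures V E (first_certified T es) (eps_approximations \<epsilon> d) q \<delta>'"
  shows "ensures V E (first_certified T ((n, c, a, b) # es)) (eps_approximations \<epsilon> d) (10 * n + q) (2 * \<delta> + \<delta>')"
proof -
  have T0: "0 < T" using assms by simp
  have c: "0 \<le> c" "c * \<mu> = d * \<nu>" using est by (auto simp: ratio_estimator_def)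
  obtain p i where p: "i \<le> 5" "samples V E a i p" "set_pmf p \<subseteq> {0..1}" "measure_pmf.expectation p (\<lambda>x. x) = \<mu>"
    using est unfolding ratio_estimator_def by blast
  obtain p' j where p': "j \<le> 5" "samples V E b j p'" "set_pmf p' \<subseteq> {0..1}" "measure_pmf.expectation p' (\<lambda>x. x) = \<nu>"
    using est unfolding ratio_estimator_def by blast
  let ?G = "{x. \<bar>x - n * \<mu>\<bar> < \<epsilon> / 3 * max (n * \<mu>) T}"
  let ?H = "{x. \<bar>x - n * \<nu>\<bar> < \<epsilon> / 3 * max (n * \<nu>) T}"
  have G: "measure_pmf.prob (sum_pmf p n) ?G \<ge> 1 - \<delta>"
    using sum_pmf_concentration[OF p(3) _ \<open>0 < \<delta>\<close> T, of n] \<epsilon> p(4) by simp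
  have H: "measure_pmf.prob (sum_pmf p' n) ?H \<ge> 1 - \<delta>"
    using sum_pmf_concentration[OF p'(3) _ \<open>0 < \<delta>\<close> T, of n] \<epsilon> p'(4) by simp
  have large: "2 * T \<le> x" if "\<bar>x - m\<bar> < \<epsilon> / 3 * max m T" "4 * T \<le> m" for x m
  proof -
    have "\<epsilon> / 3 * max m T \<le> 1 / 2 * m"
      using that \<epsilon> T0 by (intro mult_mono) auto
    then show ?thesis using that by linarith
  qed
  have "ensures V E (sum_sampler a n (\<lambda>x. sum_sampler b n (\<lambda>y.
       if 2 * T \<le> x \<and> 2 * T \<le> y then Output (c * x / y) else first_certified T es)))
       (eps_approximations \<epsilon> d) (n * i + (n * j + q)) (\<delta> + (\<delta> + \<delta>'))"
  proof (rule ensures_samples[OF samples_sum_sampler[OF p(2)] G])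
    fix x assume x: "x \<in> ?G"
    show "ensures V E (sum_sampler b n (\<lambda>y.
       if 2 * T \<le> x \<and> 2 * T \<le> y then Output (c * x / y) else first_certified T es))
       (eps_approximations \<epsilon> d) (n * j + q) (\<delta> + \<delta>')"
    proof (rule ensures_samples[OF samples_sum_sampler[OF p'(2)] H \<open>0 \<le> \<delta>'\<close>])
      fix y assume y: "y \<in> ?H"
      show "ensures V E (if 2 * T \<le> x \<and> 2 * T \<le> y then Output (c * x / y) else first_certified T es)
             (eps_approximations \<epsilon> d) q \<delta>'"
      proof (cases "2 * T \<le> x \<and> 2 * T \<le> y")
        case True
        have "c * x / y \<in> eps_approximations \<epsilon> d"
          by (rule certified_quotient[where T = T and \<mu> = "n * \<mu>" and \<nu> = "n * \<nu>"])
             (use True x y \<epsilon> T0 c \<open>0 \<le> d\<close> in \<open>auto simp: mult.left_commute\<close>)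
        then show ?thesis using True \<open>0 \<le> \<delta>'\<close> by (simp add: ensures_Output)
      next
        case False
        then have "\<not> (4 * T \<le> n * \<mu> \<and> 4 * T \<le> n * \<nu>)"
          using large x y by blast
        then show ?thesis using False rest by auto
      qed
    qed
  qed (use \<open>0 < \<delta>\<close> \<open>0 \<le> \<delta>'\<close> in auto)
  then show ?thesis
  proof (simp, elim ensures_mono)
    have "n * i \<le> n * 5" "n * j \<le> n * 5" using p p' by auto
    then show "n * i + (n * j + q) \<le> 10 * n + q" by linarith
  qed simp
qed

text \<open>Stages after the guaranteed one are not reached on the good event, so \<open>fs\<close>
  adds neither queries nor failure probability. This is how the cost can depend on the graph
  although the list of stages does not.\<close>

lemma ensures_first_certified:
  fixes \<delta> d T :: real
  assumes \<epsilon>: "0 < \<epsilon>" "\<epsilon> < 1" and "0 < \<delta>" "0 \<le> d" and T: "T = 1 / ((\<epsilon> / 3)\<^sup>2 * \<delta>)"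
    and est: "\<And>n c a b. (n, c, a, b) \<in> set (es @ [(n', c', a', b')]) \<Longrightarrow> \<exists>\<mu> \<nu>. ratio_estimator V E d c a b \<mu> \<nu>"
    and last: "ratio_estimator V E d c' a' b' \<mu> \<nu>" "4 * T \<le> n' * \<mu>" "4 * T \<le> n' * \<nu>"
  shows "ensures V E (first_certified T (es @ (n', c', a', b') # fs)) (eps_approximations \<epsilon> d)
           (10 * sum_list (map fst (es @ [(n', c', a', b')]))) (2 * \<delta> * (length es + 1))"
  using est
proof (induction es)
  case Nil
  then show ?case
    using ensures_first_certified_Cons[OF \<epsilon> \<open>0 < \<delta>\<close> order_refl[of 0] \<open>0 \<le> d\<close> T last(1), of n' fs 0] last by simp
next
  case (Cons e es)
  obtain n c a b where e: "e = (n, c, a, b)" by (cases e)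
  obtain \<mu> \<nu> where r: "ratio_estimator V E d c a b \<mu> \<nu>"
    using Cons.prems[of n c a b] e by auto
  have IH: "ensures V E (first_certified T (es @ (n', c', a', b') # fs)) (eps_approximations \<epsilon> d)
           (10 * sum_list (map fst (es @ [(n', c', a', b')]))) (2 * \<delta> * (length es + 1))"
  proof (rule Cons.IH)
    fix n c a b assume "(n, c, a, b) \<in> set (es @ [(n', c', a', b')])"
    then show "\<exists>\<mu> \<nu>. ratio_estimator V E d c a b \<mu> \<nu>"
      using Cons.prems[of n c a b] by auto
  qed
  have 0: "0 \<le> 2 * \<delta> * (length es + 1)" using \<open>0 < \<delta>\<close> by simp
  from ensures_first_certified_Cons[OF \<epsilon> \<open>0 < \<delta>\<close> 0 \<open>0 \<le> d\<close> T r disjI2[OF IH], of n]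
  show ?case by (simp add: e algebra_simps)
qed

section \<open>Estimators of the average degree\<close>

lemma samples_Degree_map:
  "samples V E (\<lambda>k. Degree x (\<lambda>i. k (f i))) 1 (return_pmf (f (degree E x)))"
  by (simp add: samples_def charge_eq_delay bind_return_pmf)

definition endpoint_pmf :: "'v set set \<Rightarrow> 'v pmf" where
  "endpoint_pmf E = bind_pmf (pmf_of_set E) pmf_of_set"

text \<open>An edge is answered as an unordered set, so a free coin together with the order on the
  vertices picks one end. A vertex results with probability proportional to its degree.\<close>

definition RandEndpoint :: "('v::linorder \<Rightarrow> 'v algorithm) \<Rightarrow> 'v algorithm" where
  "RandEndpoint k = RandEdge (\<lambda>e. Toss (pmf_of_set {0, 1}) (\<lambda>b. k (if b = 0 then Min e else Max e)))"

definition endpoint_statistic :: "(nat \<Rightarrow> real) \<Rightarrow> 'v::linorder sampler" where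
  "endpoint_statistic f = (\<lambda>k. RandEndpoint (\<lambda>x. Degree x (\<lambda>i. k (f i))))"

definition light_statistic :: "real \<Rightarrow> 'v sampler" where
  "light_statistic \<tau> = (\<lambda>k. RandVert (\<lambda>x. Degree x (\<lambda>i. k (if real i \<le> \<tau> then real i / \<tau> else 0))))"

definition heavy_edge_statistic :: "real \<Rightarrow> 'v::linorder sampler" where
  "heavy_edge_statistic \<tau> = (\<lambda>k. RandEdge (\<lambda>e. Degree (Min e) (\<lambda>i. Degree (Max e) (\<lambda>j.
     k (of_bool (\<tau> < real i \<and> \<tau> < real j))))))"

text \<open>
  For independent degree-proportional \<open>x\<close>, \<open>y\<close>, the weight \<open>1 / (deg x * deg y)\<close> cancels the sampling
  bias; the factor \<open>\<tau>\<^sup>2\<close> keeps the value in the unit interval.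
\<close>

definition heavy_pair_statistic :: "real \<Rightarrow> 'v::linorder sampler" where
  "heavy_pair_statistic \<tau> = (\<lambda>k. RandEndpoint (\<lambda>x. RandEndpoint (\<lambda>y. Degree x (\<lambda>i. Degree y (\<lambda>j.
     PairQuery x y (\<lambda>b. k (if b \<and> \<tau> < real i \<and> \<tau> < real j then \<tau>\<^sup>2 / (real i * real j) else 0)))))))"

section \<open>Incidence counts and degree-proportional sampling\<close>

locale query_graph =
  fixes V :: "'v::linorder set" and E :: "'v set set"
  assumes graph: "simple_graph V E" and no_isolated: "no_isolated_vertices V E"
begin

lemma finite_V: "finite V" and V_nonempty: "V \<noteq> {}"
  using graph by (auto simp: simple_graph_def)

lemma edge: "e \<in> E \<Longrightarrow> e \<subseteq> V" "e \<in> E \<Longrightarrow> card e = 2"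
  using graph by (auto simp: simple_graph_def)

lemma finite_edge: "e \<in> E \<Longrightarrow> finite e"
  using edge(2) card.infinite by fastforce

lemma finite_E: "finite E"
  using edge finite_V by (meson Pow_iff finite_Pow_iff finite_subset subsetI)

lemma E_nonempty: "E \<noteq> {}"
  using V_nonempty no_isolated by (auto simp: no_isolated_vertices_def)

lemma neighbors_subset: "neighbors E x \<subseteq> V"
  using edge by (auto simp: neighbors_def)

lemma finite_neighbors: "finite (neighbors E x)"
  using neighbors_subset finite_V by (rule finite_subset)

lemma edge_eq:
  assumes "e \<in> E" "x \<in> e"
  shows "\<exists>y. y \<noteq> x \<and> e = {x, y}"
proof -
  obtain a b where "e = {a, b}" "a \<noteq> b"
    using edge(2)[OF assms(1)] by (auto simp: card_2_iff)
  then show ?thesis using assms(2) by auto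
qed

lemma degree_pos: "x \<in> V \<Longrightarrow> 0 < degree E x"
  using no_isolated edge_eq finite_neighbors
  unfolding degree_def card_gt_0_iff no_isolated_vertices_def neighbors_def by blast

lemma card_E_pos: "0 < card E" and card_V_pos: "0 < card V"
  using finite_E E_nonempty finite_V V_nonempty by (simp_all add: card_gt_0_iff)

text \<open>Incidences of vertices and edges counted in two ways. A summand that also depends on the
  edge covers degree sums, counts of edges with a property, and averages over a random edge.\<close>

lemma sum_endpoints:
  fixes f :: "'v set \<Rightarrow> 'v \<Rightarrow> real"
  shows "(\<Sum>e\<in>E. \<Sum>x\<in>e. f e x) = (\<Sum>x\<in>V. \<Sum>y\<in>neighbors E x. f {x, y} x)"
proof -
  have "(\<Sum>e\<in>E. \<Sum>x\<in>e. f e x) = (\<Sum>e\<in>E. \<Sum>x | x \<in> V \<and> x \<in> e. f e x)"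
    using edge by (intro sum.cong refl) auto
  also have "\<dots> = (\<Sum>x\<in>V. \<Sum>e | e \<in> E \<and> x \<in> e. f e x)"
    using finite_E finite_V by (rule sum.swap_restrict)
  also have "\<dots> = (\<Sum>x\<in>V. \<Sum>y\<in>neighbors E x. f {x, y} x)"
  proof (intro sum.cong refl)
    fix x
    have "inj_on (\<lambda>y. {x, y}) (neighbors E x)"
      by (auto simp: inj_on_def doubleton_eq_iff)
    moreover have "(\<lambda>y. {x, y}) ` neighbors E x = {e. e \<in> E \<and> x \<in> e}"
      using edge_eq by (fastforce simp: neighbors_def)
    ultimately show "(\<Sum>e | e \<in> E \<and> x \<in> e. f e x) = (\<Sum>y\<in>neighbors E x. f {x, y} x)"
      by (simp add: sum.reindex flip: \<open>_ = {e. e \<in> E \<and> x \<in> e}\<close>)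
  qed
  finally show ?thesis .
qed

lemma sum_degree: "(\<Sum>e\<in>E. \<Sum>x\<in>e. g x) = (\<Sum>x\<in>V. real (degree E x) * g x)" for g :: "'v \<Rightarrow> real"
  using sum_endpoints[of "\<lambda>_ x. g x"] by (simp add: degree_def)

lemma set_endpoint_pmf: "set_pmf (endpoint_pmf E) \<subseteq> V"
proof -
  have "set_pmf (pmf_of_set e) = e" if "e \<in> E" for e
    using edge(2)[OF that] finite_edge[OF that] by (intro set_pmf_of_set) auto
  then show ?thesis
    using edge(1) finite_E E_nonempty by (auto simp: endpoint_pmf_def)
qed

lemma finite_set_endpoint_pmf: "finite (set_pmf (endpoint_pmf E))"
  using set_endpoint_pmf finite_V by (rule finite_subset)

lemma expectation_endpoint:
  "measure_pmf.expectation (endpoint_pmf E) g = (\<Sum>x\<in>V. real (degree E x) * g x) / (2 * real (card E))" for g :: "'v \<Rightarrow> real"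
proof -
  have "measure_pmf.expectation (endpoint_pmf E) g
      = measure_pmf.expectation (pmf_of_set E) (\<lambda>e. measure_pmf.expectation (pmf_of_set e) g)"
    using finite_set_endpoint_pmf unfolding endpoint_pmf_def by (rule expectation_bind_pmf_finite)
  also have "\<dots> = (\<Sum>e\<in>E. measure_pmf.expectation (pmf_of_set e) g) / card E"
    using finite_E E_nonempty by (rule integral_pmf_of_set[rotated])
  also have "(\<Sum>e\<in>E. measure_pmf.expectation (pmf_of_set e) g) = (\<Sum>e\<in>E. (\<Sum>x\<in>e. g x) / 2)"
  proof (intro sum.cong refl)
    fix e assume "e \<in> E"
    then show "measure_pmf.expectation (pmf_of_set e) g = (\<Sum>x\<in>e. g x) / 2"
      using edge(2)[of e] finite_edge by (subst integral_pmf_of_set) auto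
  qed
  finally show ?thesis
    by (simp add: sum_degree[symmetric] sum_divide_distrib)
qed

lemma edge_Min_Max:
  assumes "e \<in> E"
  shows "e = {Min e, Max e}" "Min e \<noteq> Max e"
proof -
  obtain a b where "e = {a, b}" "a \<noteq> b"
    using edge(2)[OF assms] by (auto simp: card_2_iff)
  then show "e = {Min e, Max e}" "Min e \<noteq> Max e"
    by (auto simp: min_def max_def)
qed

lemma samples_RandEndpoint: "samples V E RandEndpoint 1 (endpoint_pmf E)"
proof -
  have "samples V E (\<lambda>k. Toss (pmf_of_set {0, 1}) (\<lambda>b. k (if b = 0 then Min e else Max e))) 0 (pmf_of_set e)"
    if "e \<in> set_pmf (pmf_of_set E)" for e
  proof -
    have e: "e \<in> E" using that finite_E E_nonempty by simp
    let ?f = "\<lambda>b::nat. if b = 0 then Min e else Max e"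
    have "map_pmf ?f (pmf_of_set {0, 1}) = pmf_of_set (?f ` {0, 1})"
      using edge_Min_Max[OF e] by (intro map_pmf_of_set_inj) (auto simp: inj_on_def)
    also have "?f ` {0, 1} = e"
      using edge_Min_Max[OF e] by auto
    finally have "pmf_of_set e = map_pmf ?f (pmf_of_set {0, 1})" ..
    then show ?thesis
      by (simp only: samples_def delay_0 run.simps bind_map_pmf) simp
  qed
  from samples_bind[OF samples_RandEdge this]
  show ?thesis by (simp add: endpoint_pmf_def RandEndpoint_def[abs_def])
qed

lemma samples_endpoint_statistic:
  "samples V E (endpoint_statistic f) 2 (map_pmf (\<lambda>x. f (degree E x)) (endpoint_pmf E))"
proof -
  from samples_bind[OF samples_RandEndpoint samples_Degree_map] show ?thesis
    by (simp add: endpoint_statistic_def map_pmf_def numeral_2_eq_2)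
qed

section \<open>The three quotient estimators\<close>

definition light_weight :: "real \<Rightarrow> real" where
  "light_weight \<tau> = (\<Sum>x\<in>V. if real (degree E x) \<le> \<tau> then real (degree E x) else 0)"

definition heavy_edges :: "real \<Rightarrow> 'v set set" where
  "heavy_edges \<tau> = {e \<in> E. \<forall>x\<in>e. \<tau> < real (degree E x)}"

lemma average_degree_pos: "0 < average_degree V E"
  using card_E_pos card_V_pos by (simp add: average_degree_def)

text \<open>The weight \<open>1 / deg\<close> cancels the degree bias of a random endpoint, which
  leaves \<open>card V / (2 * card E)\<close>. The other sampler is the constant 1, so that this
  estimate fits the common quotient form.\<close>

lemma harmonic_estimator:
  "ratio_estimator V E (average_degree V E) 1 (\<lambda>k. k 1) (endpoint_statistic (\<lambda>i. 1 / real i)) 1 (1 / average_degree V E)"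
proof -
  let ?p = "map_pmf (\<lambda>x. 1 / real (degree E x)) (endpoint_pmf E)"
  have "measure_pmf.expectation ?p (\<lambda>x. x) = (\<Sum>x\<in>V. real (degree E x) * (1 / degree E x)) / (2 * real (card E))"
    by (simp add: expectation_endpoint)
  also have "\<dots> = (\<Sum>x\<in>V. 1) / (2 * real (card E))"
    using degree_pos by (intro arg_cong2[where f = "(/)"] sum.cong) auto
  finally have "measure_pmf.expectation ?p (\<lambda>x. x) = 1 / average_degree V E"
    by (simp add: average_degree_def)
  moreover have "set_pmf ?p \<subseteq> {0..1}"
    using set_endpoint_pmf degree_pos by (auto simp: Suc_le_eq divide_le_eq_1)
  ultimately have "\<exists>p i. i \<le> 5 \<and> samples V E (endpoint_statistic (\<lambda>i. 1 / real i)) i p \<and> set_pmf p \<subseteq> {0..1}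
      \<and> measure_pmf.expectation p (\<lambda>x. x) = 1 / average_degree V E"
    using samples_endpoint_statistic by (intro exI[of _ ?p] exI[of _ 2]) auto
  moreover have "\<exists>(p :: real pmf) i. i \<le> 5 \<and> samples V E (\<lambda>k. k 1) i p \<and> set_pmf p \<subseteq> {0..1}
      \<and> measure_pmf.expectation p (\<lambda>x. x) = 1"
    by (intro exI[of _ "return_pmf 1"] exI[of _ 0]) (auto simp: samples_return)
  ultimately show ?thesis
    using average_degree_pos by (simp add: ratio_estimator_def)
qed

text \<open>The degree sum of the light vertices cancels in the quotient: it occurs relative to
  \<open>card V\<close> for random vertices and relative to \<open>2 * card E\<close> for random
  endpoints. Division by \<open>\<tau>\<close> brings light degrees into the unit interval.\<close>

lemma light_estimator:
  assumes "0 < \<tau>"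
  shows "ratio_estimator V E (average_degree V E) \<tau> (light_statistic \<tau>) (endpoint_statistic (\<lambda>i. of_bool (real i \<le> \<tau>)))
     (light_weight \<tau> / (real (card V) * \<tau>)) (light_weight \<tau> / (2 * real (card E)))"
proof -
  let ?f = "\<lambda>i::nat. if real i \<le> \<tau> then real i / \<tau> else 0"
  let ?p = "map_pmf (\<lambda>x. ?f (degree E x)) (pmf_of_set V)"
  let ?q = "map_pmf (\<lambda>x. of_bool (real (degree E x) \<le> \<tau>)) (endpoint_pmf E)"
  from samples_bind[OF samples_RandVert samples_Degree_map[where f = ?f]] have "samples V E (light_statistic \<tau>) 2 ?p"
    by (simp add: light_statistic_def map_pmf_def numeral_2_eq_2)
  moreover have "measure_pmf.expectation ?p (\<lambda>x. x) = light_weight \<tau> / (real (card V) * \<tau>)"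
    using finite_V V_nonempty
    by (simp add: integral_pmf_of_set light_weight_def sum_divide_distrib, intro sum.cong) (auto simp: mult.commute)
  moreover have "set_pmf ?p \<subseteq> {0..1}"
    using \<open>0 < \<tau>\<close> by auto
  ultimately have p: "\<exists>p i. i \<le> 5 \<and> samples V E (light_statistic \<tau>) i p \<and> set_pmf p \<subseteq> {0..1}
      \<and> measure_pmf.expectation p (\<lambda>x. x) = light_weight \<tau> / (real (card V) * \<tau>)"
    by (intro exI[of _ ?p] exI[of _ 2]) auto
  have "measure_pmf.expectation ?q (\<lambda>x. x) = light_weight \<tau> / (2 * real (card E))"
    by (simp add: expectation_endpoint light_weight_def of_bool_def if_distrib cong: if_cong)
  then have q: "\<exists>p i. i \<le> 5 \<and> samples V E (endpoint_statistic (\<lambda>i. of_bool (real i \<le> \<tau>))) i p \<and> set_pmf p \<subseteq> {0..1}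
      \<and> measure_pmf.expectation p (\<lambda>x. x) = light_weight \<tau> / (2 * real (card E))"
    using samples_endpoint_statistic by (intro exI[of _ ?q] exI[of _ 2]) auto
  show ?thesis
    using p q \<open>0 < \<tau>\<close> card_E_pos card_V_pos by (simp add: ratio_estimator_def average_degree_def)
qed

lemma sum_heavy_edges:
  "(\<Sum>x\<in>V. \<Sum>y\<in>V. if {x, y} \<in> E \<and> \<tau> < real (degree E x) \<and> \<tau> < real (degree E y) then 1 else 0) = 2 * real (card (heavy_edges \<tau>))"
proof -
  have "(\<Sum>x\<in>V. \<Sum>y\<in>V. if {x, y} \<in> E \<and> \<tau> < real (degree E x) \<and> \<tau> < real (degree E y) then 1 else 0)
      = (\<Sum>x\<in>V. \<Sum>y\<in>neighbors E x. of_bool ({x, y} \<in> heavy_edges \<tau>) :: real)"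
    using neighbors_subset finite_V
    by (intro sum.cong refl sum.mono_neutral_cong_right) (auto simp: neighbors_def heavy_edges_def)
  also have "\<dots> = (\<Sum>e\<in>E. \<Sum>x\<in>e. of_bool (e \<in> heavy_edges \<tau>))"
    by (rule sum_endpoints[symmetric])
  also have "\<dots> = (\<Sum>e\<in>E. 2 * of_bool (e \<in> heavy_edges \<tau>))"
    using edge by simp
  also have "\<dots> = 2 * real (card (heavy_edges \<tau>))"
    using finite_E by (simp add: sum_distrib_left[symmetric] heavy_edges_def of_bool_def sum.If_cases Int_def)
  finally show ?thesis .
qed

text \<open>The number of heavy edges cancels in the quotient. It is divided by
  \<open>card E\<close> for a random edge, but by the square of \<open>card E\<close> for two
  independent endpoints, so one factor \<open>card E\<close> remains.\<close>

lemma heavy_estimator: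
  assumes "0 < \<tau>"
  shows "ratio_estimator V E (average_degree V E) (\<tau>\<^sup>2 / real (card V)) (heavy_edge_statistic \<tau>) (heavy_pair_statistic \<tau>)
     (real (card (heavy_edges \<tau>)) / real (card E)) (\<tau>\<^sup>2 * (2 * real (card (heavy_edges \<tau>))) / (2 * real (card E))\<^sup>2)"
proof -
  let ?p = "map_pmf (\<lambda>e. of_bool (e \<in> heavy_edges \<tau>)) (pmf_of_set E)"
  let ?h = "\<lambda>x y. if {x, y} \<in> E \<and> \<tau> < real (degree E x) \<and> \<tau> < real (degree E y) then \<tau>\<^sup>2 / (real (degree E x) * real (degree E y)) else 0"
  let ?q = "bind_pmf (endpoint_pmf E) (\<lambda>x. map_pmf (?h x) (endpoint_pmf E))"
  have "samples V E (\<lambda>k. Degree (Min e) (\<lambda>i. Degree (Max e) (\<lambda>j. k (of_bool (\<tau> < real i \<and> \<tau> < real j))))) 2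
      (return_pmf (of_bool (e \<in> heavy_edges \<tau>)))" if "e \<in> set_pmf (pmf_of_set E)" for e
  proof -
    have e: "e \<in> E" using that finite_E E_nonempty by simp
    have "(e \<in> heavy_edges \<tau>) = (\<tau> < real (degree E (Min e)) \<and> \<tau> < real (degree E (Max e)))"
      using arg_cong[where f = "\<lambda>S. \<forall>x\<in>S. \<tau> < real (degree E x)", OF edge_Min_Max(1)[OF e]] e
      by (simp add: heavy_edges_def)
    then show ?thesis
      by (simp add: samples_def charge_eq_delay delay_delay bind_return_pmf numeral_2_eq_2)
  qed
  from samples_bind[OF samples_RandEdge this] have "samples V E (heavy_edge_statistic \<tau>) 3 ?p"
    by (simp add: heavy_edge_statistic_def map_pmf_def numeral_3_eq_3)
  moreover have "measure_pmf.expectation ?p (\<lambda>x. x) = real (card (heavy_edges \<tau>)) / real (card E)"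
    using finite_E E_nonempty
    by (simp add: integral_pmf_of_set of_bool_def sum.If_cases Int_def heavy_edges_def)
  ultimately have p: "\<exists>p i. i \<le> 5 \<and> samples V E (heavy_edge_statistic \<tau>) i p \<and> set_pmf p \<subseteq> {0..1}
      \<and> measure_pmf.expectation p (\<lambda>x. x) = real (card (heavy_edges \<tau>)) / real (card E)"
    by (intro exI[of _ ?p] exI[of _ 3]) auto
  have "samples V E (\<lambda>k. Degree x (\<lambda>i. Degree y (\<lambda>j.
     PairQuery x y (\<lambda>b. k (if b \<and> \<tau> < real i \<and> \<tau> < real j then \<tau>\<^sup>2 / (real i * real j) else 0))))) 3 (return_pmf (?h x y))" for x y
    by (simp add: samples_def charge_eq_delay delay_delay bind_return_pmf numeral_3_eq_3)
  from samples_bind[OF samples_RandEndpoint samples_bind[OF samples_RandEndpoint this]]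
  have "samples V E (heavy_pair_statistic \<tau>) 5 ?q"
    by (simp add: heavy_pair_statistic_def map_pmf_def)
  moreover have "set_pmf ?q \<subseteq> {0..1}"
    using \<open>0 < \<tau>\<close> by (auto simp: power2_eq_square intro!: mult_mono divide_le_eq_1_pos[THEN iffD2])
  moreover have "measure_pmf.expectation ?q (\<lambda>x. x) = \<tau>\<^sup>2 * (2 * real (card (heavy_edges \<tau>))) / (2 * real (card E))\<^sup>2"
  proof -
    have "measure_pmf.expectation ?q (\<lambda>x. x)
        = measure_pmf.expectation (endpoint_pmf E) (\<lambda>x. measure_pmf.expectation (endpoint_pmf E) (?h x))"
      by (subst expectation_bind_pmf_finite) (simp_all add: finite_set_endpoint_pmf)
    also have "\<dots> = (\<Sum>x\<in>V. \<Sum>y\<in>V. real (degree E x) * real (degree E y) * ?h x y) / (2 * real (card E))\<^sup>2"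
      by (simp add: expectation_endpoint sum_distrib_left sum_divide_distrib power2_eq_square mult.assoc)
    also have "\<dots> = (\<Sum>x\<in>V. \<Sum>y\<in>V. \<tau>\<^sup>2 * (if {x, y} \<in> E \<and> \<tau> < real (degree E x) \<and> \<tau> < real (degree E y) then 1 else 0)) / (2 * real (card E))\<^sup>2"
      using \<open>0 < \<tau>\<close> by (intro arg_cong2[where f = "(/)"] sum.cong refl) auto
    also have "\<dots> = \<tau>\<^sup>2 * (2 * real (card (heavy_edges \<tau>))) / (2 * real (card E))\<^sup>2"
      by (simp only: sum_distrib_left[symmetric] sum_heavy_edges)
    finally show ?thesis .
  qed
  ultimately have q: "\<exists>p i. i \<le> 5 \<and> samples V E (heavy_pair_statistic \<tau>) i p \<and> set_pmf p \<subseteq> {0..1}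
      \<and> measure_pmf.expectation p (\<lambda>x. x) = \<tau>\<^sup>2 * (2 * real (card (heavy_edges \<tau>))) / (2 * real (card E))\<^sup>2"
    by (intro exI[of _ ?q] exI[of _ 5]) simp
  show ?thesis
    using p q \<open>0 < \<tau>\<close> card_E_pos card_V_pos
    by (simp add: ratio_estimator_def average_degree_def power2_eq_square)
qed

text \<open>An edge that is not heavy has a light end, and \<open>light_weight\<close> counts the
  light ends of all edges. Hence one of the two terms is at least half of
  \<open>card E\<close>.\<close>

lemma light_or_heavy: "real (card E) \<le> card (heavy_edges \<tau>) + light_weight \<tau>"
proof -
  have "real (card (E - heavy_edges \<tau>)) = (\<Sum>e\<in>E - heavy_edges \<tau>. 1)"
    by simp
  also have "\<dots> \<le> (\<Sum>e\<in>E - heavy_edges \<tau>. \<Sum>x\<in>e. of_bool (real (degree E x) \<le> \<tau>))"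
  proof (rule sum_mono)
    fix e assume e: "e \<in> E - heavy_edges \<tau>"
    then obtain x where "x \<in> e" "real (degree E x) \<le> \<tau>"
      by (auto simp: heavy_edges_def not_less)
    then show "(1::real) \<le> (\<Sum>x\<in>e. of_bool (real (degree E x) \<le> \<tau>))"
      using member_le_sum[of x e "\<lambda>x. of_bool (real (degree E x) \<le> \<tau>) :: real"] e finite_edge by simp
  qed
  also have "\<dots> \<le> (\<Sum>e\<in>E. \<Sum>x\<in>e. of_bool (real (degree E x) \<le> \<tau>))"
    using finite_E by (intro sum_mono2) (auto intro: sum_nonneg)
  also have "\<dots> = light_weight \<tau>"
    by (simp add: sum_degree light_weight_def of_bool_def if_distrib cong: if_cong)
  finally show ?thesis
    using finite_E by (subst (asm) card_Diff_subset) (auto simp: heavy_edges_def finite_subset of_nat_diff card_mono)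
qed

end

section \<open>The algorithm\<close>

text \<open>
  Level \<open>i\<close> spends about \<open>q = 2 ^ i\<close> queries. Were \<open>q\<close> equal to \<open>root 3 (n / d)\<close>, the degree threshold
  \<open>d * q\<close> that balances the light against the heavy estimator would be \<open>n / q\<^sup>2\<close>.
\<close>

definition level_estimators ::
    "real \<Rightarrow> nat \<Rightarrow> nat \<Rightarrow> (nat \<times> real \<times> nat sampler \<times> nat sampler) list" where
  "level_estimators T n i =
     (let s = nat \<lceil>64 * T * 2 ^ i\<rceil>; \<tau> = real n / 4 ^ i in
       [(s, 1, \<lambda>k. k 1, endpoint_statistic (\<lambda>j. 1 / real j)),
        (s, \<tau>, light_statistic \<tau>, endpoint_statistic (\<lambda>j. of_bool (real j \<le> \<tau>))),
        (s, \<tau>\<^sup>2 / real n, heavy_edge_statistic \<tau>, heavy_pair_statistic \<tau>)])"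

text \<open>At the top level \<open>2 ^ (levels n - 1)\<close> is at least \<open>n\<close>, which
  bounds every possible average degree.\<close>

definition levels :: "nat \<Rightarrow> nat" where
  "levels n = nat \<lceil>log 2 n\<rceil> + 1"

text \<open>Three stages per level with two sums each make at most \<open>6 * levels n\<close> sums.
  A failure probability of \<open>1 / (600 * levels n)\<close> for each of them adds up to at most
  \<open>1 / 100\<close>.\<close>

definition certification_threshold :: "real \<Rightarrow> nat \<Rightarrow> real" where
  "certification_threshold \<epsilon> n = 1 / ((\<epsilon> / 3)\<^sup>2 * (1 / (600 * real (levels n))))"

definition degree_estimator :: "real \<Rightarrow> nat \<Rightarrow> nat algorithm" where
  "degree_estimator \<epsilon> n = (let T = certification_threshold \<epsilon> n in
     first_certified T (concat (map (level_estimators T n) [0..<levels n])))"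

lemma le_two_power_levels: "real n \<le> 2 ^ (levels n - 1)"
proof (cases "n = 0")
  case False
  have "log 2 n \<le> real (nat \<lceil>log 2 n\<rceil>)"
    by (rule real_nat_ceiling_ge)
  then have "2 powr log 2 n \<le> 2 powr real (nat \<lceil>log 2 n\<rceil>)"
    by (intro powr_mono) auto
  also have "\<dots> = 2 ^ nat \<lceil>log 2 n\<rceil>"
    by (rule powr_realpow) simp
  finally show ?thesis using False by (simp add: levels_def)
qed simp

lemma levels_le:
  assumes "2 \<le> n"
  shows "real (levels n) \<le> 6 * ln n"
proof -
  have l1: "1 \<le> log 2 n" using assms by simp
  have "real (levels n) \<le> log 2 n + 2"
    using l1 by (simp add: levels_def) linarith
  also have "\<dots> \<le> 3 * log 2 n" using l1 by simp
  also have "\<dots> = 3 / ln 2 * ln n" by (simp add: log_def)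
  also have "\<dots> \<le> 6 * ln n"
  proof (rule mult_right_mono)
    \<comment> \<open>Amounts to \<open>ln 2 >= 1 / 2\<close>, which is \<open>ln x <= x - 1\<close>
      at \<open>x = 1 / 2\<close>.\<close>
    show "3 / ln 2 \<le> (6 :: real)"
      using ln_le_minus_one[of "1 / 2 :: real"] by (simp add: ln_div field_simps)
  qed (use assms in simp)
  finally show ?thesis .
qed

context
  fixes V :: "nat set" and E n d
  assumes graph: "simple_graph V E" and no_isolated: "no_isolated_vertices V E" and n: "card V = n"
  defines "d \<equiv> average_degree V E"
begin

interpretation query_graph V E
  using graph no_isolated by unfold_locales

lemma level_estimators_valid:
  assumes "(s, c, a, b) \<in> set (level_estimators T n i)"
  shows "\<exists>\<mu> \<nu>. ratio_estimator V E d c a b \<mu> \<nu>"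
proof -
  have "0 < real n / 4 ^ i" using card_V_pos n by simp
  from harmonic_estimator light_estimator[OF this] heavy_estimator[OF this]
  show ?thesis using assms unfolding d_def level_estimators_def n by (auto simp: Let_def)
qed

lemma d_ge_1: "1 \<le> d"
proof -
  have "real n = (\<Sum>x\<in>V. 1)" using n by simp
  also have "\<dots> \<le> (\<Sum>x\<in>V. real (degree E x) * 1)"
    using degree_pos by (intro sum_mono) (simp add: Suc_le_eq)
  also have "\<dots> = (\<Sum>e\<in>E. \<Sum>x\<in>e. 1)"
    by (rule sum_degree[symmetric])
  also have "\<dots> = 2 * card E"
    using edge by simp
  finally show ?thesis
    using card_V_pos n by (simp add: d_def average_degree_def)
qed

lemma d_le_n: "d \<le> n"
proof -
  have "2 * real (card E) = (\<Sum>e\<in>E. \<Sum>x\<in>e. 1)"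
    using edge by simp
  also have "\<dots> = (\<Sum>x\<in>V. real (degree E x) * 1)"
    by (rule sum_degree)
  also have "\<dots> \<le> (\<Sum>x\<in>V. real n)"
    using neighbors_subset finite_V n by (intro sum_mono) (auto simp: degree_def card_mono)
  also have "\<dots> = real n * real n" using n by simp
  finally show ?thesis
    using card_V_pos n by (simp add: d_def average_degree_def divide_le_eq)
qed

text \<open>With \<open>q = 2 ^ i\<close>, one of the three estimators has both means at least
  \<open>1 / (16 * q)\<close>, so \<open>64 * T * q\<close> samples bring the expected sums to
  \<open>4 * T\<close>. The extreme case is that of heavy pairs, because \<open>q ^ 3\<close> may
  exceed \<open>n / d\<close> by the factor 8.\<close>

lemma level_has_large_estimator:
  fixes i :: nat
  assumes T: "1 \<le> T"
    and le: "min d (root 3 (n / d)) \<le> 2 ^ i" and ge: "2 ^ i \<le> 2 * min d (root 3 (n / d))"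
  shows "\<exists>s c a b \<mu> \<nu>. (s, c, a, b) \<in> set (level_estimators T n i) \<and> ratio_estimator V E d c a b \<mu> \<nu>
           \<and> 4 * T \<le> real s * \<mu> \<and> 4 * T \<le> real s * \<nu>"
proof -
  define q :: real where "q = 2 ^ i"
  define s where "s = nat \<lceil>64 * T * q\<rceil>"
  define \<tau> where "\<tau> = real n / 4 ^ i"
  have q0: "0 < q" by (simp add: q_def)
  have n0: "0 < real n" using card_V_pos n by simp
  have d0: "0 < d" using d_ge_1 by simp
  have \<tau>: "\<tau> = n / q\<^sup>2"
    by (simp add: \<tau>_def q_def power2_eq_square flip: power_mult_distrib)
  then have \<tau>0: "0 < \<tau>" using n0 q0 by simp
  have large: "4 * T \<le> real s * \<mu>" if "1 \<le> 16 * q * \<mu>" for \<mu> :: real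
  proof -
    have "0 \<le> \<mu>"
    proof (rule ccontr)
      assume "\<not> 0 \<le> \<mu>"
      then have "q * \<mu> < 0" using q0 by (simp add: mult_pos_neg)
      then show False using that by linarith
    qed
    have "4 * T * 1 \<le> 4 * T * (16 * q * \<mu>)" using that T by (intro mult_left_mono) auto
    also have "\<dots> = (64 * T * q) * \<mu>" by simp
    also have "\<dots> \<le> real s * \<mu>" using \<open>0 \<le> \<mu>\<close> by (intro mult_right_mono) (simp_all only: s_def real_nat_ceiling_ge)
    finally show ?thesis by simp
  qed
  have set: "set (level_estimators T n i) = {(s, 1, \<lambda>k. k 1, endpoint_statistic (\<lambda>j. 1 / real j)),
        (s, \<tau>, light_statistic \<tau>, endpoint_statistic (\<lambda>j. of_bool (real j \<le> \<tau>))),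
        (s, \<tau>\<^sup>2 / real n, heavy_edge_statistic \<tau>, heavy_pair_statistic \<tau>)}"
    by (simp add: level_estimators_def Let_def s_def q_def \<tau>_def)
  show ?thesis
  proof (cases "d \<le> q")
    case True
    have "1 \<le> q" by (simp add: q_def)
    have "4 * T \<le> real s * 1" using \<open>1 \<le> q\<close> by (intro large) simp
    moreover have "4 * T \<le> real s * (1 / d)" using True d0 q0 by (intro large) (simp add: field_simps)
    ultimately show ?thesis
      using harmonic_estimator set unfolding d_def by blast
  next
    case False
    \<comment> \<open>For \<open>q < d\<close> the minimum can only be the cube root, which
      determines \<open>q ^ 3\<close> up to the factor 8.\<close>
    then have r: "root 3 (n / d) \<le> q" "q \<le> 2 * root 3 (n / d)"
      using le ge by (auto simp: q_def min_def split: if_splits)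
    have r3: "root 3 (n / d) ^ 3 = n / d" using n0 d0 by (simp add: odd_real_root_pow)
    have up: "n / d \<le> q ^ 3"
      using power_mono[OF r(1), of 3] r3 n0 d0 by simp
    have low: "q ^ 3 \<le> 8 * (n / d)"
      using power_mono[OF r(2), of 3] r3 q0 by (simp add: power_mult_distrib)
    have m: "2 * real (card E) = d * n"
      using n0 n by (simp add: d_def average_degree_def)
    have m0: "0 < real (card E)" using card_E_pos by simp
    show ?thesis
    proof (cases "real (card E) / 2 \<le> light_weight \<tau>")
      case True
      have "4 * T \<le> real s * (light_weight \<tau> / (2 * real (card E)))"
      proof (rule large)
        have "1 \<le> 16 * 1 * (1 / 4 :: real)" by simp
        also have "\<dots> \<le> 16 * q * (light_weight \<tau> / (2 * real (card E)))"
          using True m0 by (intro mult_mono) (auto simp: q_def field_simps)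
        finally show "1 \<le> 16 * q * (light_weight \<tau> / (2 * real (card E)))" .
      qed
      moreover have "4 * T \<le> real s * (light_weight \<tau> / (real (card V) * \<tau>))"
      proof (rule large)
        have "1 \<le> 4 * (q ^ 3 * d / n)"
          using up n0 d0 by (simp add: field_simps)
        also have "\<dots> = 16 * q * ((d * n / 4) / (real (card V) * \<tau>))"
          using n0 q0 unfolding \<tau> n by (simp add: field_simps power2_eq_square power3_eq_cube)
        also have "\<dots> \<le> 16 * q * (light_weight \<tau> / (real (card V) * \<tau>))"
          using True m \<tau>0 q0 by (intro mult_left_mono divide_right_mono) auto
        finally show "1 \<le> 16 * q * (light_weight \<tau> / (real (card V) * \<tau>))" .
      qed
      ultimately show ?thesis
        using light_estimator[OF \<tau>0] set unfolding d_def by blast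
    next
      case False
      let ?h = "real (card (heavy_edges \<tau>))"
      have h: "real (card E) / 2 \<le> ?h"
        using light_or_heavy[of \<tau>] False by simp
      have "4 * T \<le> real s * (?h / real (card E))"
      proof (rule large)
        have "1 \<le> 16 * 1 * (1 / 2 :: real)" by simp
        also have "\<dots> \<le> 16 * q * (?h / real (card E))"
          using h m0 by (intro mult_mono) (auto simp: q_def field_simps)
        finally show "1 \<le> 16 * q * (?h / real (card E))" .
      qed
      moreover have "4 * T \<le> real s * (\<tau>\<^sup>2 * (2 * ?h) / (2 * real (card E))\<^sup>2)"
      proof (rule large)
        have "1 \<le> 8 * (n / d) / q ^ 3"
          using low q0 by (subst le_divide_eq_1_pos) auto
        also have "\<dots> = 16 * q * (\<tau>\<^sup>2 * (d * n / 2) / (d * n)\<^sup>2)"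
          using n0 q0 d0 unfolding \<tau> by (simp add: field_simps power2_eq_square power3_eq_cube)
        also have "\<dots> \<le> 16 * q * (\<tau>\<^sup>2 * (2 * ?h) / (2 * real (card E))\<^sup>2)"
          unfolding m[symmetric] using h q0 by (intro mult_left_mono divide_right_mono) auto
        finally show "1 \<le> 16 * q * (\<tau>\<^sup>2 * (2 * ?h) / (2 * real (card E))\<^sup>2)" .
      qed
      ultimately show ?thesis
        using heavy_estimator[OF \<tau>0] set n unfolding d_def by blast
    qed
  qed
qed

lemma exists_level:
  "\<exists>i < levels n. min d (root 3 (n / d)) \<le> 2 ^ i \<and> 2 ^ i \<le> 2 * min d (root 3 (n / d))"
proof -
  let ?b = "min d (root 3 (n / d))"
  have d0: "0 < d" using d_ge_1 by simp
  have "1 \<le> root 3 (n / d)"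
    using d_le_n d0 by simp
  then have b1: "1 \<le> ?b" using d_ge_1 by simp
  have "?b \<le> d" by simp
  also note d_le_n
  also have "real n \<le> 2 ^ (levels n - 1)"
    by (rule le_two_power_levels)
  finally have "?b \<le> 2 ^ (levels n - 1)" .
  then have ex: "\<exists>i. ?b \<le> 2 ^ i" by blast
  define i where "i = (LEAST i. ?b \<le> 2 ^ i)"
  have 1: "?b \<le> 2 ^ i" unfolding i_def using ex by (rule LeastI_ex)
  have "i \<le> levels n - 1" unfolding i_def by (rule Least_le) fact
  then have 2: "i < levels n" by (simp add: levels_def)
  have 3: "2 ^ i \<le> 2 * ?b"
  proof (cases i)
    case (Suc j)
    then have "j < i" by simp
    then have "\<not> ?b \<le> 2 ^ j" unfolding i_def by (rule not_less_Least)
    then have "2 ^ j \<le> ?b" by (metis linorder_linear)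
    then have "2 * 2 ^ j \<le> 2 * ?b" by (rule mult_left_mono) simp
    then show ?thesis by (simp only: Suc power_Suc)
  next
    case 0
    \<comment> \<open>Exponent 0 has no predecessor to compare with; here the minimum is at least 1
      because \<open>1 <= d <= n\<close>.\<close>
    show ?thesis using b1 unfolding 0 power_0 by linarith
  qed
  show ?thesis using 1 2 3 by blast
qed

text \<open>Origin of the constant: level \<open>j\<close> has three stages of at most
  \<open>65 * T * 2 ^ j\<close> samples, the levels up to \<open>i\<close> sum geometrically to at
  most \<open>195 * T * 2 ^ (i + 1)\<close>, \<open>2 ^ i\<close> is at most twice the minimum, and
  a sample from both samplers costs at most 10 queries. In all,
  \<open>195 * 4 * 10 = 7800\<close>.\<close>

lemma degree_estimator_ensures:
  assumes \<epsilon>: "0 < \<epsilon>" "\<epsilon> < 1" 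
  obtains q where "ensures V E (degree_estimator \<epsilon> n) (eps_approximations \<epsilon> d) q (1 / 100)"
    "q \<le> 7800 * certification_threshold \<epsilon> n * min d (root 3 (n / d))"
proof -
  define T where "T = certification_threshold \<epsilon> n"
  define \<delta> where "\<delta> = 1 / (600 * real (levels n))"
  have \<delta>0: "0 < \<delta>" by (simp add: \<delta>_def levels_def)
  have T: "T = 1 / ((\<epsilon> / 3)\<^sup>2 * \<delta>)" by (simp add: T_def \<delta>_def certification_threshold_def)
  have T1: "1 \<le> T"
  proof -
    have "(\<epsilon> / 3)\<^sup>2 * \<delta> \<le> 1 * 1"
      using \<epsilon> \<delta>0 by (intro mult_mono power_le_one) (auto simp: \<delta>_def levels_def)
    then show ?thesis using \<epsilon> \<delta>0 unfolding T by (subst le_divide_eq_1_pos) auto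
  qed
  obtain i where i: "i < levels n" "min d (root 3 (n / d)) \<le> 2 ^ i" "2 ^ i \<le> 2 * min d (root 3 (n / d))"
    using exists_level by blast
  obtain s c a b \<mu> \<nu> where e: "(s, c, a, b) \<in> set (level_estimators T n i)" "ratio_estimator V E d c a b \<mu> \<nu>"
    "4 * T \<le> real s * \<mu>" "4 * T \<le> real s * \<nu>"
    using level_has_large_estimator[OF T1 i(2,3)] by blast
  obtain as bs where sp: "level_estimators T n i = as @ (s, c, a, b) # bs"
    using split_list[OF e(1)] by blast
  define es where "es = concat (map (level_estimators T n) [0..<i]) @ as"
  have "[0..<levels n] = [0..<i] @ i # [Suc i..<levels n]"
    using upt_add_eq_append[of 0 i "levels n - i"] upt_conv_Cons[of i "levels n"] i(1) by simp
  then have split: "concat (map (level_estimators T n) [0..<levels n])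
      = es @ (s, c, a, b) # (bs @ concat (map (level_estimators T n) [Suc i..<levels n]))"
    by (simp add: es_def sp)
  have prefix: "es @ [(s, c, a, b)] @ bs = concat (map (level_estimators T n) [0..<Suc i])"
    by (simp add: es_def sp)
  have len: "length (level_estimators T n j) = 3" for j
    by (simp add: level_estimators_def Let_def)
  have "length (concat (map (level_estimators T n) [0..<Suc i])) = 3 * Suc i"
    by (simp only: length_concat map_map comp_def len) (simp add: sum_list_triv)
  then have length: "length es + 1 \<le> 3 * levels n"
    using i(1) prefix[THEN arg_cong[where f = length]] by simp
  have cost: "sum_list (map fst (level_estimators T n j)) \<le> 195 * T * 2 ^ j" for j
  proof -
    have "1 * 1 \<le> T * 2 ^ j" using T1 by (intro mult_mono) auto
    then have "real_of_int \<lceil>64 * T * 2 ^ j\<rceil> \<le> 65 * (T * 2 ^ j)" by linarith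
    then show ?thesis using T1 by (simp add: level_estimators_def Let_def)
  qed
  have "real (sum_list (map fst (concat (map (level_estimators T n) [0..<k])))) \<le> 195 * T * 2 ^ k" for k
  proof (induction k)
    case (Suc k)
    then show ?case using cost[of k] by simp
  qed (use T1 in simp)
  from this[of "Suc i"] have "real (sum_list (map fst (es @ [(s, c, a, b)]))) \<le> 195 * T * 2 ^ Suc i"
    unfolding prefix[symmetric] by simp
  also have "\<dots> \<le> 195 * T * (4 * min d (root 3 (n / d)))"
    using i(3) T1 by (intro mult_left_mono) auto
  finally have q: "real (10 * sum_list (map fst (es @ [(s, c, a, b)]))) \<le> 7800 * T * min d (root 3 (n / d))"
    by simp
  have valid: "\<exists>\<mu> \<nu>. ratio_estimator V E d c' a' b' \<mu> \<nu>" if "(s', c', a', b') \<in> set (es @ [(s, c, a, b)])" for s' c' a' b'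
  proof -
    have "set (es @ [(s, c, a, b)]) \<subseteq> set (concat (map (level_estimators T n) [0..<Suc i]))"
      unfolding prefix[symmetric] by auto
    with that have "(s', c', a', b') \<in> set (concat (map (level_estimators T n) [0..<Suc i]))"
      by blast
    then obtain j where "(s', c', a', b') \<in> set (level_estimators T n j)"
      by (auto simp del: upt_Suc)
    then show ?thesis by (rule level_estimators_valid)
  qed
  have d0: "0 \<le> d" using d_ge_1 by simp
  have ens: "ensures V E (degree_estimator \<epsilon> n) (eps_approximations \<epsilon> d)
      (10 * sum_list (map fst (es @ [(s, c, a, b)]))) (2 * \<delta> * (length es + 1))"
    unfolding degree_estimator_def T_def[symmetric] Let_def split
    by (rule ensures_first_certified[OF \<epsilon> \<delta>0 d0 T valid e(2-4)])
  have "2 * \<delta> * (length es + 1) \<le> 2 * \<delta> * (3 * levels n)"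
    using of_nat_mono[OF length] \<delta>0 by (intro mult_left_mono) simp_all
  also have "\<dots> = 1 / 100"
    by (simp add: \<delta>_def levels_def field_simps)
  finally have "ensures V E (degree_estimator \<epsilon> n) (eps_approximations \<epsilon> d)
      (10 * sum_list (map fst (es @ [(s, c, a, b)]))) (1 / 100)"
    by (rule ensures_mono[OF ens order_refl])
  then show ?thesis
    by (rule that) (use q in \<open>simp only: T_def\<close>)
qed

end

text \<open>The constant is \<open>7800 * 5400 * 6\<close>, where \<open>5400 = 9 * 600\<close>
  comes from \<open>certification_threshold\<close> and 6 from \<open>levels_le\<close>.\<close>

theorem degree_estimator_correct:
  assumes "0 < \<epsilon>" "\<epsilon> < 1" "simple_graph V E" "no_isolated_vertices V E" "card V = n"
    and d: "d = average_degree V E"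
  defines "L \<equiv> \<lambda>n::nat. 252720000 * ln (real n) ^ 1"
  shows "outputs_within V E (degree_estimator \<epsilon> n) (eps_approximations \<epsilon> d)
           (L n * (1 / \<epsilon>\<^sup>2 * min d (root 3 (n / d))))" (is "outputs_within _ _ _ _ ?Q")
    and "outputs_within V E (degree_estimator \<epsilon> n) (eps_approximations \<epsilon> d)
           (L n * (1 / \<epsilon>\<^sup>2 * n powr (1 / 4)))"
proof -
  have d1: "1 \<le> d" "d \<le> n"
    using d_ge_1[OF assms(3-5)] d_le_n[OF assms(3-5)] d by auto
  interpret query_graph V E using assms by unfold_locales
  have n2: "2 \<le> n"
  proof -
    obtain e where "e \<in> E" using E_nonempty by auto
    then show ?thesis using card_mono[OF finite_V edge(1)] edge(2) assms(5) by metis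
  qed
  obtain q where q: "ensures V E (degree_estimator \<epsilon> n) (eps_approximations \<epsilon> d) q (1 / 100)"
    "q \<le> 7800 * certification_threshold \<epsilon> n * min d (root 3 (n / d))"
    using degree_estimator_ensures[OF assms(3-5) assms(1,2)] d by blast
  have min0: "0 \<le> min d (root 3 (n / d))" using d1 by simp
  have "certification_threshold \<epsilon> n = 5400 * real (levels n) / \<epsilon>\<^sup>2"
    by (simp add: certification_threshold_def power_divide)
  also have "\<dots> \<le> 5400 * (6 * ln n) / \<epsilon>\<^sup>2"
    using levels_le[OF n2] by (intro divide_right_mono mult_left_mono) auto
  finally have "7800 * certification_threshold \<epsilon> n * min d (root 3 (n / d)) \<le> 7800 * (5400 * (6 * ln n) / \<epsilon>\<^sup>2) * min d (root 3 (n / d))"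
    using min0 by (intro mult_right_mono mult_left_mono) auto
  with q(2) have qQ: "real q \<le> ?Q" by (simp add: L_def)
  have mono: "outputs_within V E (degree_estimator \<epsilon> n) (eps_approximations \<epsilon> d) r" if "real q \<le> r" for r
  proof -
    have "measure_pmf.prob (run V E (degree_estimator \<epsilon> n)) {(r, t). r \<in> eps_approximations \<epsilon> d \<and> t \<le> q}
        \<le> measure_pmf.prob (run V E (degree_estimator \<epsilon> n)) {(x, t). x \<in> eps_approximations \<epsilon> d \<and> real t \<le> r}"
      using that by (intro measure_pmf.finite_measure_mono) auto
    then show ?thesis using q(1) by (simp add: outputs_within_def ensures_def)
  qed
  show "outputs_within V E (degree_estimator \<epsilon> n) (eps_approximations \<epsilon> d) ?Q"
    using qQ by (rule mono)
  \<comment> \<open>The two terms meet at \<open>d = n powr (1 / 4)\<close>; beyond this point the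
    cube root only decreases.\<close>
  have "min d (root 3 (n / d)) \<le> n powr (1 / 4)"
  proof (cases "d \<le> n powr (1 / 4)")
    case False
    then have "n / d \<le> n / n powr (1 / 4)"
      using n2 d1 by (intro divide_left_mono) auto
    also have "\<dots> = n powr (3 / 4)"
      using n2 by (simp add: powr_diff[of n 1 "1/4", simplified])
    also have "\<dots> = (n powr (1 / 4)) ^ 3"
      using n2 by (simp add: powr_power)
    finally have "root 3 (n / d) \<le> root 3 ((n powr (1 / 4)) ^ 3)"
      by simp
    then show ?thesis by (simp add: real_root_power_cancel)
  qed simp
  then have "?Q \<le> L n * (1 / \<epsilon>\<^sup>2 * n powr (1 / 4))"
    using n2 by (intro mult_left_mono) (auto simp: L_def)
  with qQ show "outputs_within V E (degree_estimator \<epsilon> n) (eps_approximations \<epsilon> d)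
           (L n * (1 / \<epsilon>\<^sup>2 * n powr (1 / 4)))"
    by (intro mono) simp
qed

section \<open>Averages and failure probabilities\<close>

text \<open>Finite sums instead of integrals, so that averages over graphs, colourings and answers
  can be interchanged. An empty average is 0.\<close>

definition mean :: "'a set \<Rightarrow> ('a \<Rightarrow> real) \<Rightarrow> real" where
  "mean A f = (\<Sum>x\<in>A. f x) / real (card A)"

lemma mean_const: "finite A \<Longrightarrow> A \<noteq> {} \<Longrightarrow> mean A (\<lambda>_. c) = c"
  by (simp add: mean_def)

lemma mean_mono: "(\<And>x. x \<in> A \<Longrightarrow> f x \<le> g x) \<Longrightarrow> mean A f \<le> mean A g"
  unfolding mean_def by (intro divide_right_mono sum_mono) auto

lemma mean_cong: "A = B \<Longrightarrow> (\<And>x. x \<in> B \<Longrightarrow> f x = g x) \<Longrightarrow> mean A f = mean B g"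
  unfolding mean_def by simp

lemma mean_nonneg: "(\<And>x. x \<in> A \<Longrightarrow> 0 \<le> f x) \<Longrightarrow> 0 \<le> mean A f"
  unfolding mean_def by (intro divide_nonneg_nonneg sum_nonneg) auto

lemma mean_le:
  assumes "\<And>x. x \<in> A \<Longrightarrow> f x \<le> c" "0 \<le> c"
  shows "mean A f \<le> c"
proof (cases "finite A \<and> A \<noteq> {}")
  case True
  then show ?thesis using mean_mono[of A f "\<lambda>_. c"] assms by (simp add: mean_const)
qed (use assms in \<open>auto simp: mean_def\<close>)

lemma mean_add: "mean A (\<lambda>x. f x + g x) = mean A f + mean A g"
  by (simp add: mean_def sum.distrib add_divide_distrib)

lemma mean_diff_const:
  "finite A \<Longrightarrow> A \<noteq> {} \<Longrightarrow> mean A (\<lambda>x. f x - c) = mean A f - c"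
  by (simp add: mean_def sum_subtractf diff_divide_distrib)

lemma mean_mult_left: "mean A (\<lambda>x. c * f x) = c * mean A f"
  by (simp add: mean_def sum_distrib_left)

lemma mean_sum: "mean A (\<lambda>x. \<Sum>y\<in>B. f x y) = (\<Sum>y\<in>B. mean A (\<lambda>x. f x y))"
  unfolding mean_def by (subst sum.swap) (simp add: sum_divide_distrib)

lemma mean_swap: "mean A (\<lambda>x. mean B (f x)) = mean B (\<lambda>y. mean A (\<lambda>x. f x y))"
  unfolding mean_def sum_divide_distrib[symmetric] by (subst sum.swap) (simp add: mult.commute)

lemma mean_subset_ge:
  fixes f :: "'a \<Rightarrow> real" and \<rho> b :: real
  assumes "finite A" "B \<subseteq> A" "A \<noteq> {}" and f: "\<And>x. x \<in> A \<Longrightarrow> 0 \<le> f x \<and> f x \<le> 1"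
    and \<rho>: "0 \<le> \<rho>" "\<rho> \<le> 1" and bad: "real (card (A - B)) \<le> b * card A"
  shows "mean A f - (1 - \<rho>) - b \<le> \<rho> * (\<Sum>x\<in>B. f x) / card A"
proof -
  have cA: "0 < real (card A)" using assms by (simp add: card_gt_0_iff)
  have "(\<Sum>x\<in>A. f x) = (\<Sum>x\<in>A - B. f x) + (\<Sum>x\<in>B. f x)"
    using assms by (simp add: sum.subset_diff)
  also have "(\<Sum>x\<in>A - B. f x) \<le> card (A - B)"
    using sum_mono[of "A - B" f "\<lambda>_. 1"] f by simp
  finally have 1: "(\<Sum>x\<in>A. f x) \<le> b * card A + (\<Sum>x\<in>B. f x)" using bad by simp
  have "(\<Sum>x\<in>B. f x) \<le> card B"
    using sum_mono[of B f "\<lambda>_. 1"] f \<open>B \<subseteq> A\<close> by auto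
  also have "real (card B) \<le> card A"
    using assms by (simp add: card_mono)
  finally have "(1 - \<rho>) * (\<Sum>x\<in>B. f x) \<le> (1 - \<rho>) * card A"
    using \<rho> by (intro mult_left_mono) auto
  then have "(\<Sum>x\<in>A. f x) \<le> (b + (1 - \<rho>)) * card A + \<rho> * (\<Sum>x\<in>B. f x)"
    using 1 by (simp add: algebra_simps)
  then have "(\<Sum>x\<in>A. f x) / card A \<le> ((b + (1 - \<rho>)) * card A + \<rho> * (\<Sum>x\<in>B. f x)) / card A"
    by (intro divide_right_mono) auto
  then show ?thesis using cA by (simp add: mean_def add_divide_distrib)
qed

text \<open>The pattern for random neighbors in a clique and for random edges: \<open>B\<close>
  holds the answers that are still fresh, \<open>\<rho>\<close> is the factor by which their true
  probability may fall short, and \<open>e\<close> is the loss of the later queries. As values are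
  at most 1, dropping the other answers costs at most \<open>b\<close> and the factor at most
  \<open>1 - \<rho>\<close>.\<close>

lemma mean_subset_approx:
  fixes f f' :: "'a \<Rightarrow> real" and \<rho> b e :: real
  assumes "finite A" "B \<subseteq> A" "A \<noteq> {}" and f: "\<And>x. x \<in> A \<Longrightarrow> 0 \<le> f x \<and> f x \<le> 1"
    and \<rho>: "0 \<le> \<rho>" "\<rho> \<le> 1" and bad: "real (card (A - B)) \<le> b * card A"
    and e: "0 \<le> e" and f': "\<And>x. x \<in> B \<Longrightarrow> f x - e \<le> f' x"
  shows "mean A f - e - (1 - \<rho>) - b \<le> \<rho> * (\<Sum>x\<in>B. f' x) / card A"
proof -
  have cA: "0 < real (card A)" using assms by (simp add: card_gt_0_iff)
  have BA: "real (card B) \<le> card A" using assms by (simp add: card_mono)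
  have "(\<Sum>x\<in>B. f x) - card B * e \<le> (\<Sum>x\<in>B. f' x)"
    using sum_mono[of B "\<lambda>x. f x - e" f'] f' by (simp add: sum_subtractf)
  then have "\<rho> * (\<Sum>x\<in>B. f x) - \<rho> * (card B * e) \<le> \<rho> * (\<Sum>x\<in>B. f' x)"
    using \<rho> by (simp add: mult_left_mono flip: right_diff_distrib)
  moreover have "\<rho> * (card B * e) \<le> 1 * (card A * e)"
    using \<rho> BA e by (intro mult_mono) auto
  ultimately have "(\<rho> * (\<Sum>x\<in>B. f x) - card A * e) / card A \<le> \<rho> * (\<Sum>x\<in>B. f' x) / card A"
    by (intro divide_right_mono) auto
  then have "\<rho> * (\<Sum>x\<in>B. f x) / card A - e \<le> \<rho> * (\<Sum>x\<in>B. f' x) / card A"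
    using cA by (simp add: diff_divide_distrib)
  moreover have "mean A f - (1 - \<rho>) - b \<le> \<rho> * (\<Sum>x\<in>B. f x) / card A"
    by (rule mean_subset_ge[OF assms(1-4) \<rho> bad])
  ultimately show ?thesis by linarith
qed

section \<open>Failure probability under a query budget\<close>

definition failure :: "'v set \<Rightarrow> 'v set set \<Rightarrow> real set \<Rightarrow> 'v algorithm \<Rightarrow> nat \<Rightarrow> real" where
  "failure V E S A j = measure_pmf.prob (run V E A) {(r, t). r \<in> S \<longrightarrow> j < t}"

lemma failure_bounds [simp]: "0 \<le> failure V E S A j" "failure V E S A j \<le> 1"
  by (simp_all add: failure_def)

lemma prob_charge_0: "measure_pmf.prob (charge p) {(r, t). r \<in> S \<longrightarrow> 0 < t} = 1"
proof -
  have "(\<lambda>(r, t). (r, Suc t)) -` {(r :: real, t). r \<in> S \<longrightarrow> 0 < t} = UNIV"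
    by auto
  then show ?thesis by (simp add: charge_def)
qed

lemma prob_charge_Suc:
  "measure_pmf.prob (charge p) {(r, t). r \<in> S \<longrightarrow> Suc j < t} = measure_pmf.prob p {(r, t). r \<in> S \<longrightarrow> j < t}"
proof -
  have "(\<lambda>(r, t). (r, Suc t)) -` {(r :: real, t). r \<in> S \<longrightarrow> Suc j < t} = {(r, t). r \<in> S \<longrightarrow> j < t}"
    by auto
  then show ?thesis by (simp add: charge_def)
qed

lemma failure_Output: "failure V E S (Output r) j = of_bool (r \<notin> S)"
  by (simp add: failure_def)

lemma failure_Toss: "failure V E S (Toss p k) j = measure_pmf.expectation p (\<lambda>i. failure V E S (k i) j)"
  by (simp add: failure_def prob_bind_pmf)

lemma failure_0:
  "failure V E S (RandVert k1) 0 = 1" "failure V E S (RandNbr x k2) 0 = 1" "failure V E S (Degree x k3) 0 = 1"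
  "failure V E S (PairQuery x y k4) 0 = 1" "failure V E S (RandEdge k5) 0 = 1"
  using prob_charge_0 by (simp_all add: failure_def)

lemma failure_RandVert:
  assumes "finite V" "V \<noteq> {}"
  shows "failure V E S (RandVert k) (Suc j) = mean V (\<lambda>x. failure V E S (k x) j)"
  using assms by (simp add: failure_def prob_charge_Suc prob_bind_pmf integral_pmf_of_set mean_def)

lemma failure_RandEdge:
  assumes "finite E" "E \<noteq> {}"
  shows "failure V E S (RandEdge k) (Suc j) = mean E (\<lambda>e. failure V E S (k e) j)"
  using assms by (simp add: failure_def prob_charge_Suc prob_bind_pmf integral_pmf_of_set mean_def)

lemma failure_Degree: "failure V E S (Degree x k) (Suc j) = failure V E S (k (degree E x)) j"
  by (simp add: failure_def prob_charge_Suc)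

lemma failure_PairQuery: "failure V E S (PairQuery x y k) (Suc j) = failure V E S (k ({x, y} \<in> E)) j"
  by (simp add: failure_def prob_charge_Suc)

lemma failure_RandNbr:
  assumes "finite (neighbors E x)"
  shows "failure V E S (RandNbr x k) (Suc j) =
    (if neighbors E x = {} then failure V E S (k None) j
     else mean (neighbors E x) (\<lambda>y. failure V E S (k (Some y)) j))"
  using assms
  by (simp add: failure_def prob_charge_Suc random_neighbor_def bind_return_pmf bind_map_pmf prob_bind_pmf integral_pmf_of_set mean_def)

section \<open>Answers that do not depend on the hidden graph\<close>

text \<open>
  The knowledge \<open>\<beta>\<close> of an algorithm about the non-universal vertices: \<open>0\<close> stands for a vertex of
  degree 1, and \<open>i > 0\<close> for a vertex reached from the \<open>i\<close>-th random edge.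
\<close>

definition touch :: "'v \<Rightarrow> ('v \<rightharpoonup> nat) \<Rightarrow> ('v \<rightharpoonup> nat)" where
  "touch x \<beta> = (if \<beta> x = None then \<beta>(x \<mapsto> 0) else \<beta>)"

text \<open>The number of cliques is kept out of this locale on purpose: hidden graphs with
  different numbers of cliques then share one simulator.\<close>

locale hidden_cliques_view =
  fixes V :: "'v::linorder set" and z :: 'v and D :: nat
  assumes finite_V: "finite V" and z: "z \<in> V" and V_ne: "V - {z} \<noteq> {}"
begin

definition W :: "'v set" where
  "W = V - {z}"

lemma finite_W: "finite W" and W_ne: "W \<noteq> {}" and z_notin_W: "z \<notin> W" and mem_V_iff: "x \<in> V \<longleftrightarrow> x = z \<or> x \<in> W"
  using finite_V V_ne z by (auto simp: W_def)

text \<open>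
  The failure probability when all answers are given by a simulator that does not know the hidden
  graph: a vertex that is queried before it has been seen has degree 1, random edges and random
  neighbors inside cliques are uniform among all vertices but \<open>z\<close>, and two vertices are adjacent only if this is already known.
  Running out of queries counts as failure. The simulator may assign a vertex twice; this is an
  event that the comparison with the real graph charges to the error.
\<close>

primrec ideal :: "real set \<Rightarrow> 'v algorithm \<Rightarrow> nat \<Rightarrow> ('v \<rightharpoonup> nat) \<Rightarrow> nat \<Rightarrow> real" where
  "ideal S (Output x) = (\<lambda>j \<beta> r. of_bool (x \<notin> S))"
| "ideal S (Toss p k) = (\<lambda>j \<beta> r. measure_pmf.expectation p (\<lambda>i. ideal S (k i) j \<beta> r))"
| "ideal S (RandVert k) = (\<lambda>j \<beta> r. if j = 0 then 1 else mean V (\<lambda>x. ideal S (k x) (j - 1) \<beta> r))"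
| "ideal S (RandNbr x k) = (\<lambda>j \<beta> r. if j = 0 then 1
     else if x \<notin> V then ideal S (k None) (j - 1) \<beta> r
     else if x = z then mean W (\<lambda>y. ideal S (k (Some y)) (j - 1) \<beta> r)
     else if touch x \<beta> x = Some 0 then ideal S (k (Some z)) (j - 1) (touch x \<beta>) r
     else mean W (\<lambda>y. ideal S (k (Some y)) (j - 1) (\<beta>(y := \<beta> x)) r))"
| "ideal S (Degree x k) = (\<lambda>j \<beta> r. if j = 0 then 1
     else if x \<notin> V then ideal S (k 0) (j - 1) \<beta> r
     else if x = z then ideal S (k (card W)) (j - 1) \<beta> r
     else if touch x \<beta> x = Some 0 then ideal S (k 1) (j - 1) (touch x \<beta>) r
     else ideal S (k D) (j - 1) \<beta> r)"
| "ideal S (PairQuery x y k) = (\<lambda>j \<beta> r. if j = 0 then 1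
     else if x \<notin> V \<or> y \<notin> V \<or> x = y then ideal S (k False) (j - 1) \<beta> r
     else if x = z \<or> y = z then ideal S (k True) (j - 1) \<beta> r
     else let \<beta>' = touch y (touch x \<beta>) in ideal S (k (\<beta>' x = \<beta>' y \<and> \<beta>' x \<noteq> Some 0)) (j - 1) \<beta>' r)"
| "ideal S (RandEdge k) = (\<lambda>j \<beta> r. if j = 0 then 1
     else mean (W \<times> W) (\<lambda>(x, y). ideal S (k {x, y}) (j - 1) (\<beta>(x \<mapsto> Suc r, y \<mapsto> Suc r)) (Suc r)))"

lemma ideal_bounds: "0 \<le> ideal S A j \<beta> r \<and> ideal S A j \<beta> r \<le> 1"
proof (induction A arbitrary: j \<beta> r)
  case (Toss p k)
  have "0 \<le> measure_pmf.expectation p (\<lambda>i. ideal S (k i) j \<beta> r)"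
    using Toss by (intro integral_nonneg_AE) auto
  moreover have "measure_pmf.expectation p (\<lambda>i. ideal S (k i) j \<beta> r) \<le> measure_pmf.expectation p (\<lambda>i. 1)"
    using Toss by (intro integral_mono integrable_bounded_pmf[where B = 1]) (auto simp: abs_le_iff intro: order_trans[of _ 0])
  ultimately show ?case by simp
qed (auto simp: Let_def intro!: mean_nonneg mean_le)

text \<open>One simulated run serves both target sets. Its single output misses at least one of
  them, and running out of queries counts as failure for both.\<close>

lemma ideal_disjoint:
  assumes "S \<inter> S' = {}"
  shows "1 \<le> ideal S A j \<beta> r + ideal S' A j \<beta> r"
proof (induction A arbitrary: j \<beta> r)
  case (Output x)
  then show ?case using assms by auto
next
  case (Toss p k)
  have int: "integrable p (\<lambda>i. ideal T (k i) j \<beta> r)" for T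
    by (rule integrable_bounded_pmf[where B = 1]) (use ideal_bounds in \<open>auto simp: abs_le_iff intro: order_trans[of _ 0]\<close>)
  have "1 = measure_pmf.expectation p (\<lambda>i. 1 :: real)" by simp
  also have "\<dots> \<le> measure_pmf.expectation p (\<lambda>i. ideal S (k i) j \<beta> r + ideal S' (k i) j \<beta> r)"
    using Toss int by (intro integral_mono) auto
  finally show ?case using int by simp
next
  case (RandVert k)
  have "1 \<le> mean V (\<lambda>x. ideal S (k x) (j - 1) \<beta> r + ideal S' (k x) (j - 1) \<beta> r)"
    using RandVert mean_mono[of V "\<lambda>_. 1"] finite_V z by (cases "V = {}") (auto simp: mean_const)
  then show ?case by (simp add: mean_add)
next
  case (RandNbr x k)
  have "1 \<le> mean W (\<lambda>y. ideal S (k (Some y)) (j - 1) (b y) r + ideal S' (k (Some y)) (j - 1) (b y) r)" for b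
    using RandNbr mean_mono[of W "\<lambda>_. 1"] finite_W W_ne by (auto simp: mean_const)
  then show ?case using RandNbr by (simp add: mean_add)
next
  case (RandEdge k)
  let ?f = "\<lambda>T (x, y). ideal T (k {x, y}) (j - 1) (\<beta>(x \<mapsto> Suc r, y \<mapsto> Suc r)) (Suc r)"
  have "1 \<le> mean (W \<times> W) (\<lambda>p. ?f S p + ?f S' p)"
    using RandEdge mean_mono[of "W \<times> W" "\<lambda>_. 1"] finite_W W_ne
    by (simp add: mean_const case_prod_beta)
  then show ?case by (simp add: mean_add)
qed (auto simp: Let_def)

end

section \<open>Hidden cliques\<close>

text \<open>Translates edge numbers into labels of the graph: \<open>h i\<close> is the clique hit
  by the \<open>i\<close>-th random edge.\<close>

definition retrieve :: "(nat \<Rightarrow> nat) \<Rightarrow> ('v \<rightharpoonup> nat) \<Rightarrow> ('v \<rightharpoonup> nat)" where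
  "retrieve h \<beta> = map_option h \<circ> \<beta>"

lemma touch_dom: "x \<in> dom \<beta> \<Longrightarrow> touch x \<beta> = \<beta>"
  by (auto simp: touch_def)

lemma dom_touch: "dom (touch x \<beta>) = insert x (dom \<beta>)"
  by (auto simp: touch_def)

lemma ran_touch: "ran (touch x \<beta>) \<subseteq> insert 0 (ran \<beta>)"
  by (auto simp: touch_def ran_def)

text \<open>\<open>U\<close> bounds the number of vertices whose label is known. The assumptions
  leave unseen members in every clique, even after one end of a further edge is placed, and unseen
  light vertices.\<close>

locale hidden_cliques = hidden_cliques_view V z D
  for V :: "'v::linorder set" and z :: 'v and D :: nat +
  fixes g U :: nat
  assumes g: "1 \<le> g" and U: "U + 1 < D" and small: "g * D + U < card W"
begin

text \<open>
  The vertex \<open>z\<close> is adjacent to all others, each of the labels \<open>1, \<dots>, g\<close> marks a clique of \<open>D\<close>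
  vertices, and the vertices labelled \<open>0\<close> have degree 1. Because of \<open>z\<close>, no degree depends on \<open>g\<close>.
\<close>

definition graph_of :: "('v \<Rightarrow> nat) \<Rightarrow> 'v set set" where
  "graph_of \<omega> = {{z, x} | x. x \<in> W} \<union> {{x, y} | x y. x \<in> W \<and> y \<in> W \<and> x \<noteq> y \<and> \<omega> x = \<omega> y \<and> \<omega> x \<noteq> 0}"

definition labellings :: "('v \<Rightarrow> nat) set" where
  "labellings = {\<omega> \<in> W \<rightarrow>\<^sub>E {0..g}. \<forall>c\<in>{1..g}. card {x \<in> W. \<omega> x = c} = D}"

text \<open>The uniform distribution on this set is that of a random labelling conditioned on
  \<open>\<kappa>\<close>.\<close>

definition worlds :: "('v \<rightharpoonup> nat) \<Rightarrow> ('v \<Rightarrow> nat) set" where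
  "worlds \<kappa> = {\<omega> \<in> labellings. \<forall>x c. \<kappa> x = Some c \<longrightarrow> \<omega> x = c}"

definition class_size :: "nat \<Rightarrow> nat" where
  "class_size c = (if c = 0 then card W - g * D else D)"

lemma finite_labellings: "finite labellings"
  unfolding labellings_def using finite_W by (intro finite_subset[OF _ finite_PiE[of W "\<lambda>_. {0..g}"]]) auto

lemma finite_worlds: "finite (worlds \<kappa>)"
  unfolding worlds_def using finite_labellings by simp

lemma worlds_labellings: "\<omega> \<in> worlds \<kappa> \<Longrightarrow> \<omega> \<in> labellings"
  by (simp add: worlds_def)

lemma labelling_le: "\<omega> \<in> labellings \<Longrightarrow> x \<in> W \<Longrightarrow> \<omega> x \<le> g"
  by (auto simp: labellings_def PiE_def Pi_def)

lemma card_class: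
  assumes "\<omega> \<in> labellings" "c \<le> g"
  shows "card {x \<in> W. \<omega> x = c} = class_size c"
proof (cases "c = 0")
  case False
  then show ?thesis using assms by (simp add: labellings_def class_size_def)
next
  case True
  have "card W = card (\<Union>c\<in>{0..g}. {x \<in> W. \<omega> x = c})"
    using labelling_le[OF assms(1)] by (intro arg_cong[where f = card]) auto
  also have "\<dots> = (\<Sum>c\<in>{0..g}. card {x \<in> W. \<omega> x = c})"
    using finite_W by (intro card_UN_disjoint) auto
  also have "\<dots> = card {x \<in> W. \<omega> x = 0} + (\<Sum>c\<in>{1..g}. card {x \<in> W. \<omega> x = c})"
    by (simp add: sum.atLeast_Suc_atMost)
  also have "(\<Sum>c\<in>{1..g}. card {x \<in> W. \<omega> x = c}) = (\<Sum>c\<in>{1..g}. D)"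
    using assms by (intro sum.cong) (auto simp: labellings_def)
  finally show ?thesis using True by (simp add: class_size_def)
qed

lemma labellings_nonempty: "labellings \<noteq> {}"
proof -
  obtain f where f: "bij_betw f W {0..<card W}"
    using finite_W ex_bij_betw_finite_nat by blast
  \<comment> \<open>Blocks of \<open>D\<close> consecutive indices form the cliques; the shift by 1
    reserves label 0 for the light vertices.\<close>
  define \<omega> where "\<omega> x = (if x \<in> W then if f x < g * D then f x div D + 1 else 0 else undefined)" for x
  have D0: "0 < D" using U by simp
  have dm: "i div D * D \<le> i" "i < i div D * D + D" for i
    using div_mult_mod_eq[of i D] mod_less_divisor[OF D0, of i] by linarith+
  have "\<omega> \<in> W \<rightarrow>\<^sub>E {0..g}"
    by (auto simp: \<omega>_def Suc_le_eq less_mult_imp_div_less)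
  moreover have "card {x \<in> W. \<omega> x = c} = D" if c: "c \<in> {1..g}" for c
  proof -
    obtain b where b: "c = Suc b" "b < g" using c by (cases c) auto
    have "f ` {x \<in> W. \<omega> x = c} = {b * D..<b * D + D}"
    proof -
      have "f x \<in> {b * D..<b * D + D}" if "x \<in> W" "\<omega> x = c" for x
      proof -
        have "f x div D = b" using that b by (simp add: \<omega>_def split: if_splits)
        then show ?thesis using dm[of "f x"] by (simp only: atLeastLessThan_iff)
      qed
      moreover have "i \<in> f ` {x \<in> W. \<omega> x = c}" if i: "i \<in> {b * D..<b * D + D}" for i
      proof -
        have "i < Suc b * D" using i by simp
        also have "\<dots> \<le> g * D" using b by (intro mult_le_mono1) simp
        finally have "i < g * D" .
        moreover have "i div D = b" using i by (intro div_nat_eqI) (auto simp: mult.commute)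
        moreover have "i \<in> f ` W" using f \<open>i < g * D\<close> small by (simp add: bij_betw_def)
        ultimately show ?thesis using b by (auto simp: \<omega>_def)
      qed
      ultimately show ?thesis by blast
    qed
    moreover have "inj_on f {x \<in> W. \<omega> x = c}"
      using f by (auto simp: bij_betw_def inj_on_def)
    ultimately have "card {x \<in> W. \<omega> x = c} = card {b * D..<b * D + D}"
      using card_image by fastforce
    then show ?thesis by simp
  qed
  ultimately have "\<omega> \<in> labellings" by (simp add: labellings_def)
  then show ?thesis by blast
qed

section \<open>Conditional label probabilities by counting worlds\<close>

lemma worlds_update:
  "x \<notin> dom \<kappa> \<Longrightarrow> worlds (\<kappa>(x \<mapsto> c)) = {\<omega> \<in> worlds \<kappa>. \<omega> x = c}"
  by (auto simp: worlds_def)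

lemma labelling_transpose:
  assumes "\<omega> \<in> labellings" "x \<in> W" "y \<in> W"
  shows "\<omega> \<circ> Transposition.transpose x y \<in> labellings"
proof -
  let ?t = "Transposition.transpose x y"
  have tW: "?t w \<in> W \<longleftrightarrow> w \<in> W" for w
    using assms(2,3) by (auto simp: Transposition.transpose_def)
  have "\<omega> \<in> W \<rightarrow>\<^sub>E {0..g}"
    using assms(1) by (simp add: labellings_def)
  then have "\<omega> \<circ> ?t \<in> W \<rightarrow>\<^sub>E {0..g}"
    using tW by (auto simp: PiE_def Pi_def extensional_def)
  moreover have "card {w \<in> W. (\<omega> \<circ> ?t) w = c} = card {w \<in> W. \<omega> w = c}" for c
  proof -
    have "bij_betw ?t {w \<in> W. (\<omega> \<circ> ?t) w = c} {w \<in> W. \<omega> w = c}"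
      by (rule bij_betw_byWitness[where f' = ?t]) (auto simp: tW)
    then show ?thesis by (rule bij_betw_same_card)
  qed
  ultimately show ?thesis using assms(1) by (simp add: labellings_def)
qed

lemma card_worlds_exchange:
  assumes "x \<in> W - dom \<kappa>" "y \<in> W - dom \<kappa>"
  shows "card (worlds (\<kappa>(x \<mapsto> c))) = card (worlds (\<kappa>(y \<mapsto> c)))"
proof -
  let ?t = "Transposition.transpose x y"
  have *: "\<omega> \<circ> ?t \<in> worlds (\<kappa>(b \<mapsto> c))"
    if "\<omega> \<in> worlds (\<kappa>(a \<mapsto> c))" "a \<in> {x, y}" "b \<in> {x, y}" "?t b = a" for \<omega> a b
  proof -
    have ab: "a \<notin> dom \<kappa>" "b \<notin> dom \<kappa>" using that assms by auto
    have \<omega>: "\<omega> \<in> worlds \<kappa>" "\<omega> a = c"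
      using that(1) unfolding worlds_update[OF ab(1)] by auto
    have "?t w = w" if "\<kappa> w = Some d" for w d
      using that assms by (auto simp: Transposition.transpose_def)
    then have "\<omega> \<circ> ?t \<in> worlds \<kappa>"
      using \<omega>(1) labelling_transpose[of \<omega> x y] assms by (simp add: worlds_def)
    then show ?thesis
      unfolding worlds_update[OF ab(2)] using \<omega>(2) that(4) by simp
  qed
  have "bij_betw (\<lambda>\<omega>. \<omega> \<circ> ?t) (worlds (\<kappa>(x \<mapsto> c))) (worlds (\<kappa>(y \<mapsto> c)))"
  proof (rule bij_betw_byWitness[where f' = "\<lambda>\<omega>. \<omega> \<circ> ?t"])
    show "(\<lambda>\<omega>. \<omega> \<circ> ?t) ` worlds (\<kappa>(x \<mapsto> c)) \<subseteq> worlds (\<kappa>(y \<mapsto> c))"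
      by (intro image_subsetI *[where a = x and b = y]) auto
    show "(\<lambda>\<omega>. \<omega> \<circ> ?t) ` worlds (\<kappa>(y \<mapsto> c)) \<subseteq> worlds (\<kappa>(x \<mapsto> c))"
      by (intro image_subsetI *[where a = y and b = x]) auto
  qed (simp_all add: comp_assoc)
  then show ?thesis by (rule bij_betw_same_card)
qed

text \<open>
  Exchanging two vertices shows that the count is the same for every unseen \<open>x\<close>; then sum over \<open>x\<close>.
\<close>

lemma card_worlds_update:
  assumes x: "x \<in> W - dom \<kappa>" and dom: "dom \<kappa> \<subseteq> W" and c: "c \<le> g"
  shows "card (worlds (\<kappa>(x \<mapsto> c))) * (card W - card (dom \<kappa>))
       = card (worlds \<kappa>) * (class_size c - card {y \<in> dom \<kappa>. \<kappa> y = Some c})"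
proof -
  have fin: "finite (W - dom \<kappa>)" using finite_W by simp
  have "card (worlds (\<kappa>(x \<mapsto> c))) * (card W - card (dom \<kappa>)) = (\<Sum>y\<in>W - dom \<kappa>. card (worlds (\<kappa>(x \<mapsto> c))))"
    using dom finite_W by (simp add: card_Diff_subset finite_subset mult.commute)
  also have "\<dots> = (\<Sum>y\<in>W - dom \<kappa>. card {\<omega> \<in> worlds \<kappa>. \<omega> y = c})"
    using card_worlds_exchange[OF x] by (intro sum.cong refl) (auto simp: worlds_update)
  also have "\<dots> = (\<Sum>\<omega>\<in>worlds \<kappa>. card {y \<in> W - dom \<kappa>. \<omega> y = c})"
    using sum.swap_restrict[OF fin finite_worlds, where g = "\<lambda>_ _. 1 :: nat" and R = "\<lambda>y \<omega>. \<omega> y = c"] by simp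
  also have "\<dots> = (\<Sum>\<omega>\<in>worlds \<kappa>. class_size c - card {y \<in> dom \<kappa>. \<kappa> y = Some c})"
  proof (intro sum.cong refl)
    fix \<omega> assume \<omega>: "\<omega> \<in> worlds \<kappa>"
    have "{y \<in> W - dom \<kappa>. \<omega> y = c} = {y \<in> W. \<omega> y = c} - {y \<in> dom \<kappa>. \<kappa> y = Some c}"
      using \<omega> by (auto simp: worlds_def)
    moreover have "{y \<in> dom \<kappa>. \<kappa> y = Some c} \<subseteq> {y \<in> W. \<omega> y = c}"
      using \<omega> dom by (auto simp: worlds_def)
    ultimately show "card {y \<in> W - dom \<kappa>. \<omega> y = c} = class_size c - card {y \<in> dom \<kappa>. \<kappa> y = Some c}"
      using card_class[OF worlds_labellings[OF \<omega>] c] finite_W dom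
      by (simp add: card_Diff_subset finite_subset)
  qed
  finally show ?thesis by simp
qed

definition admissible :: "('v \<rightharpoonup> nat) \<Rightarrow> bool" where
  "admissible \<kappa> \<longleftrightarrow> dom \<kappa> \<subseteq> W \<and> card (dom \<kappa>) \<le> U \<and> ran \<kappa> \<subseteq> {0..g}"

text \<open>The cliques hold at most \<open>g * D\<close> of the at least \<open>card W - U\<close>
  unseen vertices.\<close>

lemma card_worlds_light:
  assumes \<kappa>: "admissible \<kappa>" and x: "x \<in> W - dom \<kappa>"
  shows "(1 - real (g * D) / real (card W - U)) * card (worlds \<kappa>) \<le> card (worlds (\<kappa>(x \<mapsto> 0)))"
proof -
  let ?u = "card (dom \<kappa>)" and ?n = "card W" and ?l = "card {y \<in> dom \<kappa>. \<kappa> y = Some 0}"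
  have dom: "dom \<kappa> \<subseteq> W" and u: "?u \<le> U" using \<kappa> by (auto simp: admissible_def)
  have l: "?l \<le> ?u" using finite_subset[OF dom finite_W] by (intro card_mono) auto
  have pos: "0 < real (?n - ?u)" using small u by simp
  have upd: "card (worlds (\<kappa>(x \<mapsto> 0))) * (?n - ?u) = card (worlds \<kappa>) * (?n - g * D - ?l)"
    using card_worlds_update[OF x dom, of 0] by (simp add: class_size_def)
  have "(1 - real (g * D) / real (?n - U)) * real (?n - ?u) \<le> (1 - real (g * D) / real (?n - ?u)) * real (?n - ?u)"
    using u small by (intro mult_right_mono diff_left_mono divide_left_mono) auto
  also have "\<dots> = real (?n - ?u) - real (g * D)" using pos by (simp add: field_simps)
  also have "\<dots> = real (?n - ?u - g * D)" using small u by (simp add: of_nat_diff)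
  also have "\<dots> \<le> real (?n - g * D - ?l)" using l by simp
  finally have "(1 - real (g * D) / real (?n - U)) * real (?n - ?u) * card (worlds \<kappa>) \<le> real (?n - g * D - ?l) * card (worlds \<kappa>)"
    by (intro mult_right_mono) auto
  also have "\<dots> = real (card (worlds (\<kappa>(x \<mapsto> 0)))) * real (?n - ?u)"
    using arg_cong[OF upd, of real] by (simp only: of_nat_mult mult.commute)
  finally have "((1 - real (g * D) / real (?n - U)) * card (worlds \<kappa>)) * real (?n - ?u) \<le> real (card (worlds (\<kappa>(x \<mapsto> 0)))) * real (?n - ?u)"
    by (simp only: mult_ac)
  then show ?thesis using pos by (rule mult_right_le_imp_le)
qed

text \<open>At least \<open>D - u\<close> members of clique \<open>c\<close> are unseen. Dividing by
  \<open>card W\<close> instead of the number of unseen vertices fits the simulator, whose answers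
  are uniform on \<open>W\<close>.\<close>

lemma card_worlds_heavy:
  assumes \<kappa>: "dom \<kappa> \<subseteq> W" and x: "x \<in> W - dom \<kappa>" and c: "c \<in> {1..g}"
    and u: "card (dom \<kappa>) \<le> u" "u \<le> D"
  shows "(real (D - u) / card W) * card (worlds \<kappa>) \<le> card (worlds (\<kappa>(x \<mapsto> c)))"
proof -
  let ?u = "card (dom \<kappa>)" and ?n = "card W" and ?l = "card {y \<in> dom \<kappa>. \<kappa> y = Some c}"
  have l: "?l \<le> ?u" using finite_subset[OF \<kappa> finite_W] by (intro card_mono) auto
  have W0: "0 < real ?n" using small by simp
  have upd: "card (worlds (\<kappa>(x \<mapsto> c))) * (?n - ?u) = card (worlds \<kappa>) * (D - ?l)"
    using card_worlds_update[OF x \<kappa>, of c] c by (simp add: class_size_def)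
  have "real (D - u) * card (worlds \<kappa>) \<le> real (D - ?l) * card (worlds \<kappa>)"
    using l u by (intro mult_right_mono) auto
  also have "\<dots> = real (card (worlds (\<kappa>(x \<mapsto> c)))) * real (?n - ?u)"
    using arg_cong[OF upd, of real] by (simp only: of_nat_mult mult.commute)
  also have "\<dots> \<le> real (card (worlds (\<kappa>(x \<mapsto> c)))) * real ?n"
    by (intro mult_left_mono) auto
  finally show ?thesis using W0 by (simp add: field_simps)
qed

text \<open>Known labels are added one at a time, and each keeps a positive share of the worlds
  because \<open>U < D\<close> and \<open>g * D + U < card W\<close>.\<close>

lemma card_worlds_pos:
  assumes "admissible \<kappa>"
  shows "0 < card (worlds \<kappa>)"
proof -
  have "finite (dom \<kappa>)" using assms finite_W by (auto simp: admissible_def intro: finite_subset)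
  then show ?thesis using assms
  proof (induction "dom \<kappa>" arbitrary: \<kappa> rule: finite_induct)
    case empty
    then have "worlds \<kappa> = labellings" by (auto simp: worlds_def)
    then show ?case using labellings_nonempty finite_labellings by (simp add: card_gt_0_iff)
  next
    case (insert x F)
    let ?\<kappa> = "\<kappa>(x := None)"
    obtain c where c: "\<kappa> x = Some c" using insert(4) by blast
    have F: "F = dom ?\<kappa>" using insert(2,4) by auto
    have ad: "dom \<kappa> \<subseteq> W" "card (dom \<kappa>) \<le> U" "ran \<kappa> \<subseteq> {0..g}"
      using insert.prems by (auto simp: admissible_def)
    have cu: "card (dom \<kappa>) = Suc (card F)" using insert(1,2,4) by (metis card_insert_disjoint)
    have "admissible ?\<kappa>"
      using ad cu F by (auto simp: admissible_def ran_def split: if_splits)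
    then have pos: "0 < card (worlds ?\<kappa>)" using insert(3)[OF F] by simp
    have x: "x \<in> W - dom ?\<kappa>" using c ad by auto
    have upd: "?\<kappa>(x \<mapsto> c) = \<kappa>" using c by auto
    have cg: "c \<le> g" using c ad by (auto simp: ran_def)
    show ?case
    proof (cases "c = 0")
      case True
      have "g * D < card W - U" using small by simp
      then have "real (g * D) < real (card W - U)" by (simp only: of_nat_less_iff)
      moreover have "0 < real (card W - U)" using small by simp
      ultimately have "real (g * D) / real (card W - U) < 1" by (simp only: divide_less_eq_1_pos)
      then have "0 < 1 - real (g * D) / real (card W - U)" by (simp only: diff_gt_0_iff_gt)
      then have "0 < (1 - real (g * D) / real (card W - U)) * card (worlds ?\<kappa>)"
        using pos by (intro mult_pos_pos) simp_all
      also have "\<dots> \<le> card (worlds \<kappa>)"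
        using card_worlds_light[OF \<open>admissible ?\<kappa>\<close> x] upd True by simp
      finally show ?thesis by simp
    next
      case False
      have "0 < (real (D - U) / card W) * card (worlds ?\<kappa>)"
        using pos U small by simp
      also have "\<dots> \<le> card (worlds \<kappa>)"
        using card_worlds_heavy[of ?\<kappa> x c U] x \<open>admissible ?\<kappa>\<close> U cg False upd by (simp add: admissible_def)
      finally show ?thesis by simp
    qed
  qed
qed

end

lemma dom_retrieve: "dom (retrieve h \<beta>) = dom \<beta>"
  by (auto simp: retrieve_def)

lemma retrieve_update: "retrieve h (\<beta>(x \<mapsto> i)) = (retrieve h \<beta>)(x \<mapsto> h i)"
  by (auto simp: retrieve_def)

lemma retrieve_touch: "h 0 = 0 \<Longrightarrow> retrieve h (touch x \<beta>) = touch x (retrieve h \<beta>)"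
  by (auto simp: retrieve_def touch_def)

context hidden_cliques
begin

section \<open>Degrees and edges of the hidden graph\<close>

lemma mem_graph:
  "{x, y} \<in> graph_of \<omega> \<longleftrightarrow> (x = z \<and> y \<in> W) \<or> (y = z \<and> x \<in> W)
     \<or> (x \<in> W \<and> y \<in> W \<and> x \<noteq> y \<and> \<omega> x = \<omega> y \<and> \<omega> x \<noteq> 0)"
  by (auto simp: graph_of_def doubleton_eq_iff)

lemma query_graph: "query_graph V (graph_of \<omega>)"
proof
  show "simple_graph V (graph_of \<omega>)"
    using finite_V z_notin_W z by (auto simp: simple_graph_def graph_of_def mem_V_iff card_2_iff)
  show "no_isolated_vertices V (graph_of \<omega>)"
    unfolding no_isolated_vertices_def
  proof
    fix v assume "v \<in> V"
    then show "\<exists>e\<in>graph_of \<omega>. v \<in> e"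
      using W_ne by (cases "v = z") (auto simp: graph_of_def mem_V_iff)
  qed
qed

lemma neighbors_outside: "x \<notin> V \<Longrightarrow> neighbors (graph_of \<omega>) x = {}"
  by (auto simp: neighbors_def mem_graph mem_V_iff)

lemma neighbors_z: "neighbors (graph_of \<omega>) z = W"
  using z_notin_W by (auto simp: neighbors_def mem_graph)

lemma neighbors_light: "x \<in> W \<Longrightarrow> \<omega> x = 0 \<Longrightarrow> neighbors (graph_of \<omega>) x = {z}"
  using z_notin_W by (auto simp: neighbors_def mem_graph)

lemma neighbors_heavy:
  "x \<in> W \<Longrightarrow> \<omega> x \<noteq> 0 \<Longrightarrow> neighbors (graph_of \<omega>) x = insert z ({y \<in> W. \<omega> y = \<omega> x} - {x})"
  using z_notin_W by (auto simp: neighbors_def mem_graph)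

lemma degree_outside: "x \<notin> V \<Longrightarrow> degree (graph_of \<omega>) x = 0"
  by (simp add: degree_def neighbors_outside)

lemma degree_z: "degree (graph_of \<omega>) z = card W"
  by (simp add: degree_def neighbors_z)

lemma degree_light: "x \<in> W \<Longrightarrow> \<omega> x = 0 \<Longrightarrow> degree (graph_of \<omega>) x = 1"
  by (simp add: degree_def neighbors_light)

text \<open>The clique provides \<open>D - 1\<close> partners, and \<open>z\<close> makes up for the
  vertex itself.\<close>

lemma degree_heavy:
  assumes "\<omega> \<in> labellings" "x \<in> W" "\<omega> x \<noteq> 0"
  shows "degree (graph_of \<omega>) x = D"
proof -
  have "card {y \<in> W. \<omega> y = \<omega> x} = D"
    using card_class[OF assms(1) labelling_le[OF assms(1,2)]] assms(3) by (simp add: class_size_def)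
  then show ?thesis
    using assms finite_W z_notin_W U by (simp add: degree_def neighbors_heavy card_Diff_singleton)
qed

lemma card_graph:
  assumes "\<omega> \<in> labellings"
  shows "2 * card (graph_of \<omega>) = 2 * card W + g * D * (D - 1)"
proof -
  interpret gr: query_graph V "graph_of \<omega>" by (rule query_graph)
  have light: "card {x \<in> W. \<omega> x = 0} = card W - g * D"
    using card_class[OF assms, of 0] by (simp add: class_size_def)
  have "{x \<in> W. \<omega> x \<noteq> 0} = W - {x \<in> W. \<omega> x = 0}" by auto
  then have heavy: "card {x \<in> W. \<omega> x \<noteq> 0} = g * D"
    using light finite_W small by (simp add: card_Diff_subset)
  have "real (2 * card (graph_of \<omega>)) = (\<Sum>e\<in>graph_of \<omega>. \<Sum>x\<in>e. 1)"
    using gr.edge(2) by simp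
  also have "\<dots> = (\<Sum>x\<in>V. real (degree (graph_of \<omega>) x) * 1)"
    by (rule gr.sum_degree)
  also have "\<dots> = real (card W) + (\<Sum>x\<in>W. real (degree (graph_of \<omega>) x))"
    using sum.remove[OF finite_V z, of "\<lambda>x. real (degree (graph_of \<omega>) x)"] by (simp add: W_def degree_z)
  also have "(\<Sum>x\<in>W. real (degree (graph_of \<omega>) x)) = (\<Sum>x\<in>W. 1 + (if \<omega> x \<noteq> 0 then real (D - 1) else 0))"
    using U by (intro sum.cong refl) (auto simp: degree_light degree_heavy[OF assms] of_nat_diff)
  also have "\<dots> = real (card W) + real (g * D) * real (D - 1)"
    using finite_W heavy by (simp add: sum.distrib sum.If_cases Int_def)
  finally have "real (2 * card (graph_of \<omega>)) = real (2 * card W + g * D * (D - 1))"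
    by simp
  then show ?thesis by (simp only: of_nat_eq_iff)
qed

section \<open>Failure averaged over the worlds\<close>

definition world_failure :: "real set \<Rightarrow> 'v algorithm \<Rightarrow> nat \<Rightarrow> ('v \<rightharpoonup> nat) \<Rightarrow> real" where
  "world_failure S A j \<kappa> = mean (worlds \<kappa>) (\<lambda>\<omega>. failure V (graph_of \<omega>) S A j)"

lemma world_failure_bounds: "0 \<le> world_failure S A j \<kappa>" "world_failure S A j \<kappa> \<le> 1"
  unfolding world_failure_def using failure_bounds by (auto intro!: mean_nonneg mean_le)

lemma sum_failure: "(\<Sum>\<omega>\<in>worlds \<kappa>. failure V (graph_of \<omega>) S A j) = card (worlds \<kappa>) * world_failure S A j \<kappa>"
  using finite_worlds by (cases "worlds \<kappa> = {}") (simp_all add: world_failure_def mean_def)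

lemma world_failure_cong:
  "(\<And>\<omega>. \<omega> \<in> worlds \<kappa> \<Longrightarrow> failure V (graph_of \<omega>) S A j = failure V (graph_of \<omega>) S A' j') \<Longrightarrow>
    world_failure S A j \<kappa> = world_failure S A' j' \<kappa>"
  unfolding world_failure_def by (intro mean_cong) auto

definition light_loss :: real where
  "light_loss = real (g * D) / real (card W - U)"

lemma light_loss_nonneg: "0 \<le> light_loss"
  by (simp add: light_loss_def)

text \<open>The worlds in which an unseen \<open>x\<close> is light make up all but a share
  \<open>light_loss\<close>, and the others may be dropped because failure is nonnegative. This pays
  for declaring a vertex light when it is queried.\<close>

lemma world_failure_touch:
  assumes "admissible \<kappa>" "x \<in> W"
  shows "world_failure S A j (touch x \<kappa>) - light_loss \<le> world_failure S A j \<kappa>"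
proof (cases "x \<in> dom \<kappa>")
  case True
  then show ?thesis using light_loss_nonneg by (simp add: touch_dom)
next
  case False
  let ?\<kappa> = "\<kappa>(x \<mapsto> 0)" and ?N = "real (card (worlds \<kappa>))"
  have N: "0 < ?N" using card_worlds_pos[OF assms(1)] by simp
  have "?N * (world_failure S A j ?\<kappa> - light_loss) \<le> ?N * (world_failure S A j ?\<kappa> - light_loss * world_failure S A j ?\<kappa>)"
    using world_failure_bounds[of S A j ?\<kappa>] light_loss_nonneg by (intro mult_left_mono diff_left_mono) (auto simp: mult_left_le)
  also have "\<dots> = ((1 - light_loss) * ?N) * world_failure S A j ?\<kappa>" by (simp add: algebra_simps)
  also have "\<dots> \<le> card (worlds ?\<kappa>) * world_failure S A j ?\<kappa>"
    using card_worlds_light[OF assms(1), of x] False assms(2) world_failure_bounds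
    unfolding light_loss_def by (intro mult_right_mono) auto
  also have "\<dots> = (\<Sum>\<omega>\<in>worlds ?\<kappa>. failure V (graph_of \<omega>) S A j)"
    by (rule sum_failure[symmetric])
  also have "\<dots> \<le> (\<Sum>\<omega>\<in>worlds \<kappa>. failure V (graph_of \<omega>) S A j)"
    using False finite_worlds by (intro sum_mono2) (auto simp: worlds_update)
  also have "\<dots> = ?N * world_failure S A j \<kappa>"
    by (rule sum_failure)
  finally have "world_failure S A j ?\<kappa> - light_loss \<le> world_failure S A j \<kappa>"
    using N by (simp only: mult_le_cancel_left_pos)
  then show ?thesis using False by (simp add: touch_def domIff)
qed

lemma world_failure_RandVert: "world_failure S (RandVert k) (Suc j) \<kappa> = mean V (\<lambda>x. world_failure S (k x) j \<kappa>)"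
proof -
  have "world_failure S (RandVert k) (Suc j) \<kappa> = mean (worlds \<kappa>) (\<lambda>\<omega>. mean V (\<lambda>x. failure V (graph_of \<omega>) S (k x) j))"
    unfolding world_failure_def using finite_V z by (intro mean_cong refl failure_RandVert) auto
  also have "\<dots> = mean V (\<lambda>x. world_failure S (k x) j \<kappa>)"
    unfolding world_failure_def by (rule mean_swap)
  finally show ?thesis .
qed

lemma world_failure_RandNbr_z: "world_failure S (RandNbr z k) (Suc j) \<kappa> = mean W (\<lambda>y. world_failure S (k (Some y)) j \<kappa>)"
proof -
  have "world_failure S (RandNbr z k) (Suc j) \<kappa> = mean (worlds \<kappa>) (\<lambda>\<omega>. mean W (\<lambda>y. failure V (graph_of \<omega>) S (k (Some y)) j))"
    unfolding world_failure_def using finite_W W_ne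
    by (intro mean_cong refl) (simp add: failure_RandNbr neighbors_z)
  also have "\<dots> = mean W (\<lambda>y. world_failure S (k (Some y)) j \<kappa>)"
    unfolding world_failure_def by (rule mean_swap)
  finally show ?thesis .
qed

lemma world_failure_Toss: "world_failure S (Toss p k) j \<kappa> = measure_pmf.expectation p (\<lambda>i. world_failure S (k i) j \<kappa>)"
  unfolding world_failure_def mean_def failure_Toss
  by (simp, subst Bochner_Integration.integral_sum)
     (auto intro!: integrable_bounded_pmf[where B = 1] simp: failure_def)

text \<open>A fresh \<open>y\<close> lies in the clique of \<open>x\<close> in a share of at least
  \<open>(D - U) / card W\<close> of the worlds and is then returned with probability
  \<open>1 / D\<close>. The neighbor \<open>z\<close> and the clique members already seen are
  dropped from the sum.\<close>

lemma world_failure_RandNbr_heavy: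
  assumes ad: "admissible \<kappa>" and c: "\<kappa> x = Some c" "c \<in> {1..g}"
  shows "(real (D - U) / D) * (\<Sum>y\<in>W - dom \<kappa>. world_failure S (k (Some y)) j (\<kappa>(y \<mapsto> c))) / card W
      \<le> world_failure S (RandNbr x k) (Suc j) \<kappa>"
proof -
  let ?N = "real (card (worlds \<kappa>))" and ?fresh = "W - dom \<kappa>"
  let ?\<phi> = "\<lambda>\<omega> y. failure V (graph_of \<omega>) S (k (Some y)) j"
  have dom: "dom \<kappa> \<subseteq> W" "card (dom \<kappa>) \<le> U" using ad by (auto simp: admissible_def)
  have N: "0 < ?N" using card_worlds_pos[OF ad] by simp
  have D0: "0 < real D" using U by simp
  have "(\<Sum>y\<in>?fresh. (real (D - U) / card W) * ?N * world_failure S (k (Some y)) j (\<kappa>(y \<mapsto> c)))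
     \<le> (\<Sum>y\<in>?fresh. card (worlds (\<kappa>(y \<mapsto> c))) * world_failure S (k (Some y)) j (\<kappa>(y \<mapsto> c)))"
    using card_worlds_heavy[OF dom(1) _ c(2) dom(2)] U world_failure_bounds by (intro sum_mono mult_right_mono) auto
  also have "\<dots> = (\<Sum>y\<in>?fresh. \<Sum>\<omega> | \<omega> \<in> worlds \<kappa> \<and> \<omega> y = c. ?\<phi> \<omega> y)"
    by (intro sum.cong refl, subst sum_failure[symmetric]) (simp add: worlds_update)
  also have "\<dots> = (\<Sum>\<omega>\<in>worlds \<kappa>. \<Sum>y | y \<in> ?fresh \<and> \<omega> y = c. ?\<phi> \<omega> y)"
    using finite_W finite_worlds by (intro sum.swap_restrict) auto
  also have "\<dots> \<le> (\<Sum>\<omega>\<in>worlds \<kappa>. D * failure V (graph_of \<omega>) S (RandNbr x k) (Suc j))"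
  proof (rule sum_mono)
    fix \<omega> assume \<omega>: "\<omega> \<in> worlds \<kappa>"
    have x: "x \<in> W" "\<omega> x = c" using dom c \<omega> by (auto simp: worlds_def)
    have nb: "neighbors (graph_of \<omega>) x = insert z ({y \<in> W. \<omega> y = c} - {x})"
      using neighbors_heavy[of x \<omega>] x c by auto
    have "card (neighbors (graph_of \<omega>) x) = D"
      using degree_heavy[OF worlds_labellings[OF \<omega>] x(1)] x c by (simp add: degree_def)
    then have "D * failure V (graph_of \<omega>) S (RandNbr x k) (Suc j) = (\<Sum>y\<in>neighbors (graph_of \<omega>) x. ?\<phi> \<omega> y)"
      using D0 nb finite_W by (subst failure_RandNbr) (auto simp: mean_def)
    moreover have "(\<Sum>y | y \<in> ?fresh \<and> \<omega> y = c. ?\<phi> \<omega> y) \<le> (\<Sum>y\<in>neighbors (graph_of \<omega>) x. ?\<phi> \<omega> y)"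
      using nb finite_W c by (intro sum_mono2) auto
    ultimately show "(\<Sum>y | y \<in> ?fresh \<and> \<omega> y = c. ?\<phi> \<omega> y) \<le> D * failure V (graph_of \<omega>) S (RandNbr x k) (Suc j)"
      by simp
  qed
  also have "\<dots> = D * (?N * world_failure S (RandNbr x k) (Suc j) \<kappa>)"
    by (simp add: sum_failure flip: sum_distrib_left)
  finally have *: "(\<Sum>y\<in>?fresh. (real (D - U) / card W) * ?N * world_failure S (k (Some y)) j (\<kappa>(y \<mapsto> c)))
      \<le> D * (?N * world_failure S (RandNbr x k) (Suc j) \<kappa>)" .
  have "?N * (D * ((real (D - U) / D) * (\<Sum>y\<in>?fresh. world_failure S (k (Some y)) j (\<kappa>(y \<mapsto> c))) / card W))
      = (real (D - U) / card W) * ?N * (\<Sum>y\<in>?fresh. world_failure S (k (Some y)) j (\<kappa>(y \<mapsto> c)))"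
    using D0 by simp
  also have "\<dots> = (\<Sum>y\<in>?fresh. (real (D - U) / card W) * ?N * world_failure S (k (Some y)) j (\<kappa>(y \<mapsto> c)))"
    by (rule sum_distrib_left)
  also note *
  also have "D * (?N * world_failure S (RandNbr x k) (Suc j) \<kappa>) = ?N * (D * world_failure S (RandNbr x k) (Suc j) \<kappa>)"
    by simp
  finally have "?N * (D * ((real (D - U) / D) * (\<Sum>y\<in>?fresh. world_failure S (k (Some y)) j (\<kappa>(y \<mapsto> c))) / card W))
      \<le> ?N * (D * world_failure S (RandNbr x k) (Suc j) \<kappa>)" .
  then show ?thesis using N D0 by (simp only: mult_le_cancel_left_pos)
qed

text \<open>A lower bound for the probability that a random edge joins two unseen members of a
  clique: each clique has at least \<open>(D - U - 1) ^ 2\<close> such ordered pairs, and the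
  denominator is twice the number of edges.\<close>

definition edge_ratio :: real where
  "edge_ratio = real (g * (D - U - 1)\<^sup>2) / real (2 * card W + g * D * (D - 1))"

text \<open>The subtracted 1 accounts for the first end, which is already known when the second one
  is placed.\<close>

lemma card_worlds_heavy_pair:
  assumes ad: "admissible \<kappa>" and xy: "x \<in> W - dom \<kappa>" "y \<in> W - dom \<kappa>" "x \<noteq> y" and c: "c \<in> {1..g}"
  shows "(real (D - U - 1) / card W)\<^sup>2 * card (worlds \<kappa>) \<le> card (worlds (\<kappa>(x \<mapsto> c, y \<mapsto> c)))"
proof -
  have dom: "dom \<kappa> \<subseteq> W" "card (dom \<kappa>) \<le> U" using ad by (auto simp: admissible_def)
  let ?q = "real (D - U - 1) / card W"
  have fin: "finite (dom \<kappa>)" using dom finite_W by (blast intro: finite_subset)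
  have "?q * card (worlds \<kappa>) \<le> card (worlds (\<kappa>(x \<mapsto> c)))"
    using card_worlds_heavy[OF dom(1) xy(1) c, of "U + 1"] dom U by simp
  then have "?q * (?q * card (worlds \<kappa>)) \<le> ?q * card (worlds (\<kappa>(x \<mapsto> c)))"
    by (intro mult_left_mono) auto
  also have "\<dots> \<le> card (worlds (\<kappa>(x \<mapsto> c, y \<mapsto> c)))"
    using card_worlds_heavy[of "\<kappa>(x \<mapsto> c)" y c "U + 1"] dom xy c U fin by (simp add: card_insert_if)
  finally show ?thesis by (simp add: power2_eq_square mult.assoc)
qed

text \<open>The lower bound is the same for all labels, so the clique of a fresh edge may be taken
  uniform in \<open>{1..g}\<close> whatever is known about earlier edges. This is what lets a
  colouring be extended by an independent colour.\<close>

lemma world_failure_RandEdge: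
  assumes ad: "admissible \<kappa>"
  defines "P \<equiv> {(x, y). x \<in> W - dom \<kappa> \<and> y \<in> W - dom \<kappa> \<and> x \<noteq> y}"
  shows "edge_ratio * (\<Sum>(x, y)\<in>P. mean {1..g} (\<lambda>c. world_failure S (k {x, y}) j (\<kappa>(x \<mapsto> c, y \<mapsto> c)))) / (real (card W))\<^sup>2
      \<le> world_failure S (RandEdge k) (Suc j) \<kappa>"
proof -
  let ?N = "real (card (worlds \<kappa>))" and ?m = "real (2 * card W + g * D * (D - 1))"
  let ?q = "real (D - U - 1) / card W"
  let ?\<phi> = "\<lambda>\<omega> e. failure V (graph_of \<omega>) S (k e) j"
  let ?F = "\<lambda>(x, y) c. world_failure S (k {x, y}) j (\<kappa>(x \<mapsto> c, y \<mapsto> c))"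
  have N: "0 < ?N" using card_worlds_pos[OF ad] by simp
  have "0 < 2 * card W + g * D * (D - 1)" using small by simp
  then have m: "0 < ?m" by (simp only: of_nat_0_less_iff)
  have finP: "finite P"
    unfolding P_def using finite_W by (intro finite_subset[OF _ finite_cartesian_product[of W W]]) auto
  have "(\<Sum>p\<in>P. \<Sum>c\<in>{1..g}. ?q\<^sup>2 * ?N * ?F p c)
     \<le> (\<Sum>p\<in>P. \<Sum>c\<in>{1..g}. case p of (x, y) \<Rightarrow> card (worlds (\<kappa>(x \<mapsto> c, y \<mapsto> c))) * world_failure S (k {x, y}) j (\<kappa>(x \<mapsto> c, y \<mapsto> c)))"
    using card_worlds_heavy_pair[OF ad] world_failure_bounds
    by (intro sum_mono) (auto simp: P_def intro!: mult_right_mono)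
  also have "\<dots> = (\<Sum>p\<in>P. \<Sum>c\<in>{1..g}. \<Sum>\<omega> | \<omega> \<in> worlds \<kappa> \<and> \<omega> (fst p) = c \<and> \<omega> (snd p) = c. ?\<phi> \<omega> {fst p, snd p})"
  proof (intro sum.cong refl)
    fix p c assume "p \<in> P"
    then obtain x y where p: "p = (x, y)" "x \<notin> dom \<kappa>" "y \<notin> dom \<kappa>" "x \<noteq> y"
      by (auto simp: P_def)
    have "y \<notin> dom (\<kappa>(x \<mapsto> c))" using p by auto
    then have "worlds (\<kappa>(x \<mapsto> c, y \<mapsto> c)) = {\<omega> \<in> worlds \<kappa>. \<omega> x = c \<and> \<omega> y = c}"
      using worlds_update[of y "\<kappa>(x \<mapsto> c)" c] worlds_update[OF p(2), of c] by auto
    then show "(case p of (x, y) \<Rightarrow> card (worlds (\<kappa>(x \<mapsto> c, y \<mapsto> c))) * world_failure S (k {x, y}) j (\<kappa>(x \<mapsto> c, y \<mapsto> c)))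
       = (\<Sum>\<omega> | \<omega> \<in> worlds \<kappa> \<and> \<omega> (fst p) = c \<and> \<omega> (snd p) = c. ?\<phi> \<omega> {fst p, snd p})"
      using p by (simp add: sum_failure[symmetric])
  qed
  also have "\<dots> = (\<Sum>p\<in>P. \<Sum>\<omega>\<in>worlds \<kappa>. if \<omega> (fst p) = \<omega> (snd p) \<and> \<omega> (fst p) \<noteq> 0 then ?\<phi> \<omega> {fst p, snd p} else 0)"
  proof (intro sum.cong refl)
    fix p assume p: "p \<in> P"
    have "(\<Sum>c\<in>{1..g}. \<Sum>\<omega> | \<omega> \<in> worlds \<kappa> \<and> \<omega> (fst p) = c \<and> \<omega> (snd p) = c. ?\<phi> \<omega> {fst p, snd p})
        = (\<Sum>\<omega>\<in>worlds \<kappa>. \<Sum>c | c \<in> {1..g} \<and> \<omega> (fst p) = c \<and> \<omega> (snd p) = c. ?\<phi> \<omega> {fst p, snd p})"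
      using finite_worlds by (intro sum.swap_restrict) auto
    also have "\<dots> = (\<Sum>\<omega>\<in>worlds \<kappa>. if \<omega> (fst p) = \<omega> (snd p) \<and> \<omega> (fst p) \<noteq> 0 then ?\<phi> \<omega> {fst p, snd p} else 0)"
    proof (intro sum.cong refl)
      fix \<omega> assume \<omega>: "\<omega> \<in> worlds \<kappa>"
      \<comment> \<open>Hence exactly one \<open>c\<close> matches if both ends share a clique, and
        none otherwise.\<close>
      have "\<omega> (fst p) \<le> g"
        using labelling_le[OF worlds_labellings[OF \<omega>]] p by (auto simp: P_def)
      then have "{c. c \<in> {1..g} \<and> \<omega> (fst p) = c \<and> \<omega> (snd p) = c}
          = (if \<omega> (fst p) = \<omega> (snd p) \<and> \<omega> (fst p) \<noteq> 0 then {\<omega> (fst p)} else {})"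
        by auto
      then show "(\<Sum>c | c \<in> {1..g} \<and> \<omega> (fst p) = c \<and> \<omega> (snd p) = c. ?\<phi> \<omega> {fst p, snd p})
         = (if \<omega> (fst p) = \<omega> (snd p) \<and> \<omega> (fst p) \<noteq> 0 then ?\<phi> \<omega> {fst p, snd p} else 0)"
        by simp
    qed
    finally show "(\<Sum>c\<in>{1..g}. \<Sum>\<omega> | \<omega> \<in> worlds \<kappa> \<and> \<omega> (fst p) = c \<and> \<omega> (snd p) = c. ?\<phi> \<omega> {fst p, snd p}) = \<dots>" .
  qed
  also have "\<dots> = (\<Sum>\<omega>\<in>worlds \<kappa>. \<Sum>p\<in>P. if \<omega> (fst p) = \<omega> (snd p) \<and> \<omega> (fst p) \<noteq> 0 then ?\<phi> \<omega> {fst p, snd p} else 0)"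
    by (rule sum.swap)
  also have "\<dots> \<le> (\<Sum>\<omega>\<in>worlds \<kappa>. ?m * failure V (graph_of \<omega>) S (RandEdge k) (Suc j))"
  proof (rule sum_mono)
    fix \<omega> assume \<omega>: "\<omega> \<in> worlds \<kappa>"
    interpret gr: query_graph V "graph_of \<omega>" by (rule query_graph)
    \<comment> \<open>\<open>P\<close> consists of ordered pairs; among the ordered adjacent pairs
      every edge occurs twice.\<close>
    have "(\<Sum>p\<in>P. if \<omega> (fst p) = \<omega> (snd p) \<and> \<omega> (fst p) \<noteq> 0 then ?\<phi> \<omega> {fst p, snd p} else 0)
        \<le> (\<Sum>p\<in>(SIGMA x:V. neighbors (graph_of \<omega>) x). ?\<phi> \<omega> {fst p, snd p})"
      using finP finite_V gr.finite_neighbors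
      by (subst sum.inter_filter[symmetric]) (auto simp: P_def neighbors_def mem_graph W_def intro!: sum_mono2)
    also have "\<dots> = (\<Sum>x\<in>V. \<Sum>y\<in>neighbors (graph_of \<omega>) x. ?\<phi> \<omega> {x, y})"
      using finite_V gr.finite_neighbors by (subst sum.Sigma) (auto simp: case_prod_beta)
    also have "\<dots> = (\<Sum>e\<in>graph_of \<omega>. \<Sum>x\<in>e. ?\<phi> \<omega> e)"
      by (rule gr.sum_endpoints[symmetric])
    also have "\<dots> = 2 * (\<Sum>e\<in>graph_of \<omega>. ?\<phi> \<omega> e)"
      using gr.edge(2) by (simp add: sum_distrib_left)
    also have "\<dots> = 2 * card (graph_of \<omega>) * failure V (graph_of \<omega>) S (RandEdge k) (Suc j)"
      using gr.finite_E gr.E_nonempty gr.card_E_pos by (simp add: failure_RandEdge mean_def)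
    also have "real (2 * card (graph_of \<omega>)) = ?m"
      by (simp only: card_graph[OF worlds_labellings[OF \<omega>]])
    finally show "(\<Sum>p\<in>P. if \<omega> (fst p) = \<omega> (snd p) \<and> \<omega> (fst p) \<noteq> 0 then ?\<phi> \<omega> {fst p, snd p} else 0)
      \<le> ?m * failure V (graph_of \<omega>) S (RandEdge k) (Suc j)" .
  qed
  also have "\<dots> = ?m * (?N * world_failure S (RandEdge k) (Suc j) \<kappa>)"
    by (simp only: sum_failure sum_distrib_left[symmetric])
  finally have *: "(\<Sum>p\<in>P. \<Sum>c\<in>{1..g}. ?q\<^sup>2 * ?N * ?F p c) \<le> ?m * (?N * world_failure S (RandEdge k) (Suc j) \<kappa>)" .
  have "(\<Sum>p\<in>P. \<Sum>c\<in>{1..g}. ?q\<^sup>2 * ?N * ?F p c) = ?q\<^sup>2 * ?N * (\<Sum>p\<in>P. \<Sum>c\<in>{1..g}. ?F p c)"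
    by (simp only: sum_distrib_left)
  also have "(\<Sum>p\<in>P. \<Sum>c\<in>{1..g}. ?F p c) = g * (\<Sum>p\<in>P. mean {1..g} (?F p))"
  proof -
    have "g * mean {1..g} f = (\<Sum>c\<in>{1..g}. f c)" for f
      using g by (simp add: mean_def)
    then show ?thesis by (simp only: sum_distrib_left)
  qed
  also have "?q\<^sup>2 * ?N * (g * (\<Sum>p\<in>P. mean {1..g} (?F p)))
      = ?m * (?N * (edge_ratio * (\<Sum>p\<in>P. mean {1..g} (?F p)) / (real (card W))\<^sup>2))"
  proof -
    have "q\<^sup>2 / w\<^sup>2 * N * (g' * s) = m * (N * (g' * q\<^sup>2 / m * s / w\<^sup>2))" if "m \<noteq> 0" for q w N g' s m :: real
      using that by simp
    from this[of ?m] show ?thesis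
      using m by (simp only: edge_ratio_def power_divide of_nat_mult[of g "(D - U - 1)\<^sup>2"] of_nat_power)
  qed
  finally have "?m * (?N * (edge_ratio * (\<Sum>p\<in>P. mean {1..g} (?F p)) / (real (card W))\<^sup>2)) \<le> ?m * (?N * world_failure S (RandEdge k) (Suc j) \<kappa>)"
    using * by (simp only:)
  then have "edge_ratio * (\<Sum>p\<in>P. mean {1..g} (?F p)) / (real (card W))\<^sup>2 \<le> world_failure S (RandEdge k) (Suc j) \<kappa>"
    using N m by (simp only: mult_le_cancel_left_pos)
  then show ?thesis by (simp add: case_prod_beta)
qed

end

section \<open>Comparison of the hidden graph with the simulation\<close>

context hidden_cliques
begin

text \<open>
  The cliques into which the random edges fall. The simulator never reveals them, so they stay
  uniform and independent, and a pair query between two of them is answered positively with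
  probability \<open>1 / g\<close> only. This independence fails for the conditional distribution of the hidden
  graph itself, which is why the average is taken over colourings first.
\<close>

definition colourings :: "nat \<Rightarrow> (nat \<Rightarrow> nat) set" where
  "colourings r = (\<Pi>\<^sub>E i\<in>{0..r}. if i = 0 then {0} else {1..g})"

lemma finite_colourings: "finite (colourings r)"
  unfolding colourings_def by (intro finite_PiE) auto

lemma colourings_nonempty: "colourings r \<noteq> {}"
  unfolding colourings_def using g by (auto simp: PiE_eq_empty_iff)

lemma colourings_0: "h \<in> colourings r \<Longrightarrow> h 0 = 0"
  unfolding colourings_def by (auto dest: PiE_mem[where x = 0])

lemma colourings_pos: "h \<in> colourings r \<Longrightarrow> i \<in> {1..r} \<Longrightarrow> h i \<in> {1..g}"
  unfolding colourings_def by (auto dest: PiE_mem[where x = i])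

lemma colourings_le: "h \<in> colourings r \<Longrightarrow> i \<le> r \<Longrightarrow> h i \<le> g"
  using colourings_0[of h r] colourings_pos[of h r i] by (cases "i = 0") auto

lemma mean_colourings_Suc:
  "mean (colourings (Suc r)) f = mean (colourings r) (\<lambda>h. mean {1..g} (\<lambda>c. f (h(Suc r := c))))"
proof -
  let ?T = "\<lambda>i::nat. if i = 0 then {0} else {1..g}"
  have ins: "{0..Suc r} = insert (Suc r) {0..r}" by auto
  have eq: "colourings (Suc r) = (\<lambda>(c, h). h(Suc r := c)) ` ({1..g} \<times> colourings r)"
    unfolding colourings_def ins by (simp add: PiE_insert_eq)
  have inj: "inj_on (\<lambda>(c, h). h(Suc r := c)) ({1..g} \<times> colourings r)"
    using inj_combinator[of "Suc r" "{0..r}" ?T] by (simp add: colourings_def)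
  have "card (colourings (Suc r)) = g * card (colourings r)"
    unfolding eq card_image[OF inj] by (simp add: card_cartesian_product)
  moreover have "(\<Sum>h\<in>colourings (Suc r). f h) = (\<Sum>h\<in>colourings r. \<Sum>c\<in>{1..g}. f (h(Suc r := c)))"
    unfolding eq sum.reindex[OF inj] by (subst sum.swap) (simp add: sum.cartesian_product case_prod_beta comp_def)
  ultimately show ?thesis
    by (simp add: mean_def sum_divide_distrib mult.commute)
qed

text \<open>A colliding colouring can be recoloured at \<open>a\<close> in \<open>g\<close> ways,
  and its old colour is still legible at \<open>b\<close>, so this recolouring is injective.\<close>

lemma mean_colourings_collision:
  assumes "a \<in> {1..r}" "b \<in> {1..r}" "a \<noteq> b"
  shows "mean (colourings r) (\<lambda>h. of_bool (h a = h b)) \<le> 1 / g"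
proof -
  let ?B = "{h \<in> colourings r. h a = h b}"
  have "inj_on (\<lambda>(h, c). h(a := c)) (?B \<times> {1..g})"
  proof (rule inj_onI, clarsimp)
    fix h h' :: "nat \<Rightarrow> nat" and c c'
    assume eq: "h(a := c) = h'(a := c')" and h: "h a = h b" "h' a = h' b"
    from eq have "h i = h' i" if "i \<noteq> a" for i using that by (metis fun_upd_apply)
    then have "h = h'" using h assms(3) by (metis ext)
    then show "h = h' \<and> c = c'" using eq by (metis fun_upd_same)
  qed
  moreover have "(\<lambda>(h, c). h(a := c)) ` (?B \<times> {1..g}) \<subseteq> colourings r"
    using assms(1) by (auto simp: colourings_def PiE_def Pi_def extensional_def)
  ultimately have "card (?B \<times> {1..g}) \<le> card (colourings r)"
    using finite_colourings by (rule card_inj_on_le)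
  then have "real (card ?B) * g \<le> card (colourings r)"
    by (simp add: card_cartesian_product flip: of_nat_mult)
  moreover have "0 < card (colourings r)"
    using finite_colourings colourings_nonempty by (simp add: card_gt_0_iff)
  ultimately have "card ?B / card (colourings r) \<le> 1 / g"
    using g by (simp add: field_simps)
  moreover have "mean (colourings r) (\<lambda>h. of_bool (h a = h b)) = card ?B / card (colourings r)"
    using finite_colourings by (simp add: mean_def of_bool_def sum.If_cases Int_def)
  ultimately show ?thesis by simp
qed

section \<open>Failure averaged over colourings and worlds\<close>

definition mean_failure :: "real set \<Rightarrow> 'v algorithm \<Rightarrow> nat \<Rightarrow> ('v \<rightharpoonup> nat) \<Rightarrow> nat \<Rightarrow> real" where
  "mean_failure S A j \<beta> r = mean (colourings r) (\<lambda>h. world_failure S A j (retrieve h \<beta>))"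

definition valid :: "('v \<rightharpoonup> nat) \<Rightarrow> nat \<Rightarrow> bool" where
  "valid \<beta> r \<longleftrightarrow> dom \<beta> \<subseteq> W \<and> card (dom \<beta>) \<le> U \<and> ran \<beta> \<subseteq> {0..r}"

lemma admissible_retrieve:
  assumes "valid \<beta> r" "h \<in> colourings r"
  shows "admissible (retrieve h \<beta>)"
  using assms colourings_le[OF assms(2)]
  by (auto simp: valid_def admissible_def dom_retrieve retrieve_def ran_def)

lemma mean_failure_bounds: "0 \<le> mean_failure S A j \<beta> r" "mean_failure S A j \<beta> r \<le> 1"
  unfolding mean_failure_def using world_failure_bounds by (auto intro!: mean_nonneg mean_le)

lemma mean_failure_cong:
  assumes "\<And>h \<omega>. h \<in> colourings r \<Longrightarrow> \<omega> \<in> worlds (retrieve h \<beta>) \<Longrightarrow>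
    failure V (graph_of \<omega>) S A j = failure V (graph_of \<omega>) S A' j'"
  shows "mean_failure S A j \<beta> r = mean_failure S A' j' \<beta> r"
  unfolding mean_failure_def using assms by (intro mean_cong world_failure_cong) auto

lemma mean_failure_touch:
  assumes "valid \<beta> r" "x \<in> W"
  shows "mean_failure S A j (touch x \<beta>) r - light_loss \<le> mean_failure S A j \<beta> r"
proof -
  have "mean_failure S A j (touch x \<beta>) r - light_loss = mean (colourings r) (\<lambda>h. world_failure S A j (retrieve h (touch x \<beta>)) - light_loss)"
    unfolding mean_failure_def using finite_colourings colourings_nonempty by (simp add: mean_diff_const)
  also have "\<dots> \<le> mean_failure S A j \<beta> r"
    unfolding mean_failure_def using world_failure_touch[OF admissible_retrieve[OF assms(1)] assms(2)]
    by (intro mean_mono) (simp add: retrieve_touch colourings_0)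
  finally show ?thesis .
qed

lemma mean_failure_RandVert: "mean_failure S (RandVert k) (Suc j) \<beta> r = mean V (\<lambda>x. mean_failure S (k x) j \<beta> r)"
  unfolding mean_failure_def world_failure_RandVert by (rule mean_swap)

lemma mean_failure_RandNbr_z: "mean_failure S (RandNbr z k) (Suc j) \<beta> r = mean W (\<lambda>y. mean_failure S (k (Some y)) j \<beta> r)"
  unfolding mean_failure_def world_failure_RandNbr_z by (rule mean_swap)

lemma mean_failure_Toss: "mean_failure S (Toss p k) j \<beta> r = measure_pmf.expectation p (\<lambda>i. mean_failure S (k i) j \<beta> r)"
  unfolding mean_failure_def mean_def world_failure_Toss
  by (simp, subst Bochner_Integration.integral_sum)
     (auto intro!: integrable_bounded_pmf[where B = 1] simp: world_failure_bounds)

lemma mean_failure_RandNbr_heavy: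
  assumes v: "valid \<beta> r" and x: "\<beta> x = Some i" "i \<noteq> 0"
  shows "(real (D - U) / D) * (\<Sum>y\<in>W - dom \<beta>. mean_failure S (k (Some y)) j (\<beta>(y \<mapsto> i)) r) / card W
      \<le> mean_failure S (RandNbr x k) (Suc j) \<beta> r"
proof -
  have i: "i \<in> {1..r}" using v x by (auto simp: valid_def ran_def)
  have "(real (D - U) / D) * (\<Sum>y\<in>W - dom \<beta>. mean_failure S (k (Some y)) j (\<beta>(y \<mapsto> i)) r) / card W
      = (real (D - U) / D / card W) * mean (colourings r) (\<lambda>h. \<Sum>y\<in>W - dom \<beta>. world_failure S (k (Some y)) j (retrieve h (\<beta>(y \<mapsto> i))))"
    by (simp add: mean_failure_def mean_sum)
  also have "\<dots> = mean (colourings r) (\<lambda>h. (real (D - U) / D / card W) * (\<Sum>y\<in>W - dom \<beta>. world_failure S (k (Some y)) j (retrieve h (\<beta>(y \<mapsto> i)))))"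
    by (rule mean_mult_left[symmetric])
  also have "\<dots> \<le> mean_failure S (RandNbr x k) (Suc j) \<beta> r"
    unfolding mean_failure_def
  proof (rule mean_mono)
    fix h assume h: "h \<in> colourings r"
    have "retrieve h \<beta> x = Some (h i)" using x by (simp add: retrieve_def)
    from world_failure_RandNbr_heavy[OF admissible_retrieve[OF v h] this colourings_pos[OF h i], of S k j]
    show "(real (D - U) / D / card W) * (\<Sum>y\<in>W - dom \<beta>. world_failure S (k (Some y)) j (retrieve h (\<beta>(y \<mapsto> i))))
        \<le> world_failure S (RandNbr x k) (Suc j) (retrieve h \<beta>)"
      by (simp add: dom_retrieve retrieve_update)
  qed
  finally show ?thesis .
qed

lemma mean_failure_RandEdge:
  assumes v: "valid \<beta> r"
  defines "P \<equiv> {(x, y). x \<in> W - dom \<beta> \<and> y \<in> W - dom \<beta> \<and> x \<noteq> y}"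
  shows "edge_ratio * (\<Sum>(x, y)\<in>P. mean_failure S (k {x, y}) j (\<beta>(x \<mapsto> Suc r, y \<mapsto> Suc r)) (Suc r)) / card (W \<times> W)
      \<le> mean_failure S (RandEdge k) (Suc j) \<beta> r"
proof -
  let ?F = "\<lambda>h p c. world_failure S (k {fst p, snd p}) j ((retrieve h \<beta>)(fst p \<mapsto> c, snd p \<mapsto> c))"
  let ?w = "(real (card W))\<^sup>2"
  \<comment> \<open>The number \<open>Suc r\<close> does not occur in \<open>\<beta>\<close>, so
    extending the colouring leaves earlier knowledge unchanged.\<close>
  have upd: "retrieve (h(Suc r := c)) (\<beta>(x \<mapsto> Suc r, y \<mapsto> Suc r)) = (retrieve h \<beta>)(x \<mapsto> c, y \<mapsto> c)" for h c x y
  proof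
    fix w
    have "\<beta> w \<noteq> Some (Suc r)" using v by (auto simp: valid_def ran_def)
    then show "retrieve (h(Suc r := c)) (\<beta>(x \<mapsto> Suc r, y \<mapsto> Suc r)) w = ((retrieve h \<beta>)(x \<mapsto> c, y \<mapsto> c)) w"
      by (cases "\<beta> w") (auto simp: retrieve_def)
  qed
  have "(\<Sum>(x, y)\<in>P. mean_failure S (k {x, y}) j (\<beta>(x \<mapsto> Suc r, y \<mapsto> Suc r)) (Suc r))
      = (\<Sum>p\<in>P. mean (colourings r) (\<lambda>h. mean {1..g} (?F h p)))"
    by (simp add: mean_failure_def mean_colourings_Suc upd case_prod_beta)
  also have "\<dots> = mean (colourings r) (\<lambda>h. \<Sum>p\<in>P. mean {1..g} (?F h p))"
    by (rule mean_sum[symmetric])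
  finally have "edge_ratio * (\<Sum>(x, y)\<in>P. mean_failure S (k {x, y}) j (\<beta>(x \<mapsto> Suc r, y \<mapsto> Suc r)) (Suc r)) / card (W \<times> W)
      = (edge_ratio / ?w) * mean (colourings r) (\<lambda>h. \<Sum>p\<in>P. mean {1..g} (?F h p))"
    by (simp add: card_cartesian_product power2_eq_square)
  also have "\<dots> = mean (colourings r) (\<lambda>h. (edge_ratio / ?w) * (\<Sum>p\<in>P. mean {1..g} (?F h p)))"
    by (rule mean_mult_left[symmetric])
  also have "\<dots> \<le> mean_failure S (RandEdge k) (Suc j) \<beta> r"
    unfolding mean_failure_def
  proof (rule mean_mono)
    fix h assume h: "h \<in> colourings r"
    from world_failure_RandEdge[OF admissible_retrieve[OF v h], of S k j]
    show "(edge_ratio / ?w) * (\<Sum>p\<in>P. mean {1..g} (?F h p)) \<le> world_failure S (RandEdge k) (Suc j) (retrieve h \<beta>)"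
      by (simp add: dom_retrieve P_def case_prod_beta)
  qed
  finally show ?thesis .
qed

lemma edge_ratio_bounds: "0 \<le> edge_ratio" "edge_ratio \<le> 1"
proof -
  show "0 \<le> edge_ratio" by (simp add: edge_ratio_def)
  have "(D - U - 1)\<^sup>2 \<le> D * (D - 1)"
    unfolding power2_eq_square by (intro mult_le_mono) auto
  then have "g * (D - U - 1)\<^sup>2 \<le> g * (D * (D - 1))"
    by (rule mult_le_mono2)
  then have "g * (D - U - 1)\<^sup>2 \<le> 2 * card W + g * D * (D - 1)"
    by (simp only: mult.assoc trans_le_add2)
  moreover have "0 < 2 * card W + g * D * (D - 1)" using small by simp
  ultimately have "real (g * (D - U - 1)\<^sup>2) \<le> real (2 * card W + g * D * (D - 1))"
    by (simp only: of_nat_le_iff)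
  then show "edge_ratio \<le> 1"
    unfolding edge_ratio_def using \<open>0 < 2 * card W + g * D * (D - 1)\<close>
    by (simp only: divide_le_eq_1_pos of_nat_0_less_iff)
qed

text \<open>One bound for all kinds of queries. \<open>2 * light_loss + 1 / g\<close> covers a pair
  query: two vertices declared light, or two edges in the same clique. \<open>U / D\<close> covers a
  random neighbor that is \<open>z\<close> or already seen, \<open>(2 * U + 1) / card W\<close>
  simulated edges with a seen end or equal ends, and \<open>1 - edge_ratio\<close> true edges
  outside the cliques or with a seen end.\<close>

definition query_loss :: real where
  "query_loss = 2 * light_loss + 1 / g + U / D + (2 * U + 1) / card W + (1 - edge_ratio)"

lemma query_loss_ge:
  "light_loss \<le> query_loss" "2 * light_loss + 1 / g \<le> query_loss"
  "light_loss + (1 - real (D - U) / D) + U / card W \<le> query_loss"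
  "(1 - edge_ratio) + (2 * U + 1) / card W \<le> query_loss" "0 \<le> query_loss"
proof -
  have D: "1 - real (D - U) / D = U / D"
    using U by (simp add: of_nat_diff field_simps)
  have "real U / card W \<le> (2 * U + 1) / card W" by (intro divide_right_mono) auto
  moreover have "0 \<le> 1 / real g" "0 \<le> real U / D" "0 \<le> real (2 * U + 1) / card W" by simp_all
  ultimately show "light_loss \<le> query_loss" "2 * light_loss + 1 / g \<le> query_loss"
    "light_loss + (1 - real (D - U) / D) + U / card W \<le> query_loss"
    "(1 - edge_ratio) + (2 * U + 1) / card W \<le> query_loss" "0 \<le> query_loss"
    using light_loss_nonneg edge_ratio_bounds unfolding query_loss_def D by - linarith+
qed

lemma valid_mono: "valid \<beta> r \<Longrightarrow> r \<le> r' \<Longrightarrow> valid \<beta> r'"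
  by (auto simp: valid_def)

lemma valid_touch:
  assumes "valid \<beta> r" "x \<in> W" "card (dom \<beta>) < U"
  shows "valid (touch x \<beta>) r"
  using assms ran_touch[of x \<beta>] finite_subset[OF _ finite_W, of "dom \<beta>"]
  by (auto simp: valid_def dom_touch card_insert_if)

lemma valid_update:
  assumes "valid \<beta> r" "x \<in> W" "card (dom \<beta>) < U" "i \<le> r"
  shows "valid (\<beta>(x \<mapsto> i)) r"
  using assms finite_subset[OF _ finite_W, of "dom \<beta>"]
  by (auto simp: valid_def card_insert_if ran_def split: if_splits)

lemma card_dom_touch: "card (dom (touch x \<beta>)) \<le> Suc (card (dom \<beta>))"
  unfolding dom_touch by (rule card_insert_le_m1) auto

lemma card_dom_update: "card (dom (\<beta>(x \<mapsto> i))) \<le> Suc (card (dom \<beta>))"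
  by (simp add: card_insert_le_m1)

lemma world_retrieve:
  assumes "\<omega> \<in> worlds (retrieve h \<beta>)" "\<beta> x = Some i"
  shows "\<omega> x = h i"
  using assms by (auto simp: worlds_def retrieve_def)

lemma worlds_nonempty: "admissible \<kappa> \<Longrightarrow> worlds \<kappa> \<noteq> {}"
  using card_worlds_pos by fastforce

lemma mean_failure_0:
  assumes "valid \<beta> r" "\<And>\<omega>. failure V (graph_of \<omega>) S A 0 = 1"
  shows "mean_failure S A 0 \<beta> r = 1"
proof -
  have "world_failure S A 0 (retrieve h \<beta>) = 1" if "h \<in> colourings r" for h
    unfolding world_failure_def using worlds_nonempty[OF admissible_retrieve[OF assms(1) that]] finite_worlds
    by (simp add: assms(2) mean_def)
  then have "mean_failure S A 0 \<beta> r = mean (colourings r) (\<lambda>h. 1)"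
    unfolding mean_failure_def by (intro mean_cong) auto
  then show ?thesis using finite_colourings colourings_nonempty by (simp add: mean_const)
qed

lemma card_fresh_pairs:
  assumes "valid \<beta> r"
  shows "real (card (W \<times> W - {(x, y). x \<in> W - dom \<beta> \<and> y \<in> W - dom \<beta> \<and> x \<noteq> y}))
     \<le> (2 * U + 1) / card W * card (W \<times> W)"
proof -
  have dom: "dom \<beta> \<subseteq> W" "card (dom \<beta>) \<le> U" using assms by (auto simp: valid_def)
  have fin: "finite (dom \<beta>)" using dom finite_W by (blast intro: finite_subset)
  let ?d = "dom \<beta>"
  have "card (W \<times> W - {(x, y). x \<in> W - ?d \<and> y \<in> W - ?d \<and> x \<noteq> y}) \<le> card (?d \<times> W \<union> W \<times> ?d \<union> (\<lambda>x. (x, x)) ` W)"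
    using fin finite_W by (intro card_mono) auto
  also have "\<dots> \<le> card (?d \<times> W) + card (W \<times> ?d) + card ((\<lambda>x. (x, x)) ` W)"
    by (intro card_Un_le[THEN order_trans] add_mono) auto
  also have "\<dots> \<le> U * card W + card W * U + card W"
    using dom(2) finite_W by (intro add_mono) (auto simp: card_cartesian_product card_image_le)
  also have "\<dots> = (2 * U + 1) * card W" by simp
  finally have "real (card (W \<times> W - {(x, y). x \<in> W - ?d \<and> y \<in> W - ?d \<and> x \<noteq> y})) \<le> real ((2 * U + 1) * card W)"
    by (simp only: of_nat_le_iff)
  also have "\<dots> = (2 * U + 1) / card W * card (W \<times> W)"
    using W_ne finite_W by (simp add: card_cartesian_product field_simps)
  finally show ?thesis .
qed

text \<open>True failure is only bounded from below, so whatever the simulator does not foresee is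
  dropped at the price of its probability. The term \<open>2 * j\<close> is there because a query
  makes at most two vertices known; the knowledge thus never exceeds \<open>U\<close>.\<close>

lemma ideal_le_mean_failure:
  assumes "valid \<beta> r" "card (dom \<beta>) + 2 * j \<le> U"
  shows "ideal S A j \<beta> r - j * query_loss \<le> mean_failure S A j \<beta> r"
  using assms
proof (induction A arbitrary: j \<beta> r)
  case (Output x)
  have "world_failure S (Output x) j (retrieve h \<beta>) = of_bool (x \<notin> S)" if "h \<in> colourings r" for h
    unfolding world_failure_def using worlds_nonempty[OF admissible_retrieve[OF Output(1) that]] finite_worlds
    by (simp add: failure_Output mean_def)
  then have "mean_failure S (Output x) j \<beta> r = mean (colourings r) (\<lambda>h. of_bool (x \<notin> S))"
    unfolding mean_failure_def by (intro mean_cong) auto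
  then show ?case using finite_colourings colourings_nonempty query_loss_ge(5) by (simp add: mean_const)
next
  case (Toss p k)
  have int: "integrable p (\<lambda>i. ideal S (k i) j \<beta> r)" "integrable p (\<lambda>i. mean_failure S (k i) j \<beta> r)"
    using ideal_bounds mean_failure_bounds by (auto intro!: integrable_bounded_pmf[where B = 1] simp: abs_le_iff intro: order_trans[of _ 0])
  have "measure_pmf.expectation p (\<lambda>i. ideal S (k i) j \<beta> r - j * query_loss) \<le> measure_pmf.expectation p (\<lambda>i. mean_failure S (k i) j \<beta> r)"
    using Toss int by (intro integral_mono) auto
  then show ?case using int by (simp add: mean_failure_Toss)
next
  case (RandVert k)
  show ?case
  proof (cases j)
    case 0
    then show ?thesis using RandVert.prems by (simp add: mean_failure_0 failure_0)
  next
    case (Suc i)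
    have "mean V (\<lambda>x. ideal S (k x) i \<beta> r) - i * query_loss = mean V (\<lambda>x. ideal S (k x) i \<beta> r - i * query_loss)"
      using finite_V z by (subst mean_diff_const) auto
    also have "\<dots> \<le> mean_failure S (RandVert k) (Suc i) \<beta> r"
      unfolding mean_failure_RandVert using RandVert Suc by (intro mean_mono) auto
    finally show ?thesis using Suc query_loss_ge(5) by (simp add: algebra_simps)
  qed
next
  case (RandNbr x k)
  show ?case
  proof (cases j)
    case 0
    then show ?thesis using RandNbr.prems by (simp add: mean_failure_0 failure_0)
  next
    case (Suc i)
    have IH: "ideal S (k a) i \<beta>' r - i * query_loss \<le> mean_failure S (k a) i \<beta>' r"
      if "valid \<beta>' r" "card (dom \<beta>') + 2 * i \<le> U" for a \<beta>'
      using RandNbr.IH[of "k a" \<beta>' r i] that by simp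
    have dU: "card (dom \<beta>) < U" using RandNbr.prems Suc by simp
    have v: "valid \<beta> r" by fact
    consider "x \<notin> V" | "x = z" | "x \<in> W" "touch x \<beta> x = Some 0" | c where "x \<in> W" "\<beta> x = Some c" "c \<noteq> 0"
      by (cases "\<beta> x") (auto simp: mem_V_iff touch_def)
    then show ?thesis
    proof cases
      case 1
      have "mean_failure S (RandNbr x k) (Suc i) \<beta> r = mean_failure S (k None) i \<beta> r"
        using 1 by (intro mean_failure_cong) (simp add: failure_RandNbr neighbors_outside)
      then show ?thesis
        using IH[OF v, of None] RandNbr.prems 1 Suc query_loss_ge(5) by (simp add: algebra_simps)
    next
      case 2
      have "mean W (\<lambda>y. ideal S (k (Some y)) i \<beta> r) - i * query_loss = mean W (\<lambda>y. ideal S (k (Some y)) i \<beta> r - i * query_loss)"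
        using finite_W W_ne by (subst mean_diff_const) auto
      also have "\<dots> \<le> mean_failure S (RandNbr z k) (Suc i) \<beta> r"
        unfolding mean_failure_RandNbr_z using IH[OF v] RandNbr.prems Suc by (intro mean_mono) auto
      finally show ?thesis
        using 2 z Suc query_loss_ge(5) by (simp add: algebra_simps)
    next
      case 3
      let ?\<beta> = "touch x \<beta>"
      have xV: "x \<in> V" "x \<noteq> z" using 3 z_notin_W by (auto simp: mem_V_iff)
      \<comment> \<open>Once \<open>x\<close> is declared light its only neighbor is
        \<open>z\<close>; \<open>light_loss\<close> pays for the declaration.\<close>
      have "mean_failure S (RandNbr x k) (Suc i) ?\<beta> r = mean_failure S (k (Some z)) i ?\<beta> r"
      proof (rule mean_failure_cong)
        fix h \<omega> assume h: "h \<in> colourings r" and \<omega>: "\<omega> \<in> worlds (retrieve h ?\<beta>)"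
        have "\<omega> x = 0" using world_retrieve[OF \<omega> 3(2)] colourings_0[OF h] by simp
        then show "failure V (graph_of \<omega>) S (RandNbr x k) (Suc i) = failure V (graph_of \<omega>) S (k (Some z)) i"
          using 3(1) by (simp add: failure_RandNbr neighbors_light mean_def)
      qed
      then have "mean_failure S (k (Some z)) i ?\<beta> r - light_loss \<le> mean_failure S (RandNbr x k) (Suc i) \<beta> r"
        using mean_failure_touch[OF v 3(1), of S "RandNbr x k" "Suc i"] by simp
      moreover have "ideal S (k (Some z)) i ?\<beta> r - i * query_loss \<le> mean_failure S (k (Some z)) i ?\<beta> r"
        using RandNbr.prems Suc card_dom_touch[of x \<beta>] by (intro IH valid_touch v 3 dU) auto
      ultimately show ?thesis
        using 3 xV Suc query_loss_ge(1) by (simp add: algebra_simps)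
    next
      case 4
      have xV: "x \<in> V" "x \<noteq> z" using 4 z_notin_W by (auto simp: mem_V_iff)
      have t: "touch x \<beta> x \<noteq> Some 0" using 4 by (simp add: touch_def)
      have c: "c \<le> r" using v 4 by (auto simp: valid_def ran_def)
      have dom: "dom \<beta> \<subseteq> W" "card (dom \<beta>) \<le> U" using v by (auto simp: valid_def)
      \<comment> \<open>The three losses come from later queries, from the factor
        \<open>(D - U) / D\<close>, and from simulated neighbors that are already known.\<close>
      have "mean W (\<lambda>y. ideal S (k (Some y)) i (\<beta>(y \<mapsto> c)) r) - i * query_loss - (1 - real (D - U) / D) - U / card W
         \<le> (real (D - U) / D) * (\<Sum>y\<in>W - dom \<beta>. mean_failure S (k (Some y)) i (\<beta>(y \<mapsto> c)) r) / card W"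
      proof (rule mean_subset_approx)
        show "real (card (W - (W - dom \<beta>))) \<le> real U / card W * card W"
          using dom W_ne finite_W by (simp add: double_diff)
        show "real (D - U) / D \<le> 1" using U by simp
        show "ideal S (k (Some y)) i (\<beta>(y \<mapsto> c)) r - i * query_loss \<le> mean_failure S (k (Some y)) i (\<beta>(y \<mapsto> c)) r"
          if "y \<in> W - dom \<beta>" for y
          using that RandNbr.prems Suc card_dom_update[of \<beta> y c] by (intro IH valid_update v dU c) auto
      qed (use finite_W W_ne ideal_bounds query_loss_ge(5) in auto)
      also have "\<dots> \<le> mean_failure S (RandNbr x k) (Suc i) \<beta> r"
        by (rule mean_failure_RandNbr_heavy[OF v 4(2,3)])
      finally show ?thesis
        using 4 xV t Suc query_loss_ge(3) light_loss_nonneg by (simp add: algebra_simps)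
    qed
  qed
next
  case (Degree x k)
  show ?case
  proof (cases j)
    case 0
    then show ?thesis using Degree.prems by (simp add: mean_failure_0 failure_0)
  next
    case (Suc i)
    have IH: "ideal S (k a) i \<beta>' r - i * query_loss \<le> mean_failure S (k a) i \<beta>' r"
      if "valid \<beta>' r" "card (dom \<beta>') + 2 * i \<le> U" for a \<beta>'
      using Degree.IH[of "k a" \<beta>' r i] that by simp
    have dU: "card (dom \<beta>) < U" using Degree.prems Suc by simp
    have v: "valid \<beta> r" by fact
    have step: "mean_failure S (Degree x k) (Suc i) \<beta>' r = mean_failure S (k a) i \<beta>' r"
      if "\<And>h \<omega>. h \<in> colourings r \<Longrightarrow> \<omega> \<in> worlds (retrieve h \<beta>') \<Longrightarrow> degree (graph_of \<omega>) x = a" for a \<beta>'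
      using that by (intro mean_failure_cong) (simp add: failure_Degree)
    consider "x \<notin> V" | "x = z" | "x \<in> W" "touch x \<beta> x = Some 0" | c where "x \<in> W" "\<beta> x = Some c" "c \<noteq> 0"
      by (cases "\<beta> x") (auto simp: mem_V_iff touch_def)
    then show ?thesis
    proof cases
      case 1
      have "mean_failure S (Degree x k) (Suc i) \<beta> r = mean_failure S (k 0) i \<beta> r"
        using 1 by (intro step degree_outside)
      then show ?thesis
        using IH[OF v, of 0] Degree.prems 1 Suc query_loss_ge(5) by (simp add: algebra_simps)
    next
      case 2
      have "mean_failure S (Degree x k) (Suc i) \<beta> r = mean_failure S (k (card W)) i \<beta> r"
        using 2 degree_z by (intro step) simp
      then show ?thesis
        using IH[OF v, of "card W"] Degree.prems 2 z Suc query_loss_ge(5) by (simp add: algebra_simps)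
    next
      case 3
      let ?\<beta> = "touch x \<beta>"
      have xV: "x \<in> V" "x \<noteq> z" using 3 z_notin_W by (auto simp: mem_V_iff)
      have "mean_failure S (Degree x k) (Suc i) ?\<beta> r = mean_failure S (k 1) i ?\<beta> r"
      proof (rule step)
        fix h \<omega> assume h: "h \<in> colourings r" and \<omega>: "\<omega> \<in> worlds (retrieve h ?\<beta>)"
        have "\<omega> x = 0" using world_retrieve[OF \<omega> 3(2)] colourings_0[OF h] by simp
        then show "degree (graph_of \<omega>) x = 1" using 3(1) by (simp add: degree_light)
      qed
      then have "mean_failure S (k 1) i ?\<beta> r - light_loss \<le> mean_failure S (Degree x k) (Suc i) \<beta> r"
        using mean_failure_touch[OF v 3(1), of S "Degree x k" "Suc i"] by simp
      moreover have "ideal S (k 1) i ?\<beta> r - i * query_loss \<le> mean_failure S (k 1) i ?\<beta> r"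
        using Degree.prems Suc card_dom_touch[of x \<beta>] by (intro IH valid_touch v 3 dU) auto
      ultimately show ?thesis
        using 3 xV Suc query_loss_ge(1) by (simp add: algebra_simps)
    next
      case 4
      have xV: "x \<in> V" "x \<noteq> z" using 4 z_notin_W by (auto simp: mem_V_iff)
      have t: "touch x \<beta> x \<noteq> Some 0" using 4 by (simp add: touch_def)
      have c: "c \<in> {1..r}" using v 4 by (auto simp: valid_def ran_def)
      have "degree (graph_of \<omega>) x = D" if "h \<in> colourings r" "\<omega> \<in> worlds (retrieve h \<beta>)" for h \<omega>
        using degree_heavy[OF worlds_labellings[OF that(2)] 4(1)] world_retrieve[OF that(2) 4(2)] colourings_pos[OF that(1) c]
        by simp
      then have "mean_failure S (Degree x k) (Suc i) \<beta> r = mean_failure S (k D) i \<beta> r"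
        by (intro step)
      then show ?thesis
        using IH[OF v, of D] Degree.prems xV t Suc query_loss_ge(5) by (simp add: algebra_simps)
    qed
  qed
next
  case (PairQuery x y k)
  show ?case
  proof (cases j)
    case 0
    then show ?thesis using PairQuery.prems by (simp add: mean_failure_0 failure_0)
  next
    case (Suc i)
    have IH: "ideal S (k a) i \<beta>' r - i * query_loss \<le> mean_failure S (k a) i \<beta>' r"
      if "valid \<beta>' r" "card (dom \<beta>') + 2 * i \<le> U" for a \<beta>'
      using PairQuery.IH[of "k a" \<beta>' r i] that by simp
    have dU: "Suc (card (dom \<beta>)) < U \<or> Suc (card (dom \<beta>)) = U" using PairQuery.prems Suc by auto
    have v: "valid \<beta> r" by fact
    have step: "mean_failure S (PairQuery x y k) (Suc i) \<beta>' r = mean_failure S (k a) i \<beta>' r"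
      if "\<And>h \<omega>. h \<in> colourings r \<Longrightarrow> \<omega> \<in> worlds (retrieve h \<beta>') \<Longrightarrow> ({x, y} \<in> graph_of \<omega>) = a" for a \<beta>'
      using that by (intro mean_failure_cong) (simp add: failure_PairQuery)
    consider "x \<notin> V \<or> y \<notin> V \<or> x = y" | "x \<in> V" "y \<in> V" "x \<noteq> y" "x = z \<or> y = z" | "x \<in> W" "y \<in> W" "x \<noteq> y"
      by (auto simp: mem_V_iff)
    then show ?thesis
    proof cases
      case 1
      have "mean_failure S (PairQuery x y k) (Suc i) \<beta> r = mean_failure S (k False) i \<beta> r"
        using 1 z_notin_W by (intro step) (auto simp: mem_graph mem_V_iff)
      then show ?thesis
        using IH[OF v, of False] PairQuery.prems 1 Suc query_loss_ge(5) by (auto simp: algebra_simps)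
    next
      case 2
      have "mean_failure S (PairQuery x y k) (Suc i) \<beta> r = mean_failure S (k True) i \<beta> r"
        using 2 by (intro step) (auto simp: mem_graph mem_V_iff)
      then show ?thesis
        using IH[OF v, of True] PairQuery.prems 2 Suc query_loss_ge(5) by (auto simp: algebra_simps)
    next
      case 3
      let ?\<beta>1 = "touch x \<beta>"
      let ?\<beta> = "touch y ?\<beta>1"
      have xV: "x \<in> V" "x \<noteq> z" "y \<in> V" "y \<noteq> z" using 3 z_notin_W by (auto simp: mem_V_iff)
      have v1: "valid ?\<beta>1 r" using PairQuery.prems Suc by (intro valid_touch v 3) auto
      have v2: "valid ?\<beta> r"
        using PairQuery.prems Suc card_dom_touch[of x \<beta>] by (intro valid_touch v1 3) auto
      have cd: "card (dom ?\<beta>) + 2 * i \<le> U"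
        using PairQuery.prems Suc card_dom_touch[of x \<beta>] card_dom_touch[of y ?\<beta>1] by simp
      obtain a b where ab: "?\<beta> x = Some a" "?\<beta> y = Some b"
        by (metis domD dom_touch insertI1 insertI2)
      have ar: "a \<le> r" "b \<le> r" using v2 ab by (auto simp: valid_def ran_def)
      have adj: "({x, y} \<in> graph_of \<omega>) = (h a = h b \<and> h a \<noteq> 0)"
        if "h \<in> colourings r" "\<omega> \<in> worlds (retrieve h ?\<beta>)" for h \<omega>
        using world_retrieve[OF that(2) ab(1)] world_retrieve[OF that(2) ab(2)] 3 z_notin_W
        by (auto simp: mem_graph)
      have touch2: "mean_failure S (PairQuery x y k) (Suc i) ?\<beta> r - 2 * light_loss \<le> mean_failure S (PairQuery x y k) (Suc i) \<beta> r"
        using mean_failure_touch[OF v 3(1), of S "PairQuery x y k" "Suc i"] mean_failure_touch[OF v1 3(2), of S "PairQuery x y k" "Suc i"] by simp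
      have id: "ideal S (PairQuery x y k) (Suc i) \<beta> r = ideal S (k (a = b \<and> a \<noteq> 0)) i ?\<beta> r"
        using xV 3 ab by (simp add: Let_def)
      have "mean_failure S (k (a = b \<and> a \<noteq> 0)) i ?\<beta> r - 1 / g \<le> mean_failure S (PairQuery x y k) (Suc i) ?\<beta> r"
      proof (cases "a = b \<or> a = 0 \<or> b = 0")
        case True
        \<comment> \<open>Same edge number, or a light vertex: every colouring gives the same
          answer.\<close>
        have "mean_failure S (PairQuery x y k) (Suc i) ?\<beta> r = mean_failure S (k (a = b \<and> a \<noteq> 0)) i ?\<beta> r"
        proof (rule step)
          fix h \<omega> assume h: "h \<in> colourings r" "\<omega> \<in> worlds (retrieve h ?\<beta>)"
          show "({x, y} \<in> graph_of \<omega>) = (a = b \<and> a \<noteq> 0)"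
            unfolding adj[OF h] using True colourings_0[OF h(1)] colourings_pos[OF h(1), of a] colourings_pos[OF h(1), of b] ar
            by (cases "a = 0"; cases "b = 0") auto
        qed
        then show ?thesis by simp
      next
        case False
        \<comment> \<open>For two different edges the simulator answers no. This is wrong only for
          colourings that put both into one clique, and there the left-hand side of the comparison
          is at most 0.\<close>
        then have "a \<in> {1..r}" "b \<in> {1..r}" "a \<noteq> b" using ar by auto
        note col = mean_colourings_collision[OF this]
        have "mean_failure S (k False) i ?\<beta> r - 1 / g \<le> mean (colourings r) (\<lambda>h. world_failure S (k False) i (retrieve h ?\<beta>)) - mean (colourings r) (\<lambda>h. of_bool (h a = h b))"
          using col by (simp add: mean_failure_def)
        also have "\<dots> = mean (colourings r) (\<lambda>h. world_failure S (k False) i (retrieve h ?\<beta>) - of_bool (h a = h b))"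
          by (simp add: mean_def sum_subtractf diff_divide_distrib)
        also have "\<dots> \<le> mean_failure S (PairQuery x y k) (Suc i) ?\<beta> r"
          unfolding mean_failure_def
        proof (rule mean_mono)
          fix h assume h: "h \<in> colourings r"
          show "world_failure S (k False) i (retrieve h ?\<beta>) - of_bool (h a = h b) \<le> world_failure S (PairQuery x y k) (Suc i) (retrieve h ?\<beta>)"
          proof (cases "h a = h b")
            case True
            then show ?thesis using world_failure_bounds[of S "k False" i] world_failure_bounds[of S "PairQuery x y k" "Suc i"]
              by (smt (verit) of_bool_eq(2))
          next
            case False
            have "world_failure S (PairQuery x y k) (Suc i) (retrieve h ?\<beta>) = world_failure S (k False) i (retrieve h ?\<beta>)"
              using adj[OF h] False by (intro world_failure_cong) (simp add: failure_PairQuery)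
            then show ?thesis using False by simp
          qed
        qed
        finally show ?thesis using False by simp
      qed
      moreover have "ideal S (k (a = b \<and> a \<noteq> 0)) i ?\<beta> r - i * query_loss \<le> mean_failure S (k (a = b \<and> a \<noteq> 0)) i ?\<beta> r"
        by (rule IH[OF v2 cd])
      ultimately have "ideal S (PairQuery x y k) (Suc i) \<beta> r - i * query_loss - (2 * light_loss + 1 / g) \<le> mean_failure S (PairQuery x y k) (Suc i) \<beta> r"
        using touch2 unfolding id by linarith
      then show ?thesis
        using Suc query_loss_ge(2) by (simp add: algebra_simps del: ideal.simps)
    qed
  qed
next
  case (RandEdge k)
  show ?case
  proof (cases j)
    case 0
    then show ?thesis using RandEdge.prems by (simp add: mean_failure_0 failure_0)
  next
    case (Suc i)
    have v: "valid \<beta> r" by fact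
    let ?P = "{(x, y). x \<in> W - dom \<beta> \<and> y \<in> W - dom \<beta> \<and> x \<noteq> y}"
    let ?b = "\<lambda>x y. \<beta>(x \<mapsto> Suc r, y \<mapsto> Suc r)"
    have "mean (W \<times> W) (\<lambda>(x, y). ideal S (k {x, y}) i (?b x y) (Suc r)) - i * query_loss - (1 - edge_ratio) - (2 * U + 1) / card W
        \<le> edge_ratio * (\<Sum>p\<in>?P. case p of (x, y) \<Rightarrow> mean_failure S (k {x, y}) i (?b x y) (Suc r)) / card (W \<times> W)"
    proof (rule mean_subset_approx)
      show "real (card (W \<times> W - ?P)) \<le> (2 * U + 1) / card W * card (W \<times> W)"
        by (rule card_fresh_pairs[OF v])
      show "(case p of (x, y) \<Rightarrow> ideal S (k {x, y}) i (?b x y) (Suc r)) - i * query_loss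
          \<le> (case p of (x, y) \<Rightarrow> mean_failure S (k {x, y}) i (?b x y) (Suc r))" if mem: "p \<in> ?P" for p
      proof -
        obtain x y where p: "p = (x, y)" "x \<in> W" "y \<in> W" using mem by auto
        have v1: "valid (\<beta>(x \<mapsto> Suc r)) (Suc r)"
          using RandEdge.prems Suc p by (intro valid_update valid_mono[OF v]) auto
        have v2: "valid (?b x y) (Suc r)"
          using RandEdge.prems Suc p card_dom_update[of \<beta> x "Suc r"] by (intro valid_update v1) auto
        have "card (dom (?b x y)) + 2 * i \<le> U"
          using RandEdge.prems Suc card_dom_update[of \<beta> x "Suc r"] card_dom_update[of "\<beta>(x \<mapsto> Suc r)" y "Suc r"] by linarith
        then have "ideal S (k {x, y}) i (?b x y) (Suc r) - i * query_loss \<le> mean_failure S (k {x, y}) i (?b x y) (Suc r)"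
          by (rule RandEdge.IH[OF rangeI v2])
        then show ?thesis using p by simp
      qed
    qed (use finite_W W_ne ideal_bounds edge_ratio_bounds query_loss_ge(5) in auto)
    also have "\<dots> \<le> mean_failure S (RandEdge k) (Suc i) \<beta> r"
      by (rule mean_failure_RandEdge[OF v])
    finally show ?thesis
      using Suc query_loss_ge(4) by (simp add: algebra_simps)
  qed
qed

text \<open>A guarantee for every hidden graph passes to their average, and from there to the
  simulator started without knowledge.\<close>

lemma ideal_empty_le:
  assumes "2 * j \<le> U" and "\<And>\<omega>. \<omega> \<in> labellings \<Longrightarrow> failure V (graph_of \<omega>) S A j \<le> p" "0 \<le> p"
  shows "ideal S A j Map.empty 0 \<le> p + j * query_loss"
proof -
  have "mean_failure S A j Map.empty 0 \<le> p"
    unfolding mean_failure_def world_failure_def using assms worlds_labellings by (intro mean_le) auto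
  moreover have "ideal S A j Map.empty 0 - j * query_loss \<le> mean_failure S A j Map.empty 0"
    using assms by (intro ideal_le_mean_failure) (auto simp: valid_def)
  ultimately show ?thesis by simp
qed

end

section \<open>The lower bound\<close>

context hidden_cliques
begin

text \<open>In the order of \<open>query_loss\<close> the terms contribute \<open>4 * C\<close>, 1,
  2, 10 and 76, each over \<open>s\<close>. In the last one, 64 stems from the edges at
  \<open>z\<close>, as \<open>card W\<close> is below \<open>16 * s ^ 4\<close> and
  \<open>g * D ^ 2\<close> is at least \<open>s ^ 5\<close>; the remaining 12 stems from clique
  members already seen.\<close>

lemma query_loss_le:
  fixes s C :: nat
  assumes D: "D = s\<^sup>2" and s: "3 \<le> s" and gs: "s \<le> g" "g \<le> C * s" and Us: "U \<le> 2 * s"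
    and n: "s ^ 4 \<le> card W + 1" "card W + 1 \<le> 16 * s ^ 4"
  shows "query_loss \<le> (4 * C + 89) / s"
proof -
  define x where "x = real s"
  have x3: "3 \<le> x" using s by (simp add: x_def)
  then have x0: "0 < x" by simp
  have "3 ^ 3 \<le> x ^ 3" using x3 by (intro power_mono) auto
  then have "27 * x \<le> x ^ 3 * x" using x0 by (intro mult_right_mono) auto
  then have x4: "27 * x \<le> x ^ 4" by (simp add: power_Suc2[symmetric] del: power_Suc)
  have W: "x ^ 4 \<le> real (card W) + 1" "real (card W) + 1 \<le> 16 * x ^ 4"
    using n[THEN of_nat_mono[where 'a = real]] by (simp_all add: x_def)
  have U': "real U \<le> 2 * x" using Us by (simp add: x_def)
  have g': "x \<le> real g" "real g \<le> C * x"
    using gs by (simp_all add: x_def flip: of_nat_mult)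
  have D': "real D = x\<^sup>2" using D by (simp add: x_def)
  have half: "x ^ 4 / 2 \<le> real (card W - U)" "x ^ 4 / 2 \<le> real (card W)"
    using W(1) U' x4 x3 small by (simp_all add: of_nat_diff)
  have "light_loss \<le> (C * x * x\<^sup>2) / (x ^ 4 / 2)"
    unfolding light_loss_def using half(1) g'(2) x0 D' by (intro frac_le) (auto intro: mult_right_mono)
  also have "\<dots> = 2 * C / x" using x0 by (simp add: field_simps power2_eq_square power4_eq_xxxx)
  finally have 1: "light_loss \<le> 2 * C / x" .
  have 2: "1 / real g \<le> 1 / x" using g' x0 by (intro divide_left_mono) auto
  have "real U / D \<le> 2 * x / x\<^sup>2" using U' D' x0 by (intro frac_le) auto
  also have "\<dots> = 2 / x" using x0 by (simp add: power2_eq_square)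
  finally have 3: "real U / D \<le> 2 / x" .
  have "real (2 * U + 1) / card W \<le> 5 * x / (x ^ 4 / 2)"
    using U' x3 half(2) by (intro frac_le) auto
  also have "5 * x / (x ^ 4 / 2) = 10 / (x ^ 3)"
    using x0 by (simp add: field_simps power_Suc2[symmetric] power4_eq_xxxx power3_eq_cube)
  also have "\<dots> \<le> 10 / x ^ 1"
    using x3 by (intro divide_left_mono power_increasing) auto
  finally have 4: "real (2 * U + 1) / card W \<le> 10 / x" by simp
  have 5: "1 - edge_ratio \<le> 76 / x"
  proof -
    let ?M = "real (2 * card W + g * D * (D - 1))"
    have D2: "2 \<le> real D" using U by simp
    have M: "?M = 2 * card W + g * D * (real D - 1)" using U by (simp add: of_nat_diff)
    have gD0: "0 < real g * real D * real D" using g D2 by simp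
    have "real g * D * D / 2 \<le> real g * D * (real D - 1)"
      using D2 mult_left_mono[of "real D / 2" "real D - 1" "real g * D"] by (simp add: mult_ac)
    then have Mge: "real g * D * D / 2 \<le> ?M" unfolding M by simp
    then have M0: "0 < ?M" using gD0 by linarith
    have sq: "real g * D * D - real (g * (D - U - 1)\<^sup>2) \<le> real g * D * (2 * (real U + 1))"
    proof -
      have "real (D - U - 1) = real D - (real U + 1)" using U by (simp add: of_nat_diff)
      then have "real (g * (D - U - 1)\<^sup>2) = real g * (real D - (real U + 1))\<^sup>2" by simp
      also have "\<dots> = real g * D * D - real g * D * (2 * (real U + 1)) + real g * (real U + 1)\<^sup>2"
        by (simp add: power2_eq_square algebra_simps)
      finally show ?thesis by simp
    qed
    have "1 - edge_ratio = (?M - real (g * (D - U - 1)\<^sup>2)) / ?M"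
      unfolding edge_ratio_def using M0 by (simp only: diff_divide_distrib) simp
    also have "\<dots> \<le> (2 * card W + real g * D * (2 * (real U + 1))) / ?M"
    proof (rule divide_right_mono)
      have "real g * D * (real D - 1) \<le> real g * D * D"
        by (intro mult_left_mono) auto
      then show "?M - real (g * (D - U - 1)\<^sup>2) \<le> 2 * card W + real g * D * (2 * (real U + 1))"
        using sq unfolding M by simp
    qed simp
    also have "\<dots> \<le> (2 * card W + real g * D * (2 * (real U + 1))) / (real g * D * D / 2)"
      using Mge gD0 M0 by (intro divide_left_mono mult_pos_pos) auto
    also have "\<dots> = 4 * card W / (real g * D * D) + 4 * (real U + 1) / D"
      using g D2 by (simp add: field_simps)
    also have "4 * card W / (real g * D * D) \<le> 4 * (16 * x ^ 4) / (x * x\<^sup>2 * x\<^sup>2)"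
      using W(2) g' D' x0 by (intro frac_le) (auto intro!: mult_mono)
    also have "\<dots> = 64 / x" using x0 by (simp add: field_simps power2_eq_square power4_eq_xxxx)
    also have "4 * (real U + 1) / D \<le> 4 * (3 * x) / x\<^sup>2"
      using U' x3 D' by (intro frac_le) auto
    also have "\<dots> = 12 / x" using x0 by (simp add: power2_eq_square)
    finally show ?thesis using x0 by (simp add: field_simps)
  qed
  have "query_loss \<le> 2 * (2 * C / x) + 1 / x + 2 / x + 10 / x + 76 / x"
    unfolding query_loss_def using 1 2 3 4 5 by linarith
  also have "\<dots> = (4 * C + 89) / s" using x0 by (simp add: x_def add_divide_distrib)
  finally show ?thesis .
qed

lemma average_degree_graph_of:
  assumes "\<omega> \<in> labellings"
  shows "average_degree V (graph_of \<omega>) = (2 * card W + g * D * (D - 1)) / real (card V)"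
  unfolding average_degree_def using card_graph[OF assms] by (metis of_nat_mult of_nat_numeral)

end

section \<open>From the comparison to a bound on the number of queries\<close>

lemma failure_le:
  assumes "outputs_within V E A S q"
  shows "failure V E S A (nat \<lfloor>q\<rfloor>) \<le> 1 / 100"
proof -
  let ?j = "nat \<lfloor>q\<rfloor>"
  have "{(r, t). r \<in> S \<longrightarrow> ?j < t} = - {(r, t). r \<in> S \<and> t \<le> ?j}" by auto
  then have "failure V E S A ?j = 1 - measure_pmf.prob (run V E A) {(r, t). r \<in> S \<and> t \<le> ?j}"
    using measure_pmf.prob_compl[of "{(r, t). r \<in> S \<and> t \<le> ?j}" "run V E A"]
    by (simp add: failure_def Compl_eq_Diff_UNIV)
  moreover have "measure_pmf.prob (run V E A) {(r, t). r \<in> S \<and> real t \<le> q}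
      \<le> measure_pmf.prob (run V E A) {(r, t). r \<in> S \<and> t \<le> ?j}"
    by (intro measure_pmf.finite_measure_mono) (auto simp: le_nat_floor)
  ultimately show ?thesis using assms by (simp add: outputs_within_def)
qed

lemma factor_approximations_disjoint:
  fixes c :: real
  assumes "1 \<le> c" "c\<^sup>2 * d < d'"
  shows "factor_approximations c d \<inter> factor_approximations c d' = {}"
proof (rule ccontr)
  assume "\<not> ?thesis"
  then obtain r where "r \<le> c * d" "d' / c \<le> r" by (auto simp: factor_approximations_def)
  then have "d' / c \<le> c * d" by simp
  then have "d' \<le> c\<^sup>2 * d" using assms(1) by (simp add: field_simps power2_eq_square)
  then show False using assms(2) by simp
qed

text \<open>With fewer queries the total loss is at most \<open>2 / 5\<close> in each of the two
  graph families, so the two simulated failures add up to at most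
  \<open>2 * (1 / 100 + 2 / 5) < 1\<close> although the target sets are disjoint. The constant 65
  makes clique edges outweigh the edges at \<open>z\<close>, so that \<open>s\<close> and
  \<open>C * s\<close> cliques give clearly different average degrees.\<close>

lemma queries_lower_bound:
  fixes c q :: real and C s n :: nat and V :: "'v::linorder set"
  assumes c: "1 \<le> c" and C: "2 * c\<^sup>2 \<le> C" and s: "C + 65 \<le> s" and n: "s ^ 4 \<le> n" "n \<le> 16 * s ^ 4"
    and V: "finite V" "card V = n"
    and alg: "\<And>E. simple_graph V E \<Longrightarrow> no_isolated_vertices V E \<Longrightarrow>
      outputs_within V E A (factor_approximations c (average_degree V E)) q"
  shows "2 * s / (5 * (4 * C + 89)) \<le> q"
proof (rule ccontr)
  assume "\<not> ?thesis"
  then have q: "q < 2 * s / (5 * (4 * C + 89))" by simp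
  define j where "j = nat \<lfloor>q\<rfloor>"
  define U where "U = 2 * j"
  define D where "D = s\<^sup>2"
  have s0: "0 < real s" using s by simp
  \<comment> \<open>\<open>q\<close> may be negative, in which case \<open>nat\<close> yields
    0.\<close>
  have "real j \<le> q \<or> j = 0"
    unfolding j_def by linarith
  then have "real j \<le> 2 * s / (5 * (4 * C + 89))"
    using q by auto
  then have j: "real j * (4 * C + 89) \<le> 2 / 5 * s" by (simp add: field_simps)
  have "real j * 1 \<le> real j * (4 * C + 89)" by (intro mult_left_mono) auto
  then have "real j \<le> real s" using j s0 by simp
  then have U: "U \<le> 2 * s" by (simp add: U_def)
  have C2: "2 \<le> C"
  proof -
    have "2 * 1 \<le> 2 * c\<^sup>2" using c by (intro mult_left_mono one_le_power) auto
    then have "2 \<le> real C" using C by simp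
    then show ?thesis by simp
  qed
  have n2: "2 \<le> n"
  proof -
    have "2 ^ 1 \<le> s ^ 1" using s by simp
    also have "\<dots> \<le> s ^ 4" using s by (intro power_increasing) auto
    finally show ?thesis using n by simp
  qed
  obtain z where z: "z \<in> V" using V n2 by (metis card.empty ex_in_conv not_numeral_le_zero)
  define W where "W = V - {z}"
  have cW: "card W + 1 = n" using V z n2 by (simp add: W_def)
  \<comment> \<open>Room in \<open>W\<close> for up to \<open>C * s\<close> cliques of size
    \<open>s ^ 2\<close> and for the seen vertices.\<close>
  have s3: "65 * s ^ 3 + C * s ^ 3 \<le> s ^ 4"
    using mult_right_mono[OF s, of "s ^ 3"] by (simp add: algebra_simps power_Suc[symmetric] del: power_Suc)
  have s13: "s \<le> s ^ 3" "1 \<le> s ^ 3"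
    using s power_increasing[of 1 3 s] by auto
  interpret view: hidden_cliques_view V z D
    using V z n2 cW by unfold_locales (auto simp: W_def[symmetric])
  have viewW: "view.W = W" by (simp add: view.W_def W_def)
  have loc: "hidden_cliques V z D g U" if "1 \<le> g" "g \<le> C * s" for g
  proof
    show "1 \<le> g" by fact
    have "3 * s \<le> s\<^sup>2" using mult_right_mono[of 3 s s] s by (simp add: power2_eq_square)
    then show "U + 1 < D" using U s unfolding D_def by linarith
    have "g * D \<le> C * s * D" using that by (intro mult_right_mono) auto
    also have "\<dots> = C * s ^ 3" by (simp add: D_def power2_eq_square power3_eq_cube)
    finally show "g * D + U < card view.W"
      using s3 s13 n(1) cW U unfolding viewW by linarith
  qed
  interpret H1: hidden_cliques V z D s U
    using s C2 by (intro loc) auto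
  interpret H2: hidden_cliques V z D "C * s" U
    using s C2 by (intro loc) auto
  let ?X = "real s * D * (real D - 1)"
  define d1 where "d1 = (2 * card W + ?X) / n"
  define d2 where "d2 = (2 * card W + C * ?X) / n"
  have D1: "1 \<le> D" using s by (simp add: D_def)
  have d1: "average_degree V (H1.graph_of \<omega>) = d1" if "\<omega> \<in> H1.labellings" for \<omega>
    using H1.average_degree_graph_of[OF that] V D1 by (simp add: d1_def viewW of_nat_diff)
  have d2: "average_degree V (H2.graph_of \<omega>) = d2" if "\<omega> \<in> H2.labellings" for \<omega>
    using H2.average_degree_graph_of[OF that] V D1 by (simp add: d2_def viewW of_nat_diff mult_ac)
  have X: "2 * card W < ?X"
  proof -
    have "2 * card W < 65 / 2 * real s ^ 4"
      using cW n(2)[THEN of_nat_mono[where 'a = real]] s0 by simp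
    also have "\<dots> \<le> real s / 2 * real s ^ 4"
      using s by (intro mult_right_mono) auto
    also have "\<dots> = real s * D * (real D / 2)"
      by (simp add: D_def power2_eq_square power4_eq_xxxx)
    also have "\<dots> \<le> ?X"
    proof (rule mult_left_mono)
      have "2 ^ 2 \<le> s ^ 2" using s by (intro power_mono) auto
      then have "4 \<le> real D" unfolding D_def by (simp flip: of_nat_power)
      then show "real D / 2 \<le> real D - 1" by simp
    qed simp
    finally show ?thesis .
  qed
  \<comment> \<open>By \<open>X\<close> the smaller degree sum is below \<open>2 * ?X\<close>, and
    \<open>2 * c ^ 2 <= C\<close>.\<close>
  have "c\<^sup>2 * d1 < d2"
  proof -
    have "c\<^sup>2 * (2 * card W) < c\<^sup>2 * ?X"
      using X c by (intro mult_strict_left_mono) auto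
    moreover have "2 * c\<^sup>2 * ?X \<le> C * ?X"
      using X C by (intro mult_right_mono) auto
    ultimately have "c\<^sup>2 * (2 * card W + ?X) < 2 * card W + C * ?X"
      by (simp add: algebra_simps)
    then have "c\<^sup>2 * (2 * card W + ?X) / n < (2 * card W + C * ?X) / n"
      using n2 by (intro divide_strict_right_mono) auto
    then show ?thesis by (simp add: d1_def d2_def)
  qed
  then have disj: "factor_approximations c d1 \<inter> factor_approximations c d2 = {}"
    using c by (intro factor_approximations_disjoint)
  have f1: "failure V (H1.graph_of \<omega>) (factor_approximations c d1) A j \<le> 1 / 100" if "\<omega> \<in> H1.labellings" for \<omega>
  proof -
    interpret query_graph V "H1.graph_of \<omega>" by (rule H1.query_graph)
    show ?thesis using failure_le[OF alg[OF graph no_isolated]] d1[OF that] by (simp add: j_def)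
  qed
  have f2: "failure V (H2.graph_of \<omega>) (factor_approximations c d2) A j \<le> 1 / 100" if "\<omega> \<in> H2.labellings" for \<omega>
  proof -
    interpret query_graph V "H2.graph_of \<omega>" by (rule H2.query_graph)
    show ?thesis using failure_le[OF alg[OF graph no_isolated]] d2[OF that] by (simp add: j_def)
  qed
  have l1: "H1.query_loss \<le> (4 * C + 89) / s"
    using s C2 U n cW by (intro H1.query_loss_le[OF D_def]) (auto simp: viewW)
  have l2: "H2.query_loss \<le> (4 * C + 89) / s"
    using s C2 U n cW by (intro H2.query_loss_le[OF D_def]) (auto simp: viewW)
  have small_loss: "j * l \<le> 2 / 5" if "l \<le> (4 * C + 89) / s" for l :: real
  proof -
    have "j * l \<le> j * ((4 * C + 89) / s)" using that by (intro mult_left_mono) auto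
    also have "\<dots> \<le> 2 / 5" using j s0 by (simp add: field_simps)
    finally show ?thesis .
  qed
  have "1 \<le> view.ideal (factor_approximations c d1) A j Map.empty 0 + view.ideal (factor_approximations c d2) A j Map.empty 0"
    by (rule view.ideal_disjoint[OF disj])
  also have "\<dots> \<le> (1 / 100 + j * H1.query_loss) + (1 / 100 + j * H2.query_loss)"
    using f1 f2 by (intro add_mono H1.ideal_empty_le H2.ideal_empty_le) (auto simp: U_def)
  also have "\<dots> \<le> (1 / 100 + 2 / 5) + (1 / 100 + 2 / 5)"
    using small_loss[OF l1] small_loss[OF l2] by linarith
  finally show False by simp
qed

text \<open>\<open>s\<close> is \<open>n powr (1 / 4)\<close> rounded down. Rounding loses less than
  1, which explains 66 in place of 65, and at most a factor 2, which gives
  \<open>n <= 16 * s ^ 4\<close> and uses up the factor 2 of the preceding bound.\<close>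

theorem constant_factor_lower_bound:
  fixes c :: real
  assumes c: "1 \<le> c"
  shows "\<exists>\<delta>>0. \<forall>\<^sub>F n in sequentially.
    \<forall>(V :: nat set) (A :: nat algorithm) (q::real).
      finite V \<and> card V = n \<and>
      (\<forall>E. simple_graph V E \<and> no_isolated_vertices V E \<longrightarrow>
         outputs_within V E A (factor_approximations c (average_degree V E)) q) \<longrightarrow>
      q \<ge> \<delta> * real n powr (1 / 4)"
proof -
  define C where "C = nat \<lceil>2 * c\<^sup>2\<rceil>"
  have C: "2 * c\<^sup>2 \<le> C" unfolding C_def by (rule real_nat_ceiling_ge)
  let ?\<delta> = "1 / (5 * (4 * real C + 89))"
  have "\<delta>' \<le> q" if large: "(C + 66) ^ 4 \<le> n" and \<delta>': "\<delta>' = ?\<delta> * real n powr (1 / 4)" and V: "finite V" "card V = n"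
    and alg: "\<forall>E. simple_graph V E \<and> no_isolated_vertices V E \<longrightarrow>
         outputs_within V E A (factor_approximations c (average_degree V E)) q"
    for n and V :: "nat set" and A q \<delta>'
  proof -
    define y where "y = real n powr (1 / 4)"
    define s where "s = nat \<lfloor>y\<rfloor>"
    have n0: "0 < n" using large by (cases n) auto
    have y0: "0 \<le> y" by (simp add: y_def)
    have y4: "y ^ 4 = n" using n0 by (simp add: y_def powr_power)
    have "real (C + 66) ^ 4 \<le> y ^ 4"
      unfolding y4 using large[THEN of_nat_mono[where 'a = real]] by (simp only: of_nat_power)
    then have yC: "real (C + 66) \<le> y" using y0 by (simp only: power_mono_iff zero_less_numeral of_nat_0_le_iff)
    have sy: "real s \<le> y" "y < real s + 1" unfolding s_def using y0 by linarith+
    have s: "C + 65 \<le> s" using yC sy by simp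
    have y2: "y \<le> 2 * real s" using sy s by simp
    have "real s ^ 4 \<le> real n" unfolding y4[symmetric] using sy by (intro power_mono) auto
    then have n1: "s ^ 4 \<le> n" by (simp flip: of_nat_power)
    have "real n \<le> (2 * real s) ^ 4" unfolding y4[symmetric] using y2 y0 by (intro power_mono) auto
    also have "\<dots> = real (16 * s ^ 4)" by (simp add: power_mult_distrib)
    finally have n2: "n \<le> 16 * s ^ 4" by (simp only: of_nat_le_iff)
    have "2 * s / (5 * (4 * C + 89)) \<le> q"
      using alg by (intro queries_lower_bound[OF c C s n1 n2 V]) auto
    moreover have "\<delta>' \<le> ?\<delta> * (2 * real s)"
      unfolding \<delta>' using y2 by (intro mult_left_mono) (simp_all add: y_def)
    moreover have "?\<delta> * (2 * real s) = 2 * s / (5 * (4 * C + 89))" by simp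
    ultimately show ?thesis by linarith
  qed
  then have "\<forall>\<^sub>F n in sequentially. \<forall>(V :: nat set) (A :: nat algorithm) (q::real).
      finite V \<and> card V = n \<and>
      (\<forall>E. simple_graph V E \<and> no_isolated_vertices V E \<longrightarrow>
         outputs_within V E A (factor_approximations c (average_degree V E)) q) \<longrightarrow>
      q \<ge> ?\<delta> * real n powr (1 / 4)"
    by (intro eventually_sequentiallyI[of "(C + 66) ^ 4"]) blast
  moreover have "0 < ?\<delta>" by simp
  ultimately show ?thesis by blast
qed

theorem theorem1p1:
  shows
    "(\<exists>(L :: nat \<Rightarrow> real) (A :: real \<Rightarrow> nat \<Rightarrow> nat algorithm).
        polylog L \<and>
        (\<forall>(\<epsilon>::real) (n::nat) (V :: nat set) (E :: nat set set).
           0 < \<epsilon> \<and> \<epsilon> < 1 \<and> simple_graph V E \<and> no_isolated_vertices V E \<and> card V = n \<longrightarrow>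
           (let d = average_degree V E in
              outputs_within V E (A \<epsilon> n) (eps_approximations \<epsilon> d)
                (L n * (1 / \<epsilon>\<^sup>2 * min d (root 3 (real n / d)))) \<and>
              outputs_within V E (A \<epsilon> n) (eps_approximations \<epsilon> d)
                (L n * (1 / \<epsilon>\<^sup>2 * real n powr (1 / 4)))))) \<and>
     (\<forall>c::real. c \<ge> 1 \<longrightarrow>
        (\<exists>\<delta>>0. \<forall>\<^sub>F n in sequentially.
           \<forall>(V :: nat set) (A :: nat algorithm) (q::real).
             finite V \<and> card V = n \<and>
             (\<forall>E. simple_graph V E \<and> no_isolated_vertices V E \<longrightarrow>
                outputs_within V E A (factor_approximations c (average_degree V E)) q) \<longrightarrow>
             q \<ge> \<delta> * real n powr (1 / 4)))"
proof (intro conjI allI impI)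
  show "\<exists>(L :: nat \<Rightarrow> real) (A :: real \<Rightarrow> nat \<Rightarrow> nat algorithm).
        polylog L \<and>
        (\<forall>(\<epsilon>::real) (n::nat) (V :: nat set) (E :: nat set set).
           0 < \<epsilon> \<and> \<epsilon> < 1 \<and> simple_graph V E \<and> no_isolated_vertices V E \<and> card V = n \<longrightarrow>
           (let d = average_degree V E in
              outputs_within V E (A \<epsilon> n) (eps_approximations \<epsilon> d)
                (L n * (1 / \<epsilon>\<^sup>2 * min d (root 3 (real n / d)))) \<and>
              outputs_within V E (A \<epsilon> n) (eps_approximations \<epsilon> d)
                (L n * (1 / \<epsilon>\<^sup>2 * real n powr (1 / 4)))))"
  proof (rule exI[of _ "\<lambda>n. 252720000 * ln (real n) ^ 1"], rule exI[of _ degree_estimator], intro conjI allI impI)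
    show "polylog (\<lambda>n. 252720000 * ln (real n) ^ 1)"
      unfolding polylog_def by (intro exI[of _ 252720000] conjI exI[of _ 1] allI refl) simp
  qed (unfold Let_def, intro conjI degree_estimator_correct, blast+)
next
  fix c :: real
  assume "1 \<le> c"
  then show "\<exists>\<delta>>0. \<forall>\<^sub>F n in sequentially.
           \<forall>(V :: nat set) (A :: nat algorithm) (q::real).
             finite V \<and> card V = n \<and>
             (\<forall>E. simple_graph V E \<and> no_isolated_vertices V E \<longrightarrow>
                outputs_within V E A (factor_approximations c (average_degree V E)) q) \<longrightarrow>
             q \<ge> \<delta> * real n powr (1 / 4)"
    by (rule constant_factor_lower_bound)
qed

end
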